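(* Let $s\ge 1$ be an integer, $m=[s/2]$, and let $\alpha>0$. Let $\psi_i$ be the explicit eigenfunctions of the Whittaker--Hill operator $L=-\frac{d^2}{dx^2}-(4\alpha s\cos 2x+2\alpha^2\cos 4x)$ defined in the context, indexed by $i\in\{0,1,\dots,2m\}$ if $s=2m+1$ is odd and by $i\in\{1,\dots,2m\}$ if $s=2m$ is even. Let $I=\{i_1,\dots,i_k\}$ be a nonempty subset of the index set. If the Wronskian $W_I(x)=W(\psi_{i_1},\dots,\psi_{i_k})(x)$ has no real zeros, then $I$ is a cluster subset.
   Context: Write $D=\frac{d}{dx}$. Eigenfunctions. Put $K=-D^2+4\alpha(\sin 2x)D-4(s-1)\alpha\cos 2x$. If $\varphi$ satisfies $K\varphi=\nu\varphi$, then $\psi=\varphi e^{\alpha\cos 2x}$ satisfies $L\psi=\lambda\psi$ with $\lambda=\nu-2\alpha^2$. For odd $s=2m+1$, $K$ preserves the $s$-dimensional space spanned by $1,\cos 2jx,\sin 2jx$ ($1\le j\le m$). For even $s=2m$, $K$ preserves the $s$-dimensional space spanned by $\cos(2j-1)x,\sin(2j-1)x$ ($1\le j\le m$). For $\alpha>0$ the restriction of $K$ to this space has $s$ distinct real eigenvalues. They are listed in increasing order as $\nu_0<\nu_1<\dots<\nu_{2m}$ if $s=2m+1$, and as $\nu_1<\dots<\nu_{2m}$ if $s=2m$. Let $\varphi_i$ be the corresponding real eigenfunctions in this space (unique up to a nonzero scalar), and let $\psi_i=\varphi_i e^{\alpha\cos 2x}$. Cluster subsets. A cluster is any pair $\{2j-1,2j\}$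 with $1\le j\le m$ and, when $s=2m+1$ is odd, also the single-element set $\{0\}$. A cluster subset of the index set is a subset that is a union of clusters. Equivalently, for each $j=1,\dots,m$ it contains $2j-1$ if and only if it contains $2j$. $W(f_1,\dots,f_k)=\det\big(D^{p-1}f_q\big)_{p,q=1}^k$ denotes the Wronskian. *)

theory Defs
  imports "HOL-Analysis.Analysis" "Jordan_Normal_Form.Determinant"
begin

definition whittaker_hill_op :: "real \<Rightarrow> nat \<Rightarrow> (real \<Rightarrow> real) \<Rightarrow> real \<Rightarrow> real" where
  "whittaker_hill_op \<alpha> s f = (\<lambda>x. - (deriv ^^ 2) f x
     - (4 * \<alpha> * real s * cos (2 * x) + 2 * \<alpha>\<^sup>2 * cos (4 * x)) * f x)"

text \<open>The operator obtained from the Whittaker--Hill operator by conjugation with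
  \<open>exp (\<alpha> cos 2x)\<close>; see \<open>whittaker_hill_op_gauge\<close> below.\<close>

definition gauged_op :: "real \<Rightarrow> nat \<Rightarrow> (real \<Rightarrow> real) \<Rightarrow> real \<Rightarrow> real" where
  "gauged_op \<alpha> s f = (\<lambda>x. - (deriv ^^ 2) f x + 4 * \<alpha> * sin (2 * x) * deriv f x
     - 4 * (real s - 1) * \<alpha> * cos (2 * x) * f x)"

text \<open>The span is written out with explicit coefficients, since functions into the reals
  are not an instance of the class of real vector spaces.\<close>

definition trig_space :: "nat \<Rightarrow> (real \<Rightarrow> real) set" where
  "trig_space s =
     (if odd s
      then {f. \<exists>c a b. f = (\<lambda>x. c + (\<Sum>j = 1..s div 2.
              a j * cos (2 * real j * x) + b j * sin (2 * real j * x)))}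
      else {f. \<exists>a b. f = (\<lambda>x. \<Sum>j = 1..s div 2.
              a j * cos ((2 * real j - 1) * x) + b j * sin ((2 * real j - 1) * x))})"

definition is_eigenfunction :: "real \<Rightarrow> nat \<Rightarrow> real \<Rightarrow> (real \<Rightarrow> real) \<Rightarrow> bool" where
  "is_eigenfunction \<alpha> s \<mu> f \<longleftrightarrow>
     f \<in> trig_space s \<and> f \<noteq> (\<lambda>x. 0) \<and> gauged_op \<alpha> s f = (\<lambda>x. \<mu> * f x)"

definition eigenvalues :: "real \<Rightarrow> nat \<Rightarrow> real set" where
  "eigenvalues \<alpha> s = {\<mu>. \<exists>f. is_eigenfunction \<alpha> s \<mu> f}"

definition index_set :: "nat \<Rightarrow> nat set" where
  "index_set s = (if odd s then {0..2 * (s div 2)} else {1..2 * (s div 2)})"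

definition clusters :: "nat \<Rightarrow> nat set set" where
  "clusters s = {{2 * j - 1, 2 * j} | j. 1 \<le> j \<and> j \<le> s div 2} \<union> (if odd s then {{0}} else {})"

definition cluster_subset :: "nat \<Rightarrow> nat set \<Rightarrow> bool" where
  "cluster_subset s I \<longleftrightarrow> (\<exists>\<C>. \<C> \<subseteq> clusters s \<and> I = \<Union>\<C>)"

text \<open>Rows and columns are numbered from 0, so row \<open>p\<close> holds the derivatives of order \<open>p\<close>.\<close>

definition wronskian :: "(real \<Rightarrow> real) list \<Rightarrow> real \<Rightarrow> real" where
  "wronskian fs x = Determinant.det
     (Matrix.mat (length fs) (length fs) (\<lambda>(p, q). (deriv ^^ p) (fs ! q) x))"

lemma whittaker_hill_op_gauge:
  assumes f: "\<And>x. (f has_real_derivative f' x) (at x)"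
    and f': "\<And>x. (f' has_real_derivative f'' x) (at x)"
    and eig: "gauged_op \<alpha> s f = (\<lambda>x. \<mu> * f x)"
  shows "whittaker_hill_op \<alpha> s (\<lambda>x. f x * exp (\<alpha> * cos (2 * x)))
    = (\<lambda>x. (\<mu> - 2 * \<alpha>\<^sup>2) * (f x * exp (\<alpha> * cos (2 * x))))"
proof
  fix x :: real
  let ?e = "\<lambda>x. exp (\<alpha> * cos (2 * x))"
  let ?g = "\<lambda>x. f x * ?e x"
  let ?g' = "\<lambda>x. (f' x - 2 * \<alpha> * sin (2 * x) * f x) * ?e x"
  let ?g'' = "\<lambda>x. (f'' x - 4 * \<alpha> * sin (2 * x) * f' x
     + (4 * \<alpha>\<^sup>2 * (sin (2 * x))\<^sup>2 - 4 * \<alpha> * cos (2 * x)) * f x) * ?e x"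
  have df: "deriv f = f'" "deriv f' = f''"
    using f f' by (auto intro!: ext DERIV_imp_deriv)
  have "deriv ?g y = ?g' y" for y
    by (rule DERIV_imp_deriv) (auto intro!: derivative_eq_intros f simp: algebra_simps)
  then have dg: "deriv ?g = ?g'" by blast
  have "deriv ?g' y = ?g'' y" for y
    by (rule DERIV_imp_deriv)
      (auto intro!: derivative_eq_intros f f' simp: algebra_simps power2_eq_square)
  then have dg': "deriv ?g' = ?g''" by blast
  have c4: "cos (4 * x) = 1 - 2 * (sin (2 * x))\<^sup>2"
    using cos_double_sin[of "2 * x"] by simp
  have K: "\<mu> * f x = - f'' x + 4 * \<alpha> * sin (2 * x) * f' x - 4 * (real s - 1) * \<alpha> * cos (2 * x) * f x"
    using fun_cong[OF eig, of x] by (simp add: gauged_op_def numeral_2_eq_2 df)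
  have "whittaker_hill_op \<alpha> s ?g x
      = (- f'' x + 4 * \<alpha> * sin (2 * x) * f' x - 4 * (real s - 1) * \<alpha> * cos (2 * x) * f x
          - 2 * \<alpha>\<^sup>2 * f x) * ?e x"
    unfolding whittaker_hill_op_def numeral_2_eq_2 funpow.simps o_def id_def
    by (simp only: dg dg' c4 flip: numeral_2_eq_2) (simp add: algebra_simps)
  also have "\<dots> = (\<mu> - 2 * \<alpha>\<^sup>2) * ?g x"
    by (simp only: K[symmetric]) (simp add: algebra_simps)
  finally show "whittaker_hill_op \<alpha> s ?g x = (\<mu> - 2 * \<alpha>\<^sup>2) * ?g x" .
qed

end

theory Submission
  imports Defs
begin

text \<open>Suppose that \<open>W\<^sub>I\<close> has no zeros. The Crum--Darboux transformation attached to \<open>W\<^sub>I\<close> is then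
  regular on the whole line. It turns the solutions of \<open>L y = l y\<close> into those of another Sturm--Liouville
  system; it flips the parity of every solution when the cardinality of \<open>I\<close> is odd, preserves
  it when this cardinality is even, and annihilates \<open>\<psi>\<^sub>i\<close> for \<open>i \<in> I\<close>.

  Counting zeros of trigonometric polynomials against Pruefer angles shows that \<open>\<psi>\<^bsub>2j-1\<^esub>\<close> and \<open>\<psi>\<^bsub>2j\<^esub>\<close>
  have opposite parity and angles that turn equally often over \<open>[0, \<pi>]\<close>, so that for \<open>l\<close> strictly between their
  eigenvalues no solution is of one parity type at 0 and of the other at \<open>\<pi>\<close>.
  Suppose that exactly one of the two indices lies in \<open>I\<close>. Let \<open>y\<^sub>l\<close> be the solution whose type at 0 is that of
  the eigenfunction outside \<open>I\<close>. Its transform never vanishes to second order, has the same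
  type at \<open>\<pi>\<close> for both eigenvalues, and never has the opposite type in between. By continuity in \<open>l\<close> its
  Pruefer angle at \<open>\<pi>\<close> is the same for both eigenvalues, which contradicts the strict monotonicity of
  the angle in \<open>l\<close>.\<close>

section \<open>Pruefer angles\<close>

text \<open>Neither a definite parity nor the oscillation of the eigenfunctions is given; one count
  yields both. A nonzero even or odd part of \<phi>_i solves the same equation and is multiplied by
  (-1)^(s-1) when x grows by pi, so its angle makes an integer number n of half turns over [0, pi],
  where n has the parity of s - 1. Every half turn costs a zero in [0, pi), and there are at most s
  - 1 of these. As functions of the index these numbers increase weakly, and strictly within one
  parity, so the s indices have just enough room. Attributing the other parity to a single index
  would destroy the fit, so each \<phi>_i is purely even or odd.

  The delicate point for y_l is the eigenvalue of the \<psi>_j with j in I, where the transformation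
  has a kernel. The kernel is spanned by \<psi>_j, whose type is opposite to that of y_l; hence y_l
  lies outside it, while at pi the component of y_l along \<psi>_j is removed and the wanted type
  remains. The transformed functions satisfy a first-order system with continuous coefficients, so
  angles can be compared without a formula for the new potential.\<close>

lemma nonincreasing_within:
  fixes f :: "real \<Rightarrow> real"
  assumes "a \<le> b"
    and der: "\<And>x. x \<in> {a..b} \<Longrightarrow> (f has_real_derivative f' x) (at x within {a..b})"
    and neg: "\<And>x. x \<in> {a<..<b} \<Longrightarrow> f' x \<le> 0"
  shows "f b \<le> f a"
proof (rule DERIV_nonpos_imp_decreasing_open[OF \<open>a \<le> b\<close>])
  show "continuous_on {a..b} f"
    using der by (rule DERIV_continuous_on)
  fix x assume x: "a < x" "x < b"
  then have "(f has_real_derivative f' x) (at x)"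
    using der[of x] by (simp add: at_within_Icc_at)
  then show "\<exists>y. (f has_real_derivative y) (at x) \<and> y \<le> 0"
    using neg[of x] x by auto
qed

text \<open>For supersolutions only an upper bound on the derivative is available. To the right of
  the last point where \<open>d\<close> is nonpositive this bound reads d' <= C d, so d exp(-C x)
  cannot increase.\<close>

lemma gronwall_nonpos:
  fixes d :: "real \<Rightarrow> real"
  assumes der: "\<And>x. x \<in> {0..c} \<Longrightarrow> (d has_real_derivative d' x) (at x within {0..c})"
    and bd: "\<And>x. x \<in> {0..c} \<Longrightarrow> d' x \<le> C * \<bar>d x\<bar>"
    and "d 0 \<le> 0" and x: "x \<in> {0..c}"
  shows "d x \<le> 0"
proof (rule ccontr)
  assume pos: "\<not> d x \<le> 0"
  define S where "S = {y \<in> {0..x}. d y \<le> 0}"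
  have cont: "continuous_on {0..x} d"
    by (rule continuous_on_subset[OF DERIV_continuous_on[OF der]]) (use x in auto)
  have "closed S"
    unfolding S_def using continuous_on_closed_Collect_le[OF cont continuous_on_const] by simp
  moreover have "bounded S"
    by (rule bounded_subset[of "{0..x}"]) (auto simp: S_def)
  ultimately have "compact S"
    by (simp add: compact_eq_bounded_closed)
  moreover have "S \<noteq> {}"
    using assms by (auto simp: S_def)
  ultimately obtain x0 where x0: "x0 \<in> S" "\<And>y. y \<in> S \<Longrightarrow> y \<le> x0"
    using compact_attains_sup[of S] by blast
  then have x0': "0 \<le> x0" "x0 \<le> x" "d x0 \<le> 0"
    by (auto simp: S_def)
  have gt: "d y > 0" if "x0 < y" "y < x" for y
    using x0(2)[of y] that x0' by (force simp: S_def)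
  have "d x * exp (- C * x) \<le> d x0 * exp (- C * x0)"
  proof (rule nonincreasing_within[OF x0'(2)])
    fix y assume y: "y \<in> {x0..x}"
    have "(d has_real_derivative d' y) (at y within {x0..x})"
      by (rule DERIV_subset[OF der]) (use y x0' x in auto)
    then show "((\<lambda>y. d y * exp (- C * y)) has_real_derivative (d' y - C * d y) * exp (- C * y)) (at y within {x0..x})"
      by (auto intro!: derivative_eq_intros simp: algebra_simps)
  next
    fix y assume y: "y \<in> {x0<..<x}"
    then show "(d' y - C * d y) * exp (- C * y) \<le> 0"
      using bd[of y] gt[of y] x0' x by (auto simp: mult_le_0_iff)
  qed
  also have "\<dots> \<le> 0"
    using x0' by (simp add: mult_nonpos_nonneg)
  finally show False
    using pos by (simp add: mult_le_0_iff)
qed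

text \<open>Where d <= 0 the bound reads d' <= - C d, so d exp(C x) is nonincreasing; its last value
  is nonnegative, hence so are all earlier ones. This rigidity is what makes the comparisons of
  angles strict.\<close>

lemma gronwall_zero:
  fixes d :: "real \<Rightarrow> real"
  assumes der: "\<And>x. x \<in> {0..c} \<Longrightarrow> (d has_real_derivative d' x) (at x within {0..c})"
    and bd: "\<And>x. x \<in> {0..c} \<Longrightarrow> d' x \<le> C * \<bar>d x\<bar>"
    and "d 0 \<le> 0" "0 \<le> d c" and x: "x \<in> {0..c}"
  shows "d x = 0"
proof -
  note np = gronwall_nonpos[OF der bd \<open>d 0 \<le> 0\<close>]
  have "d c * exp (C * c) \<le> d x * exp (C * x)"
  proof (rule nonincreasing_within[where f = "\<lambda>y. d y * exp (C * y)"])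
    show "x \<le> c" using x by simp
  next
    fix y assume y: "y \<in> {x..c}"
    have "(d has_real_derivative d' y) (at y within {x..c})"
      by (rule DERIV_subset[OF der]) (use y x in auto)
    then show "((\<lambda>y. d y * exp (C * y)) has_real_derivative (d' y + C * d y) * exp (C * y)) (at y within {x..c})"
      by (auto intro!: derivative_eq_intros simp: algebra_simps)
  next
    fix y assume y: "y \<in> {x<..<c}"
    then show "(d' y + C * d y) * exp (C * y) \<le> 0"
      using bd[of y] np[of y] x by (auto simp: mult_le_0_iff)
  qed
  moreover have "0 \<le> d c * exp (C * c)"
    using assms by simp
  ultimately have "0 \<le> d x"
    by (metis exp_gt_zero order.trans zero_le_mult_iff not_le order_less_imp_not_less)
  with np[OF _ _ x] show ?thesis
    by simp
qed

text \<open>The angle \<open>\<theta>\<close> of a solution \<open>(y, z)\<close> of \<open>y' = - \<beta> y + z\<close>, \<open>z' = \<beta> z + (g - l) y\<close>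
  satisfies \<open>prufer \<beta> g l c \<theta>\<close>.\<close>

definition prufer_rhs :: "(real \<Rightarrow> real) \<Rightarrow> (real \<Rightarrow> real) \<Rightarrow> real \<Rightarrow> real \<Rightarrow> real \<Rightarrow> real" where
  "prufer_rhs \<beta> g l x t = \<beta> x * sin (2 * t) + (g x - l + 1) * (cos t)\<^sup>2 - 1"

definition prufer :: "(real \<Rightarrow> real) \<Rightarrow> (real \<Rightarrow> real) \<Rightarrow> real \<Rightarrow> real \<Rightarrow> (real \<Rightarrow> real) \<Rightarrow> bool" where
  "prufer \<beta> g l c \<theta> \<longleftrightarrow>
     (\<forall>x\<in>{0..c}. (\<theta> has_real_derivative prufer_rhs \<beta> g l x (\<theta> x)) (at x within {0..c}))"

lemma abs_cos_diff_le: "\<bar>cos a - cos b\<bar> \<le> \<bar>a - b\<bar>" for a b :: real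
proof -
  have "\<bar>cos a - cos b\<bar> = 2 * \<bar>sin ((a + b) / 2)\<bar> * \<bar>sin ((b - a) / 2)\<bar>"
    by (simp add: cos_diff_cos abs_mult)
  also have "\<dots> \<le> 2 * 1 * \<bar>(b - a) / 2\<bar>"
    using abs_sin_x_le_abs_x[of "(b - a) / 2"] abs_sin_le_one[of "(a + b) / 2"]
    by (intro mult_mono) auto
  finally show ?thesis by simp
qed

lemma abs_sin_diff_le: "\<bar>sin a - sin b\<bar> \<le> \<bar>a - b\<bar>" for a b :: real
  using abs_cos_diff_le[of "pi / 2 - a" "pi / 2 - b"] by (simp add: cos_diff abs_minus_commute)

lemma prufer_rhs_lipschitz:
  assumes "continuous_on {0..c} \<beta>" "continuous_on {0..c} g"
  obtains C where "\<And>x s t. x \<in> {0..c} \<Longrightarrow> \<bar>prufer_rhs \<beta> g l x s - prufer_rhs \<beta> g l x t\<bar> \<le> C * \<bar>s - t\<bar>"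
proof -
  have "bounded (\<beta> ` {0..c})" "bounded (g ` {0..c})"
    using assms by (auto intro!: compact_imp_bounded compact_continuous_image)
  then obtain B G where B: "\<And>x. x \<in> {0..c} \<Longrightarrow> \<bar>\<beta> x\<bar> \<le> B" and G: "\<And>x. x \<in> {0..c} \<Longrightarrow> \<bar>g x\<bar> \<le> G"
    unfolding bounded_iff by (metis image_eqI real_norm_def)
  show ?thesis
  proof (rule that)
    fix x s t :: real assume x: "x \<in> {0..c}"
    have "(cos s)\<^sup>2 - (cos t)\<^sup>2 = (cos (2 * s) - cos (2 * t)) / 2"
      by (simp add: cos_double_cos)
    then have c: "\<bar>(cos s)\<^sup>2 - (cos t)\<^sup>2\<bar> \<le> \<bar>s - t\<bar>"
      using abs_cos_diff_le[of "2 * s" "2 * t"] by (simp add: abs_if split: if_splits)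
    have s: "\<bar>sin (2 * s) - sin (2 * t)\<bar> \<le> 2 * \<bar>s - t\<bar>"
      using abs_sin_diff_le[of "2 * s" "2 * t"] by (simp add: abs_if split: if_splits)
    have "prufer_rhs \<beta> g l x s - prufer_rhs \<beta> g l x t
        = \<beta> x * (sin (2 * s) - sin (2 * t)) + (g x - l + 1) * ((cos s)\<^sup>2 - (cos t)\<^sup>2)"
      by (simp add: prufer_rhs_def algebra_simps)
    also have "\<bar>\<dots>\<bar> \<le> \<bar>\<beta> x\<bar> * \<bar>sin (2 * s) - sin (2 * t)\<bar> + \<bar>g x - l + 1\<bar> * \<bar>(cos s)\<^sup>2 - (cos t)\<^sup>2\<bar>"
      by (metis abs_mult abs_triangle_ineq)
    also have "\<dots> \<le> B * (2 * \<bar>s - t\<bar>) + (G + \<bar>l\<bar> + 1) * \<bar>s - t\<bar>"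
      using B[OF x] G[OF x] s c by (intro add_mono mult_mono) auto
    finally show "\<bar>prufer_rhs \<beta> g l x s - prufer_rhs \<beta> g l x t\<bar> \<le> (2 * B + (G + \<bar>l\<bar> + 1)) * \<bar>s - t\<bar>"
      by (simp add: algebra_simps)
  qed
qed

text \<open>The Lipschitz bound on the right-hand side bounds the derivative of
  \<open>\<theta> x - \<eta> x\<close> from above by a multiple of its absolute value. Strict
  comparison and the barrier both amount to excluding this case of equality.\<close>

lemma prufer_supersolution_eq:
  assumes cont: "continuous_on {0..c} \<beta>" "continuous_on {0..c} g"
    and p: "prufer \<beta> g l c \<theta>"
    and der: "\<And>x. x \<in> {0..c} \<Longrightarrow> (\<eta> has_real_derivative \<eta>' x) (at x within {0..c})"
    and sup: "\<And>x. x \<in> {0..c} \<Longrightarrow> prufer_rhs \<beta> g l x (\<eta> x) \<le> \<eta>' x"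
    and le: "\<theta> 0 \<le> \<eta> 0" "\<eta> c \<le> \<theta> c" and x: "x \<in> {0..c}"
  shows "\<theta> x = \<eta> x"
proof -
  obtain C where C: "\<And>x s t. x \<in> {0..c} \<Longrightarrow> \<bar>prufer_rhs \<beta> g l x s - prufer_rhs \<beta> g l x t\<bar> \<le> C * \<bar>s - t\<bar>"
    using prufer_rhs_lipschitz[OF cont] by blast
  have "\<theta> x - \<eta> x = 0"
  proof (rule gronwall_zero[where d = "\<lambda>x. \<theta> x - \<eta> x"])
    fix y assume y: "y \<in> {0..c}"
    show "((\<lambda>x. \<theta> x - \<eta> x) has_real_derivative prufer_rhs \<beta> g l y (\<theta> y) - \<eta>' y) (at y within {0..c})"
      using p der y by (auto intro!: derivative_intros simp: prufer_def)
    show "prufer_rhs \<beta> g l y (\<theta> y) - \<eta>' y \<le> C * \<bar>\<theta> y - \<eta> y\<bar>"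
      using C[OF y, of "\<theta> y" "\<eta> y"] sup[OF y] by linarith
  qed (use le x in auto)
  then show ?thesis by simp
qed

text \<open>Raising l lowers the right-hand side by a multiple of the squared cosine, so if the
  conclusion failed the two angles would agree and their cosine would vanish identically. That is
  impossible, because an angle with vanishing cosine moves with speed -1.\<close>

lemma prufer_comparison:
  assumes cont: "continuous_on {0..c} \<beta>" "continuous_on {0..c} g" and "0 < c"
    and p: "prufer \<beta> g l\<^sub>1 c \<theta>\<^sub>1" "prufer \<beta> g l\<^sub>2 c \<theta>\<^sub>2" and "l\<^sub>1 < l\<^sub>2" and le: "\<theta>\<^sub>2 0 \<le> \<theta>\<^sub>1 0"
  shows "\<theta>\<^sub>2 c < \<theta>\<^sub>1 c"
proof (rule ccontr)
  assume "\<not> \<theta>\<^sub>2 c < \<theta>\<^sub>1 c"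
  have sup: "prufer_rhs \<beta> g l\<^sub>1 x t = prufer_rhs \<beta> g l\<^sub>2 x t + (l\<^sub>2 - l\<^sub>1) * (cos t)\<^sup>2" for x t
    by (simp add: prufer_rhs_def algebra_simps)
  have eq: "\<theta>\<^sub>2 x = \<theta>\<^sub>1 x" if "x \<in> {0..c}" for x
  proof (rule prufer_supersolution_eq[OF cont p(2)])
    show "(\<theta>\<^sub>1 has_real_derivative prufer_rhs \<beta> g l\<^sub>1 x (\<theta>\<^sub>1 x)) (at x within {0..c})"
      if "x \<in> {0..c}" for x
      using p(1) that by (simp add: prufer_def)
    show "prufer_rhs \<beta> g l\<^sub>2 x (\<theta>\<^sub>1 x) \<le> prufer_rhs \<beta> g l\<^sub>1 x (\<theta>\<^sub>1 x)" for x
      using sup[of x "\<theta>\<^sub>1 x"] \<open>l\<^sub>1 < l\<^sub>2\<close> by simp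
  qed (use \<open>\<not> \<theta>\<^sub>2 c < \<theta>\<^sub>1 c\<close> le that in auto)
  have der: "(\<theta>\<^sub>1 has_real_derivative prufer_rhs \<beta> g l\<^sub>1 x (\<theta>\<^sub>1 x)) (at x)"
            "(\<theta>\<^sub>1 has_real_derivative prufer_rhs \<beta> g l\<^sub>2 x (\<theta>\<^sub>1 x)) (at x)" if "x \<in> {0<..<c}" for x
  proof -
    have x: "x \<in> {0..c}" "at x within {0..c} = at x"
      using that by (auto simp: at_within_Icc_at)
    show "(\<theta>\<^sub>1 has_real_derivative prufer_rhs \<beta> g l\<^sub>1 x (\<theta>\<^sub>1 x)) (at x)"
      using p(1) x(1) unfolding prufer_def x(2)[symmetric] by blast
    have "(\<theta>\<^sub>2 has_real_derivative prufer_rhs \<beta> g l\<^sub>2 x (\<theta>\<^sub>1 x)) (at x)"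
      using p(2) x(1) eq[OF x(1)] unfolding prufer_def x(2)[symmetric] by metis
    then show "(\<theta>\<^sub>1 has_real_derivative prufer_rhs \<beta> g l\<^sub>2 x (\<theta>\<^sub>1 x)) (at x)"
      by (rule DERIV_cong_ev[THEN iffD1, rotated -1])
        (use that in \<open>auto intro!: eventually_nhds_in_open[of "{0<..<c}", THEN eventually_mono] eq\<close>)
  qed
  have cos0: "cos (\<theta>\<^sub>1 x) = 0" if "x \<in> {0<..<c}" for x
    using DERIV_unique[OF der[OF that]] sup[of x "\<theta>\<^sub>1 x"] \<open>l\<^sub>1 < l\<^sub>2\<close> by simp
  define x where "x = c / 2"
  have x: "x \<in> {0<..<c}"
    using \<open>0 < c\<close> by (simp add: x_def)
  have d: "((\<lambda>x. cos (\<theta>\<^sub>1 x)) has_real_derivative - sin (\<theta>\<^sub>1 x) * (- 1)) (at x)"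
    by (rule derivative_eq_intros der x refl)+ (simp add: prufer_rhs_def cos0[OF x] sin_double)
  have "((\<lambda>x. cos (\<theta>\<^sub>1 x)) has_real_derivative 0) (at x)"
    by (rule DERIV_cong_ev[THEN iffD1, OF refl _ refl DERIV_const[of 0]])
      (use x in \<open>auto intro!: eventually_nhds_in_open[of "{0<..<c}", THEN eventually_mono] simp: cos0\<close>)
  from DERIV_unique[OF d this] cos0[OF x] sin_cos_squared_add[of "\<theta>\<^sub>1 x"] show False
    by simp
qed

text \<open>An angle with vanishing cosine can only be crossed downwards.\<close>

lemma prufer_barrier:
  assumes cont: "continuous_on {0..c} \<beta>" "continuous_on {0..c} g" and "0 < c"
    and p: "prufer \<beta> g l c \<theta>" and le: "\<theta> 0 \<le> k" and "cos k = 0"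
  shows "\<theta> c < k"
proof (rule ccontr)
  assume "\<not> \<theta> c < k"
  have rhs: "prufer_rhs \<beta> g l x k = - 1" for x
    by (simp add: prufer_rhs_def \<open>cos k = 0\<close> sin_double)
  have eq: "\<theta> x = k" if "x \<in> {0..c}" for x
    by (rule prufer_supersolution_eq[OF cont p, where \<eta> = "\<lambda>_. k" and \<eta>' = "\<lambda>_. 0"])
      (use \<open>\<not> \<theta> c < k\<close> le that rhs in auto)
  define x where "x = c / 2"
  have x: "x \<in> {0<..<c}" "x \<in> {0..c}"
    using \<open>0 < c\<close> by (auto simp: x_def)
  have d: "(\<theta> has_real_derivative - 1) (at x)"
    using p x rhs[of x] eq[of x] by (auto simp: prufer_def at_within_Icc_at dest!: bspec[of _ _ x])
  have "(\<theta> has_real_derivative 0) (at x)"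
    by (rule DERIV_cong_ev[THEN iffD1, OF refl _ refl DERIV_const[of k]])
      (use x in \<open>auto intro!: eventually_nhds_in_open[of "{0<..<c}", THEN eventually_mono] simp: eq\<close>)
  from DERIV_unique[OF d this] show False
    by simp
qed

text \<open>The right-hand side depends on the angle only through its double.\<close>

lemma prufer_shift:
  assumes "prufer \<beta> g l c \<theta>"
  shows "prufer \<beta> g l c (\<lambda>x. \<theta> x + pi * of_int n)"
proof -
  have "(cos (t + pi * of_int n))\<^sup>2 = (cos t)\<^sup>2" "sin (2 * (t + pi * of_int n)) = sin (2 * t)" for t
  proof -
    have "sin (2 * (t + pi * of_int n)) = sin (2 * t + 2 * pi * of_int n)"
         "cos (2 * (t + pi * of_int n)) = cos (2 * t + 2 * pi * of_int n)"
      by (simp_all add: algebra_simps)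
    then have "cos (2 * (t + pi * of_int n)) = cos (2 * t)"
        and s: "sin (2 * (t + pi * of_int n)) = sin (2 * t)"
      by (simp_all only: sin_add cos_add sin_int_2pin cos_int_2pin)
    then show "(cos (t + pi * of_int n))\<^sup>2 = (cos t)\<^sup>2"
      by (simp only: cos_double_cos)
    show "sin (2 * (t + pi * of_int n)) = sin (2 * t)" by (rule s)
  qed
  then have "prufer_rhs \<beta> g l x (t + pi * of_int n) = prufer_rhs \<beta> g l x t" for x t
    by (simp add: prufer_rhs_def)
  then show ?thesis
    using assms by (auto simp: prufer_def intro!: derivative_eq_intros)
qed

section \<open>Continuous polar angles of pairs of functions\<close>

text \<open>A nonvanishing complex function on a contractible set has a continuous logarithm, whose
  imaginary part is the angle. The domain is a general convex set so that intervals and rectangles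
  of points (x, l) are both covered.\<close>

lemma polar_lift:
  fixes u v :: "'a::real_normed_vector \<Rightarrow> real"
  assumes "convex S" "continuous_on S u" "continuous_on S v"
    and nz: "\<And>x. x \<in> S \<Longrightarrow> u x \<noteq> 0 \<or> v x \<noteq> 0"
  obtains \<rho> \<theta> where "continuous_on S \<theta>" "\<And>x. x \<in> S \<Longrightarrow> \<rho> x > 0"
    "\<And>x. x \<in> S \<Longrightarrow> u x = \<rho> x * cos (\<theta> x)" "\<And>x. x \<in> S \<Longrightarrow> v x = \<rho> x * sin (\<theta> x)"
proof -
  have "continuous_on S (\<lambda>x. Complex (u x) (v x))"
    using assms by (auto intro!: continuous_intros)
  moreover have "Complex (u x) (v x) \<noteq> 0" if "x \<in> S" for x
    using nz[OF that] by (auto simp: complex_eq_iff)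
  ultimately obtain h where h: "continuous_on S h" "\<And>x. x \<in> S \<Longrightarrow> Complex (u x) (v x) = exp (h x)"
    using continuous_logarithm_on_contractible[OF _ convex_imp_contractible[OF \<open>convex S\<close>]] by blast
  show ?thesis
  proof (rule that[of "\<lambda>x. Im (h x)" "\<lambda>x. exp (Re (h x))"])
    show "continuous_on S (\<lambda>x. Im (h x))"
      using h(1) by (intro continuous_intros)
    fix x assume x: "x \<in> S"
    show "u x = exp (Re (h x)) * cos (Im (h x))" "v x = exp (Re (h x)) * sin (Im (h x))"
      using h(2)[OF x] by (auto simp: complex_eq_iff Re_exp Im_exp)
  qed auto
qed

text \<open>\<open>\<theta>\<close> is only known to be continuous. Up to the constant
  \<open>\<theta> x\<close> it is, near \<open>x\<close>, the arctangent of the quotient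
  \<open>h / k\<close> of the components rotated by \<open>\<theta> x\<close>, and this can be
  differentiated.\<close>

lemma polar_angle_deriv:
  fixes u v :: "real \<Rightarrow> real"
  assumes cont: "continuous_on S \<theta>" and x: "x \<in> S"
    and pos: "\<And>x. x \<in> S \<Longrightarrow> \<rho> x > 0"
    and u: "\<And>x. x \<in> S \<Longrightarrow> u x = \<rho> x * cos (\<theta> x)" and v: "\<And>x. x \<in> S \<Longrightarrow> v x = \<rho> x * sin (\<theta> x)"
    and du: "(u has_real_derivative u') (at x within S)"
    and dv: "(v has_real_derivative v') (at x within S)"
  shows "(\<theta> has_real_derivative (u x * v' - v x * u') / (\<rho> x)\<^sup>2) (at x within S)"
proof -
  define h where "h y = v y * cos (\<theta> x) - u y * sin (\<theta> x)" for y
  define k where "k y = u y * cos (\<theta> x) + v y * sin (\<theta> x)" for y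
  have hk: "h y = \<rho> y * sin (\<theta> y - \<theta> x)" "k y = \<rho> y * cos (\<theta> y - \<theta> x)" if "y \<in> S" for y
    by (simp_all add: h_def k_def u[OF that] v[OF that] sin_diff cos_diff algebra_simps)
  obtain d where d: "d > 0" "\<And>y. y \<in> S \<Longrightarrow> dist y x < d \<Longrightarrow> dist (\<theta> y) (\<theta> x) < pi / 2"
    using cont x pi_half_gt_zero unfolding continuous_on_iff by blast
  have hkx: "h x = 0" "k x = \<rho> x" "\<rho> x > 0"
    using hk[OF x] pos[OF x] by auto
  have "((\<lambda>y. \<theta> x + arctan (h y / k y)) has_real_derivative
      ((v' * cos (\<theta> x) - u' * sin (\<theta> x)) / \<rho> x)) (at x within S)"
    using hkx unfolding h_def k_def
    by (auto intro!: derivative_eq_intros du dv simp: field_simps)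
  then have "(\<theta> has_real_derivative ((v' * cos (\<theta> x) - u' * sin (\<theta> x)) / \<rho> x)) (at x within S)"
  proof (rule has_field_derivative_transform_within[OF _ d(1) x])
    fix y assume y: "y \<in> S" "dist y x < d"
    have "\<bar>\<theta> y - \<theta> x\<bar> < pi / 2"
      using d(2)[OF y] by (simp add: dist_real_def)
    then have "arctan (tan (\<theta> y - \<theta> x)) = \<theta> y - \<theta> x"
      by (intro arctan_tan) (simp_all only: abs_less_iff, simp_all)
    moreover have "h y / k y = tan (\<theta> y - \<theta> x)"
      using pos[OF y(1)] by (simp add: hk[OF y(1)] tan_def)
    ultimately show "\<theta> x + arctan (h y / k y) = \<theta> y"
      by simp
  qed
  moreover have "(v' * cos (\<theta> x) - u' * sin (\<theta> x)) / \<rho> x = (u x * v' - v x * u') / (\<rho> x)\<^sup>2"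
    using hkx(3) by (simp add: u[OF x] v[OF x] field_simps power2_eq_square)
  ultimately show ?thesis by simp
qed

lemma polar_angle_prufer:
  assumes cont: "continuous_on {0..c} \<theta>"
    and pos: "\<And>x. x \<in> {0..c} \<Longrightarrow> \<rho> x > 0"
    and u: "\<And>x. x \<in> {0..c} \<Longrightarrow> u x = \<rho> x * cos (\<theta> x)" and v: "\<And>x. x \<in> {0..c} \<Longrightarrow> v x = \<rho> x * sin (\<theta> x)"
    and du: "\<And>x. x \<in> {0..c} \<Longrightarrow> (u has_real_derivative v x - \<beta> x * u x) (at x within {0..c})"
    and dv: "\<And>x. x \<in> {0..c} \<Longrightarrow> (v has_real_derivative \<beta> x * v x + (g x - l) * u x) (at x within {0..c})"
  shows "prufer \<beta> g l c \<theta>"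
  unfolding prufer_def
proof
  fix x assume x: "x \<in> {0..c}"
  have sc: "(sin (\<theta> x))\<^sup>2 = 1 - (cos (\<theta> x))\<^sup>2"
    by (simp add: sin_squared_eq)
  have "u x * (\<beta> x * v x + (g x - l) * u x) - v x * (v x - \<beta> x * u x)
      = (\<rho> x)\<^sup>2 * (\<beta> x * (2 * sin (\<theta> x) * cos (\<theta> x)) + (g x - l) * (cos (\<theta> x))\<^sup>2 - (sin (\<theta> x))\<^sup>2)"
    by (simp add: u[OF x] v[OF x] algebra_simps power2_eq_square)
  also have "\<dots> = (\<rho> x)\<^sup>2 * prufer_rhs \<beta> g l x (\<theta> x)"
    by (simp only: prufer_rhs_def sin_double sc) (simp add: algebra_simps)
  finally have "(u x * (\<beta> x * v x + (g x - l) * u x) - v x * (v x - \<beta> x * u x)) / (\<rho> x)\<^sup>2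
      = prufer_rhs \<beta> g l x (\<theta> x)"
    using pos[OF x] by simp
  with polar_angle_deriv[OF cont x pos u v du[OF x] dv[OF x]]
  show "(\<theta> has_real_derivative prufer_rhs \<beta> g l x (\<theta> x)) (at x within {0..c})"
    by simp
qed

section \<open>Linear equations depending on a parameter\<close>

text \<open>The substitution t = s x moves the variable endpoint into the integrand, so that
  continuity of integrals over a fixed interval in a parameter applies.\<close>

lemma continuous_on_integral_upper:
  fixes f :: "real \<times> 'b::topological_space \<Rightarrow> real"
  assumes f: "continuous_on ({0..c} \<times> L) f"
  shows "continuous_on ({0..c} \<times> L) (\<lambda>z. integral {0..fst z} (\<lambda>t. f (t, snd z)))"
proof -
  have "integral {0..x} (\<lambda>t. f (t, l)) = x * integral {0..1} (\<lambda>s. f (s * x, l))"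
    if "x \<in> {0..c}" "l \<in> L" for x l
  proof (cases "x = 0")
    case False
    with that have x: "x > 0" by auto
    have "(\<lambda>t. f (t, l)) integrable_on {0..x}"
      using that by (intro integrable_continuous_real continuous_on_compose2[OF f] continuous_intros) auto
    then have "((\<lambda>t. f (t, l)) has_integral integral {0..x} (\<lambda>t. f (t, l))) {0..x}"
      by blast
    then have "((\<lambda>s. f (x * s, l)) has_integral 1 / \<bar>x\<bar> * integral {0..x} (\<lambda>t. f (t, l)))
        ((\<lambda>s. s / x) ` {0..x})"
      using x has_integral_stretch_real[of "\<lambda>t. f (t, l)" _ 0 x x] by simp
    moreover have "(\<lambda>s. s / x) ` {0..x} = {0..1}"
      using x by simp
    ultimately have "integral {0..1} (\<lambda>s. f (x * s, l)) = 1 / x * integral {0..x} (\<lambda>t. f (t, l))"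
      using x by (simp add: integral_unique)
    then show ?thesis
      using x by (simp add: mult.commute)
  qed simp
  moreover have "continuous_on ({0..c} \<times> L)
      (\<lambda>z. fst z * integral (cbox 0 1) (\<lambda>s. f (s * fst z, snd z)))"
  proof (intro continuous_on_mult continuous_on_fst continuous_on_id integral_continuous_on_param)
    show "continuous_on (({0..c} \<times> L) \<times> cbox 0 1) (\<lambda>(z, s). f (s * fst z, snd z))"
      unfolding case_prod_beta
    proof (rule continuous_on_compose2[OF f])
      show "continuous_on (({0..c} \<times> L) \<times> cbox 0 1) (\<lambda>p. (snd p * fst (fst p), snd (fst p)))"
        by (intro continuous_intros)
      show "(\<lambda>p. (snd p * fst (fst p), snd (fst p))) ` (({0..c} \<times> L) \<times> cbox 0 1) \<subseteq> {0..c} \<times> L"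
      proof clarsimp
        fix x s :: real assume "0 \<le> s" "s \<le> 1" "0 \<le> x" "x \<le> c"
        then show "s * x \<le> c" using mult_left_le_one_le[of x s] by linarith
      qed
    qed
  qed
  ultimately show ?thesis
    by (subst continuous_on_cong[OF refl, where g = "\<lambda>z. fst z * integral {0..1} (\<lambda>s. f (s * fst z, snd z))"]) auto
qed

text \<open>The n-th term, not the n-th partial sum, of the Picard series: the Volterra operator of
  the system u' = v, v' = (q - l) u applied n times to the constant initial data. The argument is
  the pair (x, l).\<close>

fun picard_term :: "(real \<Rightarrow> real) \<Rightarrow> real \<Rightarrow> real \<Rightarrow> nat \<Rightarrow> real \<times> real \<Rightarrow> real \<times> real" where
  "picard_term q u0 v0 0 z = (u0, v0)"
| "picard_term q u0 v0 (Suc n) z =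
    (integral {0..fst z} (\<lambda>t. snd (picard_term q u0 v0 n (t, snd z))),
     integral {0..fst z} (\<lambda>t. (q t - snd z) * fst (picard_term q u0 v0 n (t, snd z))))"

lemma picard_term_continuous:
  assumes "continuous_on {0..c} q"
  shows "continuous_on ({0..c} \<times> L) (\<lambda>z. fst (picard_term q u0 v0 n z)) \<and>
    continuous_on ({0..c} \<times> L) (\<lambda>z. snd (picard_term q u0 v0 n z))"
proof (induction n)
  case (Suc n)
  have "continuous_on ({0..c} \<times> L) (\<lambda>z. q (fst z))"
    by (rule continuous_on_compose2[OF assms]) (auto intro!: continuous_intros)
  then have "continuous_on ({0..c} \<times> L) (\<lambda>z. (q (fst z) - snd z) * fst (picard_term q u0 v0 n z))"
    using Suc by (intro continuous_on_mult continuous_on_diff continuous_on_snd continuous_on_id) auto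
  from continuous_on_integral_upper[OF this] continuous_on_integral_upper[of c L "\<lambda>z. snd (picard_term q u0 v0 n z)"] Suc
  show ?case by simp
qed simp

lemma picard_term_continuous_section:
  assumes "continuous_on {0..c} q"
  shows "continuous_on {0..c} (\<lambda>t. fst (picard_term q u0 v0 n (t, l)))"
    and "continuous_on {0..c} (\<lambda>t. snd (picard_term q u0 v0 n (t, l)))"
proof -
  note c = picard_term_continuous[OF assms, of "{l}" u0 v0 n]
  have "continuous_on {0..c} (\<lambda>t. (t, l))"
    by (intro continuous_intros)
  then show "continuous_on {0..c} (\<lambda>t. fst (picard_term q u0 v0 n (t, l)))"
    and "continuous_on {0..c} (\<lambda>t. snd (picard_term q u0 v0 n (t, l)))"
    by (rule continuous_on_compose2[OF conjunct1[OF c]] continuous_on_compose2[OF conjunct2[OF c]]; auto)+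
qed

lemma abs_integral_le_power:
  fixes f :: "real \<Rightarrow> real"
  assumes "0 \<le> x" "continuous_on {0..x} f"
    and le: "\<And>t. t \<in> {0..x} \<Longrightarrow> \<bar>f t\<bar> \<le> A * (t ^ n / fact n)"
  shows "\<bar>integral {0..x} f\<bar> \<le> A * (x ^ Suc n / fact (Suc n))"
proof -
  have "((\<lambda>t. A * (t ^ n / fact n)) has_integral A * (x ^ Suc n / fact (Suc n)) - A * (0 ^ Suc n / fact (Suc n))) {0..x}"
  proof (intro fundamental_theorem_of_calculus \<open>0 \<le> x\<close>)
    fix t assume "t \<in> {0..x}"
    have "((\<lambda>t. t ^ Suc n) has_real_derivative real (Suc n) * t ^ n) (at t within {0..x})"
      using DERIV_power_Suc[OF DERIV_ident, where n = n and x = t and s = "{0..x}"] by simp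
    then have "((\<lambda>t. A * (t ^ Suc n / fact (Suc n))) has_real_derivative A * (real (Suc n) * t ^ n / fact (Suc n)))
        (at t within {0..x})"
      by (intro DERIV_cmult DERIV_cdivide)
    moreover have "real (Suc n) * t ^ n / fact (Suc n) = t ^ n / fact n"
      by (simp add: fact_Suc del: of_nat_Suc)
    ultimately show "((\<lambda>t. A * (t ^ Suc n / fact (Suc n))) has_vector_derivative A * (t ^ n / fact n)) (at t within {0..x})"
      by (simp only: has_real_derivative_iff_has_vector_derivative)
  qed
  then have I: "((\<lambda>t. A * (t ^ n / fact n)) has_integral A * (x ^ Suc n / fact (Suc n))) {0..x}"
    by simp
  have "\<bar>integral {0..x} f\<bar> \<le> integral {0..x} (\<lambda>t. A * (t ^ n / fact n))"
    using integral_norm_bound_integral[of f "{0..x}" "\<lambda>t. A * (t ^ n / fact n)"] I le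
      integrable_continuous_real[OF assms(2)] by auto
  then show ?thesis
    unfolding integral_unique[OF I] .
qed

text \<open>Repeated integration of t^n / n! produces the factorial. The lower bound 1 on
  \<open>K\<close> lets one estimate serve both components, since the first is integrated without
  the factor \<open>q t - l\<close>.\<close>

lemma picard_term_bound:
  assumes q: "continuous_on {0..c} q" and "1 \<le> K" "\<And>x. x \<in> {0..c} \<Longrightarrow> \<bar>q x - l\<bar> \<le> K"
    and "x \<in> {0..c}"
  shows "\<bar>fst (picard_term q u0 v0 n (x, l))\<bar> \<le> (\<bar>u0\<bar> + \<bar>v0\<bar>) * K ^ n * (x ^ n / fact n) \<and>
    \<bar>snd (picard_term q u0 v0 n (x, l))\<bar> \<le> (\<bar>u0\<bar> + \<bar>v0\<bar>) * K ^ n * (x ^ n / fact n)"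
  using assms(4)
proof (induction n arbitrary: x)
  case (Suc n)
  let ?A = "(\<bar>u0\<bar> + \<bar>v0\<bar>) * K ^ Suc n"
  have sub: "{0..x} \<subseteq> {0..c}"
    using Suc.prems by auto
  have "0 \<le> (\<bar>u0\<bar> + \<bar>v0\<bar>) * K ^ n * (t ^ n / fact n)" if "t \<in> {0..x}" for t
    using that \<open>1 \<le> K\<close> by (intro mult_nonneg_nonneg) auto
  then have le: "(\<bar>u0\<bar> + \<bar>v0\<bar>) * K ^ n * (t ^ n / fact n) \<le> ?A * (t ^ n / fact n)" if "t \<in> {0..x}" for t
    using that \<open>1 \<le> K\<close> mult_right_mono[of 1 K "(\<bar>u0\<bar> + \<bar>v0\<bar>) * K ^ n * (t ^ n / fact n)"]
    by (simp add: mult_ac)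
  have "\<bar>integral {0..x} (\<lambda>t. snd (picard_term q u0 v0 n (t, l)))\<bar> \<le> ?A * (x ^ Suc n / fact (Suc n))"
  proof (rule abs_integral_le_power)
    show "\<bar>snd (picard_term q u0 v0 n (t, l))\<bar> \<le> ?A * (t ^ n / fact n)" if "t \<in> {0..x}" for t
      using conjunct2[OF Suc.IH[of t]] le[OF that] that sub order.trans by blast
    show "continuous_on {0..x} (\<lambda>t. snd (picard_term q u0 v0 n (t, l)))"
      by (rule continuous_on_subset[OF picard_term_continuous_section(2)[OF q] sub])
    show "0 \<le> x" using Suc.prems by simp
  qed
  moreover have "\<bar>integral {0..x} (\<lambda>t. (q t - l) * fst (picard_term q u0 v0 n (t, l)))\<bar>
      \<le> ?A * (x ^ Suc n / fact (Suc n))"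
  proof (rule abs_integral_le_power)
    show "\<bar>(q t - l) * fst (picard_term q u0 v0 n (t, l))\<bar> \<le> ?A * (t ^ n / fact n)" if "t \<in> {0..x}" for t
    proof -
      have t: "t \<in> {0..c}" using that sub by auto
      have "\<bar>q t - l\<bar> * \<bar>fst (picard_term q u0 v0 n (t, l))\<bar>
          \<le> K * ((\<bar>u0\<bar> + \<bar>v0\<bar>) * K ^ n * (t ^ n / fact n))"
        using conjunct1[OF Suc.IH[OF t]] assms(3)[OF t] \<open>1 \<le> K\<close> by (intro mult_mono) linarith+
      then show ?thesis by (simp add: abs_mult mult_ac)
    qed
    show "continuous_on {0..x} (\<lambda>t. (q t - l) * fst (picard_term q u0 v0 n (t, l)))"
      by (intro continuous_on_mult continuous_on_diff continuous_on_const
          continuous_on_subset[OF picard_term_continuous_section(1)[OF q] sub] continuous_on_subset[OF q sub])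
    show "0 \<le> x" using Suc.prems by simp
  qed
  ultimately show ?case
    unfolding picard_term.simps fst_conv snd_conv by blast
qed simp

text \<open>The solution is built as a series because joint continuity in (x, l) is needed for the
  deformation argument; it comes from uniform convergence on the rectangle, with the exponential
  series as majorant.\<close>

lemma linear_ode_solution:
  assumes q: "continuous_on {0..c} q" and "0 \<le> c"
  obtains u v :: "real \<times> real \<Rightarrow> real" where
    "continuous_on ({0..c} \<times> {a..b}) u" "continuous_on ({0..c} \<times> {a..b}) v"
    "\<And>l. l \<in> {a..b} \<Longrightarrow> u (0, l) = u0" "\<And>l. l \<in> {a..b} \<Longrightarrow> v (0, l) = v0"
    "\<And>x l. x \<in> {0..c} \<Longrightarrow> l \<in> {a..b} \<Longrightarrow>
        ((\<lambda>x. u (x, l)) has_real_derivative v (x, l)) (at x within {0..c})"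
    "\<And>x l. x \<in> {0..c} \<Longrightarrow> l \<in> {a..b} \<Longrightarrow>
        ((\<lambda>x. v (x, l)) has_real_derivative (q x - l) * u (x, l)) (at x within {0..c})"
proof -
  let ?P = "picard_term q u0 v0"
  let ?R = "{0..c} \<times> {a..b}"
  have "bounded (q ` {0..c})"
    using q by (auto intro!: compact_imp_bounded compact_continuous_image)
  then obtain Q where Q: "\<And>x. x \<in> {0..c} \<Longrightarrow> \<bar>q x\<bar> \<le> Q"
    unfolding bounded_iff by (metis image_eqI real_norm_def)
  \<comment> \<open>\<open>K\<close> is at least 1 and dominates the modulus of
    \<open>q x - l\<close> for all \<open>l\<close> in \<open>{a..b}\<close> at once.\<close>
  define K where "K = 1 + \<bar>Q\<bar> + \<bar>a\<bar> + \<bar>b\<bar>"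
  have K: "\<bar>q x - l\<bar> \<le> K" if "x \<in> {0..c}" "l \<in> {a..b}" for x l
    using Q[OF that(1)] that(2) by (auto simp: K_def)
  define M where "M n = (\<bar>u0\<bar> + \<bar>v0\<bar>) * ((K * c) ^ n / fact n)" for n
  have "summable (\<lambda>n. (K * c) ^ n / fact n)"
    using summable_exp_generic[of "K * c"] by (simp add: divide_inverse mult.commute)
  then have M: "summable M"
    unfolding M_def by (rule summable_mult)
  have "K \<ge> 1" by (simp add: K_def)
  have bd: "\<bar>fst (?P n z)\<bar> \<le> M n" "\<bar>snd (?P n z)\<bar> \<le> M n" if "z \<in> ?R" for n z
  proof -
    obtain x l where z: "z = (x, l)" "x \<in> {0..c}" "l \<in> {a..b}" using \<open>z \<in> ?R\<close> by auto
    have "K ^ n * x ^ n \<le> K ^ n * c ^ n"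
      using z \<open>K \<ge> 1\<close> by (intro mult_left_mono power_mono) auto
    then have "K ^ n * (x ^ n / fact n) \<le> (K * c) ^ n / fact n"
      by (simp add: divide_right_mono power_mult_distrib)
    then have "(\<bar>u0\<bar> + \<bar>v0\<bar>) * K ^ n * (x ^ n / fact n) \<le> M n"
      unfolding M_def mult.assoc by (intro mult_left_mono) auto
    with picard_term_bound[OF q \<open>K \<ge> 1\<close> K[OF _ z(3)] z(2), of u0 v0 n]
    show "\<bar>fst (?P n z)\<bar> \<le> M n" "\<bar>snd (?P n z)\<bar> \<le> M n"
      unfolding z(1) by auto
  qed
  define u where "u z = (\<Sum>n. fst (?P n z))" for z
  define v where "v z = (\<Sum>n. snd (?P n z))" for z
  have ul: "uniform_limit ?R (\<lambda>n z. \<Sum>i<n. fst (?P i z)) u sequentially"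
           "uniform_limit ?R (\<lambda>n z. \<Sum>i<n. snd (?P i z)) v sequentially"
    unfolding u_def v_def using bd M by (auto intro!: Weierstrass_m_test)
  have sm: "summable (\<lambda>n. fst (?P n z))" "summable (\<lambda>n. snd (?P n z))" if "z \<in> ?R" for z
    using bd[OF that] by (auto intro!: summable_comparison_test'[OF M, of 0])
  note pc = picard_term_continuous[OF q, of "{a..b}" u0 v0]
  have contu: "continuous_on ?R u"
    by (rule uniform_limit_theorem[OF _ ul(1)])
      (auto intro!: always_eventually continuous_on_sum conjunct1[OF pc])
  have contv: "continuous_on ?R v"
    by (rule uniform_limit_theorem[OF _ ul(2)])
      (auto intro!: always_eventually continuous_on_sum conjunct2[OF pc])
  show ?thesis
  proof (rule that[OF contu contv])
    fix l assume l: "l \<in> {a..b}"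
    have "fst (?P n (0, l)) = (if n = 0 then u0 else 0)" "snd (?P n (0, l)) = (if n = 0 then v0 else 0)" for n
      by (cases n; simp)+
    then show "u (0, l) = u0" "v (0, l) = v0"
      unfolding u_def v_def
      using sums_unique[OF sums_single[of 0 "\<lambda>_. u0"]] sums_unique[OF sums_single[of 0 "\<lambda>_. v0"]]
      by simp_all
    have sm0: "summable (\<lambda>n. fst (?P (Suc n) (0, l)))" "summable (\<lambda>n. snd (?P (Suc n) (0, l)))"
      by simp_all
    fix x assume x: "x \<in> {0..c}"
    have R: "(t, l) \<in> ?R" if "t \<in> {0..c}" for t
      using that l by auto
    \<comment> \<open>The term of index 0 is the constant initial value. Only the rest of the series
      is differentiated termwise, and the derivative of its term n + 1 is an expression in term
      n.\<close>
    have shift: "u (t, l) = u0 + (\<Sum>n. fst (?P (Suc n) (t, l)))"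
         "v (t, l) = v0 + (\<Sum>n. snd (?P (Suc n) (t, l)))" if "t \<in> {0..c}" for t
      using suminf_split_head[OF sm(1)[OF R[OF that]]] suminf_split_head[OF sm(2)[OF R[OF that]]]
      by (simp_all add: u_def v_def)
    have ulx: "uniform_limit {0..c} (\<lambda>n t. \<Sum>i<n. snd (?P i (t, l))) (\<lambda>t. v (t, l)) sequentially"
      using uniform_limit_compose'[OF ul(2), of "\<lambda>t. (t, l)" "{0..c}"] R by auto
    have d: "((\<lambda>t. fst (?P (Suc n) (t, l))) has_real_derivative snd (?P n (t, l))) (at t within {0..c})"
      if "t \<in> {0..c}" for n t
      using integral_has_real_derivative[OF picard_term_continuous_section(2)[OF q] that] by simp
    obtain g where g: "\<And>t. t \<in> {0..c} \<Longrightarrow> (\<lambda>n. fst (?P (Suc n) (t, l))) sums g t"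
        "\<And>t. t \<in> {0..c} \<Longrightarrow> (g has_real_derivative v (t, l)) (at t within {0..c})"
      using has_field_derivative_series[OF convex_real_interval(5) d ulx _ sm0(1)] \<open>0 \<le> c\<close>
      by (metis atLeastAtMost_iff order_refl)
    have "u (t, l) = u0 + g t" if "t \<in> {0..c}" for t
      using shift(1)[OF that] sums_unique[OF g(1)[OF that]] by simp
    then show "((\<lambda>x. u (x, l)) has_real_derivative v (x, l)) (at x within {0..c})"
      using has_field_derivative_transform_within[OF _ zero_less_one_class.zero_less_one x, of "\<lambda>t. u0 + g t" "v (x, l)" "\<lambda>x. u (x, l)"]
        DERIV_add[OF DERIV_const g(2)[OF x], of u0] by simp

    have ulx2: "uniform_limit {0..c} (\<lambda>n t. \<Sum>i<n. (q t - l) * fst (?P i (t, l)))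
        (\<lambda>t. (q t - l) * u (t, l)) sequentially"
    proof -
      have 1: "uniform_limit {0..c} (\<lambda>n t. \<Sum>i<n. (q t - l) * fst (?P i (t, l)))
          (\<lambda>t. \<Sum>i. (q t - l) * fst (?P i (t, l))) sequentially"
      proof (rule Weierstrass_m_test[where M = "\<lambda>n. K * M n"])
        fix n t assume t: "t \<in> {0..c}"
        show "norm ((q t - l) * fst (?P n (t, l))) \<le> K * M n"
          using K[OF t l] bd(1)[OF R[OF t], of n] \<open>K \<ge> 1\<close> by (auto simp: abs_mult intro!: mult_mono)
      next
        show "summable (\<lambda>n. K * M n)" using M by (rule summable_mult)
      qed
      have 2: "(\<Sum>i. (q t - l) * fst (?P i (t, l))) = (q t - l) * u (t, l)" if "t \<in> {0..c}" for t
        unfolding u_def by (rule suminf_mult[OF sm(1)[OF R[OF that]]])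
      show ?thesis
        by (rule uniform_limit_cong'[THEN iffD1, OF refl 2 1])
    qed
    have d: "((\<lambda>t. snd (?P (Suc n) (t, l))) has_real_derivative (q t - l) * fst (?P n (t, l))) (at t within {0..c})"
      if "t \<in> {0..c}" for n t
      using integral_has_real_derivative[OF continuous_on_mult[OF continuous_on_diff[OF q continuous_on_const]
          picard_term_continuous_section(1)[OF q]] that] by simp
    obtain h where h: "\<And>t. t \<in> {0..c} \<Longrightarrow> (\<lambda>n. snd (?P (Suc n) (t, l))) sums h t"
        "\<And>t. t \<in> {0..c} \<Longrightarrow> (h has_real_derivative (q t - l) * u (t, l)) (at t within {0..c})"
      using has_field_derivative_series[OF convex_real_interval(5) d ulx2 _ sm0(2)] \<open>0 \<le> c\<close>
      by (metis atLeastAtMost_iff order_refl)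
    have "v (t, l) = v0 + h t" if "t \<in> {0..c}" for t
      using shift(2)[OF that] sums_unique[OF h(1)[OF that]] by simp
    then show "((\<lambda>x. v (x, l)) has_real_derivative (q x - l) * u (x, l)) (at x within {0..c})"
      using has_field_derivative_transform_within[OF _ zero_less_one_class.zero_less_one x, of "\<lambda>t. v0 + h t" "(q x - l) * u (x, l)" "\<lambda>x. v (x, l)"]
        DERIV_add[OF DERIV_const h(2)[OF x], of v0] by simp

  qed
qed

text \<open>The energy E = u^2 + v^2 satisfies |E'| <= C E, so E exp(-C x) is nonincreasing and E
  exp(C x) nondecreasing. The first handles points to the right of \<open>x0\<close>, the second
  those to its left.\<close>

lemma linear_ode_zero:
  fixes u v :: "real \<Rightarrow> real"
  assumes q: "continuous_on {0..c} q"
    and du: "\<And>x. x \<in> {0..c} \<Longrightarrow> (u has_real_derivative v x) (at x within {0..c})"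
    and dv: "\<And>x. x \<in> {0..c} \<Longrightarrow> (v has_real_derivative (q x - l) * u x) (at x within {0..c})"
    and x0: "x0 \<in> {0..c}" "u x0 = 0" "v x0 = 0" and x: "x \<in> {0..c}"
  shows "u x = 0 \<and> v x = 0"
proof -
  have "bounded (q ` {0..c})"
    using q by (auto intro!: compact_imp_bounded compact_continuous_image)
  then obtain Q where Q: "\<And>x. x \<in> {0..c} \<Longrightarrow> \<bar>q x\<bar> \<le> Q"
    unfolding bounded_iff by (metis image_eqI real_norm_def)
  define C where "C = 1 + Q + \<bar>l\<bar>"
  define E where "E x = (u x)\<^sup>2 + (v x)\<^sup>2" for x
  define E' where "E' x = 2 * u x * v x * (1 + q x - l)" for x
  have bd: "\<bar>E' x\<bar> \<le> C * E x" if "x \<in> {0..c}" for x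
  proof -
    have "\<bar>2 * u x * v x\<bar> \<le> E x"
      unfolding E_def using sum_squares_bound[of "u x" "v x"] sum_squares_bound[of "u x" "- v x"]
      by (simp add: abs_le_iff)
    moreover have "\<bar>1 + q x - l\<bar> \<le> C"
      using Q[OF that] by (simp add: C_def)
    ultimately have "\<bar>2 * u x * v x\<bar> * \<bar>1 + q x - l\<bar> \<le> E x * C"
      by (intro mult_mono) (auto simp: E_def)
    then show ?thesis
      unfolding E'_def by (simp only: abs_mult mult.commute[of C])
  qed
  have dE: "(E has_real_derivative E' y) (at y within S)" if "y \<in> S" "S \<subseteq> {0..c}" for y S
  proof -
    have u: "(u has_real_derivative v y) (at y within S)"
      and v: "(v has_real_derivative (q y - l) * u y) (at y within S)"
      using that by (auto intro: DERIV_subset[OF du] DERIV_subset[OF dv])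
    show ?thesis
      unfolding E_def E'_def
      by (auto intro!: derivative_eq_intros u v simp: algebra_simps)
  qed
  have "E x \<le> 0"
  proof (cases "x0 \<le> x")
    case True
    have "E x * exp (- C * x) \<le> E x0 * exp (- C * x0)"
    proof (rule DERIV_nonpos_imp_decreasing_open[OF True])
      show "continuous_on {x0..x} (\<lambda>x. E x * exp (- C * x))"
        by (intro continuous_intros DERIV_continuous_on[OF dE]) (use x x0 in auto)
      fix y assume y: "x0 < y" "y < x"
      then have "(E has_real_derivative E' y) (at y)"
        using dE[of y "{0..c}"] x x0 by (simp add: at_within_Icc_at)
      then have "((\<lambda>x. E x * exp (- C * x)) has_real_derivative (E' y - C * E y) * exp (- C * y)) (at y)"
        by (auto intro!: derivative_eq_intros simp: algebra_simps)
      then show "\<exists>d. ((\<lambda>x. E x * exp (- C * x)) has_real_derivative d) (at y) \<and> d \<le> 0"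
        using bd[of y] y x x0 by (auto simp: mult_le_0_iff intro!: exI)
    qed
    also have "\<dots> = 0" using x0 by (simp add: E_def)
    finally show ?thesis by (simp add: mult_le_0_iff)
  next
    case False
    then have le: "x \<le> x0" by simp
    have "E x * exp (C * x) \<le> E x0 * exp (C * x0)"
    proof (rule DERIV_nonneg_imp_increasing_open[OF le])
      show "continuous_on {x..x0} (\<lambda>x. E x * exp (C * x))"
        by (intro continuous_intros DERIV_continuous_on[OF dE]) (use x x0 in auto)
      fix y assume y: "x < y" "y < x0"
      then have "(E has_real_derivative E' y) (at y)"
        using dE[of y "{0..c}"] x x0 by (simp add: at_within_Icc_at)
      then have "((\<lambda>x. E x * exp (C * x)) has_real_derivative (E' y + C * E y) * exp (C * y)) (at y)"
        by (auto intro!: derivative_eq_intros simp: algebra_simps)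
      then show "\<exists>d. ((\<lambda>x. E x * exp (C * x)) has_real_derivative d) (at y) \<and> d \<ge> 0"
        using bd[of y] y x x0 by (auto simp: zero_le_mult_iff intro!: exI)
    qed
    also have "\<dots> = 0" using x0 by (simp add: E_def)
    finally show ?thesis by (simp add: mult_le_0_iff)
  qed
  then show ?thesis
    unfolding E_def by (metis sum_power2_le_zero_iff)
qed

section \<open>The Crum--Darboux transformation\<close>

text \<open>\<open>jet p l u v\<close> is the \<open>p\<close>-th derivative of a solution of \<open>y'' = (V - l) y\<close> with
  \<open>y = u\<close>, \<open>y' = v\<close>, up to lower order terms whose coefficients do not depend on \<open>l\<close>, \<open>u\<close>, \<open>v\<close>.\<close>

definition jet :: "nat \<Rightarrow> real \<Rightarrow> real \<Rightarrow> real \<Rightarrow> real" where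
  "jet p l u v = (- l) ^ (p div 2) * (if even p then u else v)"

lemma jet_simps [simp]: "jet 0 l u v = u" "jet (Suc 0) l u v = v" "jet (Suc (Suc p)) l u v = - l * jet p l u v"
  by (simp_all add: jet_def)

lemma jet_linear: "jet p l (a * u + b * u') (a * v + b * v') = a * jet p l u v + b * jet p l u' v'"
  by (simp add: jet_def algebra_simps)

text \<open>The derivative of v is (V - l) u. Its part - l u is the jet of the next order, so V u is
  left over, and this happens only for odd orders.\<close>

lemma jet_deriv:
  assumes "(u has_real_derivative v x) (at x within S)"
    and "(v has_real_derivative (V x - l) * u x) (at x within S)"
  shows "((\<lambda>x. jet p l (u x) (v x)) has_real_derivative
    jet (Suc p) l (u x) (v x) + (if odd p then V x * jet (p - 1) l (u x) (v x) else 0)) (at x within S)"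
proof (cases "even p")
  case True
  then show ?thesis
    using assms by (auto intro!: derivative_eq_intros simp: jet_def)
next
  case False
  then obtain h where "p = 2 * h + 1" by (elim oddE)
  then show ?thesis
    using assms by (auto intro!: derivative_eq_intros simp: jet_def algebra_simps)
qed

text \<open>\<open>True\<close> is the condition satisfied at a symmetry point by an even function
  (Neumann), \<open>False\<close> that of an odd one (Dirichlet); \<open>u\<close> and
  \<open>v\<close> stand for value and derivative.\<close>

definition bc :: "bool \<Rightarrow> real \<Rightarrow> real \<Rightarrow> bool" where
  "bc t u v \<longleftrightarrow> (if t then v = 0 else u = 0)"

lemma jet_bc: "bc t u v \<Longrightarrow> even p \<noteq> t \<Longrightarrow> jet p l u v = 0"
  by (auto simp: bc_def jet_def)

section \<open>The transformation at a fixed point, as linear algebra\<close>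

text \<open>\<open>U q\<close> and \<open>W q\<close> are the value and the derivative of the q-th
  column at one point, and \<open>B\<close> is the two-sided inverse of the matrix of their jets of
  order below \<open>k\<close>.\<close>

locale darboux =
  fixes k :: nat and lam U W :: "nat \<Rightarrow> real" and B :: "nat \<Rightarrow> nat \<Rightarrow> real"
  assumes k: "1 \<le> k"
    and inv1: "\<And>p r. p < k \<Longrightarrow> r < k \<Longrightarrow> (\<Sum>q<k. jet p (lam q) (U q) (W q) * B q r) = (if p = r then 1 else 0)"
    and inv2: "\<And>q j. q < k \<Longrightarrow> j < k \<Longrightarrow> (\<Sum>p<k. B q p * jet p (lam j) (U j) (W j)) = (if q = j then 1 else 0)"
begin

abbreviation E where "E p q \<equiv> jet p (lam q) (U q) (W q)"

text \<open>\<open>Y\<close> is the quotient of the Wronskian of the columns and \<open>y\<close> by that of the columns. The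
  second component is \<open>Z\<close> instead of \<open>Y'\<close>, because the system for \<open>(Y, Z)\<close> involves no derivative of
  \<open>B\<close>.\<close>

definition coord where "coord l u v q = (\<Sum>p<k. B q p * jet p l u v)"

definition Y where "Y l u v = jet k l u v - (\<Sum>q<k. coord l u v q * E k q)"

definition X where "X l u v p = (\<Sum>q<k. coord l u v q * (lam q - l) * E p q)"

definition Z where "Z l u v = X l u v (k - 1)"

lemma coord_jet: "p < k \<Longrightarrow> (\<Sum>q<k. E p q * coord l u v q) = jet p l u v"
proof -
  assume p: "p < k"
  have "(\<Sum>q<k. E p q * coord l u v q) = (\<Sum>q<k. \<Sum>r<k. (E p q * B q r) * jet r l u v)"
    by (simp add: coord_def sum_distrib_left mult.assoc)
  also have "\<dots> = (\<Sum>r<k. (\<Sum>q<k. E p q * B q r) * jet r l u v)"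
    by (subst sum.swap) (simp add: sum_distrib_right)
  also have "\<dots> = (\<Sum>r<k. (if p = r then jet r l u v else 0))"
    by (intro sum.cong) (auto simp: inv1 p)
  also have "\<dots> = jet p l u v"
    using p by simp
  finally show ?thesis .
qed

lemma coord_eqI:
  assumes "\<And>p. p < k \<Longrightarrow> (\<Sum>q<k. E p q * d q) = (\<Sum>q<k. E p q * d' q)" and q: "q < k"
  shows "d q = d' q"
proof -
  have *: "(\<Sum>p<k. B q p * (\<Sum>j<k. E p j * d j)) = d q" for d
  proof -
    have "(\<Sum>p<k. B q p * (\<Sum>j<k. E p j * d j)) = (\<Sum>p<k. \<Sum>j<k. (B q p * E p j) * d j)"
      by (simp add: sum_distrib_left mult.assoc)
    also have "\<dots> = (\<Sum>j<k. (\<Sum>p<k. B q p * E p j) * d j)"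
      by (subst sum.swap) (simp add: sum_distrib_right)
    also have "\<dots> = (\<Sum>j<k. (if q = j then d j else 0))"
      by (intro sum.cong) (auto simp: inv2 q)
    also have "\<dots> = d q"
      using q by simp
    finally show ?thesis .
  qed
  have "(\<Sum>p<k. B q p * (\<Sum>j<k. E p j * d j)) = (\<Sum>p<k. B q p * (\<Sum>j<k. E p j * d' j))"
    by (intro sum.cong refl) (simp add: assms(1))
  then show ?thesis
    unfolding * .
qed

text \<open>Multiplication by the negative eigenvalue raises the order of a jet by two. So
  \<open>X\<close> at p is the error made at order p + 2 by the expansion in the columns that is
  exact for all orders below \<open>k\<close>. Hence it vanishes for p + 2 < k, and \<open>Y\<close>
  and \<open>Z\<close> are the errors at orders k and k + 1.\<close>

lemma X_eq:
  assumes "p < k"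
  shows "X l u v p = jet (Suc (Suc p)) l u v - (\<Sum>q<k. coord l u v q * E (Suc (Suc p)) q)"
proof -
  have "X l u v p = (\<Sum>q<k. coord l u v q * (lam q * E p q)) - l * (\<Sum>q<k. E p q * coord l u v q)"
    by (simp add: X_def sum_distrib_left sum_subtractf[symmetric] algebra_simps)
  also have "\<dots> = jet (Suc (Suc p)) l u v + (\<Sum>q<k. coord l u v q * (lam q * E p q))"
    by (simp add: coord_jet assms)
  also have "\<dots> = jet (Suc (Suc p)) l u v - (\<Sum>q<k. coord l u v q * E (Suc (Suc p)) q)"
    by (simp add: sum_negf[symmetric] flip: diff_minus_eq_add)
  finally show ?thesis .
qed

lemma X_below: "p + 2 < k \<Longrightarrow> X l u v p = 0"
  using coord_jet[of "Suc (Suc p)" l u v] by (simp add: X_eq mult.commute[of "coord _ _ _ _"])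

lemma X_Y: "p + 2 = k \<Longrightarrow> X l u v p = Y l u v"
  by (auto simp: X_eq Y_def)

lemma Z_eq: "Z l u v = jet (Suc k) l u v - (\<Sum>q<k. coord l u v q * E (Suc k) q)"
proof -
  obtain n where n: "k = Suc n" using k by (cases k) auto
  then have "k - 1 = n" "Suc k = Suc (Suc n)" "n < k" by auto
  then show ?thesis
    using X_eq[of n l u v] by (simp only: Z_def)
qed

text \<open>With \<open>Y\<close> and \<open>Z\<close> zero, \<open>X\<close> vanishes at every p <
  k: at k - 1 it is \<open>Z\<close>, at k - 2 it is \<open>Y\<close>, and below that it vanishes
  anyway. The invertible jet matrix then annihilates the vector of products in the
  conclusion.\<close>

lemma coord_eq_0:
  assumes "Y l u v = 0" "Z l u v = 0" "q < k"
  shows "coord l u v q * (lam q - l) = 0"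
proof -
  have "X l u v p = 0" if "p < k" for p
  proof -
    have "p + 2 < k \<or> p + 2 = k \<or> p = k - 1"
      using that by linarith
    then show ?thesis
      using assms X_below X_Y by (auto simp: Z_def)
  qed
  then have "(\<Sum>q<k. E p q * (coord l u v q * (lam q - l))) = (\<Sum>q<k. E p q * 0)" if "p < k" for p
    using that by (simp add: X_def mult_ac)
  from coord_eqI[of "\<lambda>q. coord l u v q * (lam q - l)" "\<lambda>_. 0", OF this assms(3)] show ?thesis
    by simp
qed

text \<open>Order 1 is not below \<open>k\<close> when k = 1; there the expansion is the equation
  \<open>Y l u v = 0\<close> itself.\<close>

lemma Y0_coord_jet:
  assumes "Y l u v = 0" "p \<le> 1"
  shows "jet p l u v = (\<Sum>q<k. coord l u v q * E p q)"
proof (cases "p < k")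
  case True
  then show ?thesis using coord_jet by (simp add: mult.commute)
next
  case False
  then have "p = k" using k assms(2) by linarith
  then show ?thesis using assms(1) by (simp add: Y_def)
qed

lemma nonvanishing:
  assumes "u \<noteq> 0 \<or> v \<noteq> 0" "\<And>q. q < k \<Longrightarrow> lam q \<noteq> l"
  shows "Y l u v \<noteq> 0 \<or> Z l u v \<noteq> 0"
proof (rule ccontr)
  assume *: "\<not> ?thesis"
  then have "coord l u v q = 0" if "q < k" for q
    using coord_eq_0[OF _ _ that] assms(2)[OF that] by auto
  then show False
    using Y0_coord_jet[of l u v 0] Y0_coord_jet[of l u v 1] * assms(1) by simp
qed

text \<open>If \<open>l\<close> may equal \<open>lam j\<close>, the coordinate at \<open>j\<close>
  is the only one that can survive the vanishing of \<open>Y\<close> and \<open>Z\<close>. Then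
  \<open>(u, v)\<close> would be a multiple of \<open>(U j, W j)\<close>, against the nonzero
  Wronskian.\<close>

lemma nonvanishing_resonant:
  assumes "u * W j - v * U j \<noteq> 0" "j < k" "\<And>q. q < k \<Longrightarrow> q \<noteq> j \<Longrightarrow> lam q \<noteq> l"
  shows "Y l u v \<noteq> 0 \<or> Z l u v \<noteq> 0"
proof (rule ccontr)
  assume *: "\<not> ?thesis"
  then have 0: "coord l u v q = 0" if "q < k" "q \<noteq> j" for q
    using coord_eq_0[OF _ _ that(1)] assms(3)[OF that] by auto
  have "jet p l u v = coord l u v j * E p j" if "p \<le> 1" for p
  proof -
    have "jet p l u v = (\<Sum>q<k. if q = j then coord l u v j * E p j else 0)"
      unfolding Y0_coord_jet[of l u v p, OF conjunct1[OF *[simplified]] that]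
      by (intro sum.cong refl) (auto simp: 0)
    then show ?thesis using assms(2) by simp
  qed
  from this[of 0] this[of 1] have "u = coord l u v j * U j" "v = coord l u v j * W j"
    by auto
  with assms(1) show False
    by (metis (no_types, lifting) diff_self mult.assoc mult.commute)
qed

lemma coord_linear: "coord l (a * u + b * u') (a * v + b * v') q = a * coord l u v q + b * coord l u' v' q"
  by (simp add: coord_def jet_linear sum.distrib sum_distrib_left algebra_simps)

lemma Y_linear: "Y l (a * u + b * u') (a * v + b * v') = a * Y l u v + b * Y l u' v'"
  by (simp add: Y_def coord_linear jet_linear sum.distrib sum_distrib_left algebra_simps)

lemma Z_linear: "Z l (a * u + b * u') (a * v + b * v') = a * Z l u v + b * Z l u' v'"
  by (simp add: Z_def X_def coord_linear jet_linear sum.distrib sum_distrib_left sum_subtractf algebra_simps)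

lemma kills:
  assumes "j < k"
  shows "Y (lam j) (U j) (W j) = 0" "Z (lam j) (U j) (W j) = 0"
proof -
  have *: "coord (lam j) (U j) (W j) q = (if q = j then 1 else 0)" if "q < k" for q
    using that assms by (simp add: coord_def inv2)
  have "(\<Sum>q<k. coord (lam j) (U j) (W j) q * E k q) = (\<Sum>q<k. if q = j then E k q else 0)"
    by (intro sum.cong) (auto simp: *)
  then show "Y (lam j) (U j) (W j) = 0"
    using assms by (simp add: Y_def)
  show "Z (lam j) (U j) (W j) = 0"
    unfolding Z_def X_def by (intro sum.neutral) (auto simp: *)
qed

text \<open>A pair of type \<open>t\<close> has nonzero jets only at orders p with
  \<open>even p = t\<close>, so its coordinates along columns of the other type vanish. Now
  \<open>Y\<close> is made of jets of order k and \<open>Z\<close>, through \<open>X\<close>, of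
  column jets of order k - 1; one of the two orders has the wrong parity.\<close>

lemma bc_image:
  assumes bcs: "\<And>q. q < k \<Longrightarrow> bc (\<tau> q) (U q) (W q)" and "bc t u v"
  shows "bc (t = even k) (Y l u v) (Z l u v)"
proof -
  have coord: "coord l u v q = 0" if q: "q < k" and "\<tau> q \<noteq> t" for q
  proof -
    have "coord l u v q = (if \<tau> q = t then coord l u v q else 0)"
    proof (rule coord_eqI[OF _ q])
      fix p assume p: "p < k"
      show "(\<Sum>q<k. E p q * coord l u v q) = (\<Sum>q<k. E p q * (if \<tau> q = t then coord l u v q else 0))"
      proof (cases "even p = t")
        case True
        then show ?thesis
          by (intro sum.cong refl) (use jet_bc[OF bcs] in auto)
      next
        case False
        have "(\<Sum>q<k. E p q * (if \<tau> q = t then coord l u v q else 0)) = 0"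
          by (intro sum.neutral) (use jet_bc[OF bcs] False in auto)
        then show ?thesis
          using coord_jet[OF p] jet_bc[OF \<open>bc t u v\<close> False] by simp
      qed
    qed
    then show ?thesis using that by simp
  qed
  have zero: "coord l u v q * E p q = 0" if "even p \<noteq> t" "q < k" for p q
    using coord[OF that(2)] jet_bc[OF bcs[OF that(2)], of p] that(1) by auto
  show ?thesis
  proof (cases "t = even k")
    case True
    then have "even (k - 1) \<noteq> t"
      using k by simp
    then have "Z l u v = 0"
      unfolding Z_def X_def by (intro sum.neutral ballI) (use zero[of "k - 1"] in fastforce)
    then show ?thesis using True by (simp add: bc_def)
  next
    case False
    have "(\<Sum>q<k. coord l u v q * E k q) = 0"
      by (intro sum.neutral ballI zero) (use False in auto)
    then have "Y l u v = 0"
      using False jet_bc[OF \<open>bc t u v\<close>, of k] by (auto simp: Y_def)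
    then show ?thesis using False by (simp add: bc_def)
  qed
qed

end

section \<open>The first-order system of the transformed solutions\<close>

text \<open>The condition \<open>not_bot\<close> excludes isolated points of \<open>S\<close>, so
  that derivatives within \<open>S\<close> are unique and two expressions for the same derivative
  may be equated.\<close>

locale darboux_ode =
  fixes k :: nat and lam :: "nat \<Rightarrow> real" and U W :: "nat \<Rightarrow> real \<Rightarrow> real"
    and B :: "nat \<Rightarrow> nat \<Rightarrow> real \<Rightarrow> real" and V :: "real \<Rightarrow> real" and S :: "real set"
  assumes pointwise: "\<And>x. x \<in> S \<Longrightarrow> darboux k lam (\<lambda>q. U q x) (\<lambda>q. W q x) (\<lambda>q p. B q p x)"
    and dU: "\<And>q x. q < k \<Longrightarrow> x \<in> S \<Longrightarrow> (U q has_real_derivative W q x) (at x within S)"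
    and dW: "\<And>q x. q < k \<Longrightarrow> x \<in> S \<Longrightarrow> (W q has_real_derivative (V x - lam q) * U q x) (at x within S)"
    and dB: "\<And>q p x. q < k \<Longrightarrow> p < k \<Longrightarrow> x \<in> S \<Longrightarrow> \<exists>D. (B q p has_real_derivative D) (at x within S)"
    and contV: "continuous_on S V"
    and not_bot: "\<And>x. x \<in> S \<Longrightarrow> at x within S \<noteq> bot"
begin

abbreviation E where "E p q x \<equiv> jet p (lam q) (U q x) (W q x)"

text \<open>The coefficients that express the row of order k of the column jets through the rows of
  lower order.\<close>

definition A where "A p x = (\<Sum>j<k. E k j x * B j p x)"

text \<open>The logarithmic derivative of the determinant of the jet matrix: the derivatives of all
  rows but the last contribute nothing to it.\<close>

definition beta where "beta x = A (k - 1) x"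

text \<open>All that multiplies \<open>Y\<close> in the derivative of \<open>Z\<close>, apart from
  \<open>- l\<close>: the first summand comes from expanding the row of order k, the second from
  differentiating jets of odd order k - 1, the last from the derivatives of the coordinates.\<close>

definition g where
  "g x = (if 2 \<le> k then A (k - 2) x else 0) + (if even k then V x else 0)
    + (\<Sum>q<k. lam q * (E (k - 1) q x * B q (k - 1) x))"

abbreviation coord where
  "coord l u v q x \<equiv> darboux.coord k (\<lambda>q p. B q p x) l u v q"

abbreviation Y where
  "Y l u v x \<equiv> darboux.Y k lam (\<lambda>q. U q x) (\<lambda>q. W q x) (\<lambda>q p. B q p x) l u v"

abbreviation Z where
  "Z l u v x \<equiv> darboux.Z k lam (\<lambda>q. U q x) (\<lambda>q. W q x) (\<lambda>q p. B q p x) l u v"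

lemma contB: "q < k \<Longrightarrow> p < k \<Longrightarrow> continuous_on S (B q p)"
  using dB by (meson DERIV_continuous continuous_on_eq_continuous_within)

lemma contUW: "q < k \<Longrightarrow> continuous_on S (U q)" "q < k \<Longrightarrow> continuous_on S (W q)"
  using dU dW by (auto intro!: DERIV_continuous_on)

lemma contE: "q < k \<Longrightarrow> continuous_on S (E p q)"
  unfolding jet_def by (cases "even p") (auto intro!: continuous_intros contUW)

lemma contA: "p < k \<Longrightarrow> continuous_on S (A p)"
  unfolding A_def by (intro continuous_on_sum continuous_on_mult contB contE) auto

lemma k: "x \<in> S \<Longrightarrow> 1 \<le> k"
  using pointwise darboux.k by blast

lemma cont_beta: "continuous_on S beta"
proof (cases "S = {}")
  case False
  then obtain x where "x \<in> S" by blast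
  then have "1 \<le> k" by (rule k)
  then have "k - 1 < k" by simp
  then show ?thesis unfolding beta_def[abs_def] by (rule contA)
qed simp

lemma cont_g: "continuous_on S g"
proof (cases "S = {}")
  case False
  then have "1 \<le> k" using k by blast
  then have 1: "continuous_on S (\<lambda>x. \<Sum>q<k. lam q * (E (k - 1) q x * B q (k - 1) x))"
    by (intro continuous_on_sum continuous_on_mult continuous_on_const contB contE) auto
  have 2: "continuous_on S (\<lambda>x. if 2 \<le> k then A (k - 2) x else 0)"
    using contA[of "k - 2"] by (cases "2 \<le> k") auto
  have 3: "continuous_on S (\<lambda>x. if even k then V x else 0)"
    using contV by (cases "even k") auto
  show ?thesis
    unfolding g_def[abs_def] by (intro continuous_on_add 1 2 3)
qed simp

context
  fixes l :: real and u v :: "real \<Rightarrow> real"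
  assumes du: "\<And>x. x \<in> S \<Longrightarrow> (u has_real_derivative v x) (at x within S)"
    and dv: "\<And>x. x \<in> S \<Longrightarrow> (v has_real_derivative (V x - l) * u x) (at x within S)"
begin

lemma E_deriv:
  assumes "q < k" "x \<in> S"
  shows "(E p q has_real_derivative E (Suc p) q x + (if odd p then V x * E (p - 1) q x else 0)) (at x within S)"
  by (rule jet_deriv) (use dU dW assms in auto)

text \<open>The expansion of the jets is differentiated order by order. For p < k - 1 the
  differentiated relation is again an exact expansion, so only the order k - 1 leaves an error, and
  this error is \<open>Y\<close>. That some derivative exists has to be settled beforehand, from the
  differentiability of \<open>B\<close>.\<close>

lemma coord_deriv:
  assumes q: "q < k" and x: "x \<in> S"
  shows "((\<lambda>x. coord l (u x) (v x) q x) has_real_derivative B q (k - 1) x * Y l (u x) (v x) x) (at x within S)"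
proof -
  interpret D: darboux k lam "\<lambda>q. U q x" "\<lambda>q. W q x" "\<lambda>q p. B q p x"
    by (rule pointwise[OF x])
  have "\<exists>D. ((\<lambda>x. coord l (u x) (v x) q x) has_real_derivative D) (at x within S)" if q: "q < k" for q
  proof -
    have "\<forall>p. \<exists>D. p < k \<longrightarrow> (B q p has_real_derivative D) (at x within S)"
      using dB[OF q _ x] by blast
    then obtain D where D: "\<And>p. p < k \<Longrightarrow> (B q p has_real_derivative D p) (at x within S)"
      by metis
    have "((\<lambda>x. \<Sum>p<k. B q p x * jet p l (u x) (v x)) has_real_derivative
        (\<Sum>p<k. D p * jet p l (u x) (v x) + (jet (Suc p) l (u x) (v x) + (if odd p then V x * jet (p - 1) l (u x) (v x) else 0)) * B q p x))
        (at x within S)"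
      using du[OF x] dv[OF x] by (intro DERIV_sum DERIV_mult D jet_deriv) auto
    then show ?thesis
      using has_field_derivative_transform_within[OF _ zero_less_one_class.zero_less_one x, where g = "\<lambda>x. coord l (u x) (v x) q x"]
        darboux.coord_def[OF pointwise, symmetric] by meson
  qed
  then obtain D where D: "\<And>q. q < k \<Longrightarrow> ((\<lambda>x. coord l (u x) (v x) q x) has_real_derivative D q) (at x within S)"
    by metis
  \<comment> \<open>Both sides are compared after multiplication by the jet matrix; the column of
    index k - 1 of its inverse picks out the last equation.\<close>
  have "D q = B q (k - 1) x * Y l (u x) (v x) x"
  proof (rule D.coord_eqI[OF _ q])
    fix p assume p: "p < k"
    let ?E' = "\<lambda>q. E (Suc p) q x + (if odd p then V x * E (p - 1) q x else 0)"
    have "((\<lambda>x. \<Sum>q<k. E p q x * coord l (u x) (v x) q x) has_real_derivative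
        (\<Sum>q<k. ?E' q * coord l (u x) (v x) q x + D q * E p q x)) (at x within S)"
      by (intro DERIV_sum DERIV_mult D E_deriv x) auto
    then have "((\<lambda>x. jet p l (u x) (v x)) has_real_derivative
        (\<Sum>q<k. ?E' q * coord l (u x) (v x) q x + D q * E p q x)) (at x within S)"
      by (rule has_field_derivative_transform_within[OF _ zero_less_one_class.zero_less_one x])
        (rule darboux.coord_jet[OF pointwise p])
    from has_field_derivative_unique[OF this jet_deriv[where V = V] not_bot[OF x]]
    have "(\<Sum>q<k. ?E' q * coord l (u x) (v x) q x + D q * E p q x)
        = jet (Suc p) l (u x) (v x) + (if odd p then V x * jet (p - 1) l (u x) (v x) else 0)"
      using du[OF x] dv[OF x] by blast
    moreover have "(\<Sum>q<k. ?E' q * coord l (u x) (v x) q x + D q * E p q x)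
        = (\<Sum>q<k. E (Suc p) q x * coord l (u x) (v x) q x)
          + (if odd p then V x * (\<Sum>q<k. E (p - 1) q x * coord l (u x) (v x) q x) else 0)
          + (\<Sum>q<k. E p q x * D q)"
      by (simp add: sum.distrib sum_distrib_left algebra_simps)
    moreover have "(\<Sum>q<k. E (p - 1) q x * coord l (u x) (v x) q x) = jet (p - 1) l (u x) (v x)"
      using p by (intro D.coord_jet) auto
    ultimately have "(\<Sum>q<k. E p q x * D q)
        = jet (Suc p) l (u x) (v x) - (\<Sum>q<k. E (Suc p) q x * coord l (u x) (v x) q x)"
      by (simp split: if_splits)
    also have "\<dots> = (if p = k - 1 then Y l (u x) (v x) x else 0)"
    proof (cases "p = k - 1")
      case True
      then have "Suc p = k" using D.k by simp
      with True show ?thesis by (simp add: D.Y_def mult.commute)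
    next
      case False
      then have "Suc p < k" using p by simp
      with False show ?thesis using D.coord_jet[of "Suc p"] by simp
    qed
    also have "\<dots> = (\<Sum>q<k. E p q x * B q (k - 1) x) * Y l (u x) (v x) x"
      using D.inv1[OF p, of "k - 1"] D.k by simp
    also have "\<dots> = (\<Sum>q<k. E p q x * (B q (k - 1) x * Y l (u x) (v x) x))"
      by (simp add: sum_distrib_right mult.assoc)
    finally show "(\<Sum>q<k. E p q x * D q) = (\<Sum>q<k. E p q x * (B q (k - 1) x * Y l (u x) (v x) x))" .
  qed
  with D[OF q] show ?thesis by simp
qed

text \<open>The terms with \<open>V\<close> carry jets of order k - 1, where the expansion is exact,
  and cancel. The derivatives of the coordinates contribute \<open>- beta x\<close> times
  \<open>Y\<close>.\<close>

lemma Y_deriv: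
  assumes x: "x \<in> S"
  shows "((\<lambda>x. Y l (u x) (v x) x) has_real_derivative
    Z l (u x) (v x) x - beta x * Y l (u x) (v x) x) (at x within S)"
proof -
  interpret D: darboux k lam "\<lambda>q. U q x" "\<lambda>q. W q x" "\<lambda>q p. B q p x"
    by (rule pointwise[OF x])
  let ?c = "\<lambda>q. coord l (u x) (v x) q x" and ?Y = "Y l (u x) (v x) x"
  let ?D = "jet (Suc k) l (u x) (v x) + (if odd k then V x * jet (k - 1) l (u x) (v x) else 0)
    - (\<Sum>q<k. (B q (k - 1) x * ?Y) * E k q x + (E (Suc k) q x + (if odd k then V x * E (k - 1) q x else 0)) * ?c q)"
  have "((\<lambda>x. jet k l (u x) (v x) - (\<Sum>q<k. coord l (u x) (v x) q x * E k q x)) has_real_derivative ?D) (at x within S)"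
    using du[OF x] dv[OF x]
    by (intro DERIV_diff DERIV_sum DERIV_mult coord_deriv E_deriv jet_deriv x) auto
  then have D: "((\<lambda>x. Y l (u x) (v x) x) has_real_derivative ?D) (at x within S)"
    by (rule has_field_derivative_transform_within[OF _ zero_less_one_class.zero_less_one x])
      (simp add: darboux.Y_def[OF pointwise])
  have "(\<Sum>q<k. E (k - 1) q x * ?c q) = jet (k - 1) l (u x) (v x)"
    using D.k by (intro D.coord_jet) auto
  moreover have "?D = jet (Suc k) l (u x) (v x) - (\<Sum>q<k. ?c q * E (Suc k) q x)
      - (\<Sum>q<k. E k q x * B q (k - 1) x) * ?Y
      + (if odd k then V x * (jet (k - 1) l (u x) (v x) - (\<Sum>q<k. E (k - 1) q x * ?c q)) else 0)"
    by (simp add: sum.distrib sum_distrib_left sum_distrib_right algebra_simps)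
  ultimately have "?D = Z l (u x) (v x) x - beta x * ?Y"
    by (simp add: D.Z_eq beta_def A_def)
  with D show ?thesis by simp
qed

lemma Z_deriv:
  assumes x: "x \<in> S"
  shows "((\<lambda>x. Z l (u x) (v x) x) has_real_derivative
    beta x * Z l (u x) (v x) x + (g x - l) * Y l (u x) (v x) x) (at x within S)"
proof -
  interpret D: darboux k lam "\<lambda>q. U q x" "\<lambda>q. W q x" "\<lambda>q p. B q p x"
    by (rule pointwise[OF x])
  let ?c = "\<lambda>q. coord l (u x) (v x) q x" and ?Y = "Y l (u x) (v x) x" and ?Z = "Z l (u x) (v x) x"
  have Sk: "Suc (k - 1) = k" using D.k by simp
  let ?D = "\<Sum>q<k. (B q (k - 1) x * ?Y * (lam q - l)) * E (k - 1) q x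
      + (E k q x + (if odd (k - 1) then V x * E (k - 1 - 1) q x else 0)) * (?c q * (lam q - l))"
  have "((\<lambda>x. \<Sum>q<k. coord l (u x) (v x) q x * (lam q - l) * E (k - 1) q x) has_real_derivative ?D) (at x within S)"
    using E_deriv[where p = "k - 1"] unfolding Sk
    by (intro DERIV_sum DERIV_mult DERIV_cmult_right coord_deriv x) (use x in auto)
  then have D: "((\<lambda>x. Z l (u x) (v x) x) has_real_derivative ?D) (at x within S)"
    by (rule has_field_derivative_transform_within[OF _ zero_less_one_class.zero_less_one x])
      (simp add: darboux.Z_def[OF pointwise] darboux.X_def[OF pointwise])
  \<comment> \<open>Since \<open>B\<close> inverts the jet matrix, the row of order k is a
    combination of the lower rows. This carries over to \<open>X\<close>, where only the entries k -
    1 and k - 2, that is \<open>Z\<close> and \<open>Y\<close>, are nonzero.\<close>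
  have Ek: "E k q x = (\<Sum>p<k. A p x * E p q x)" if q: "q < k" for q
  proof -
    have "(\<Sum>p<k. A p x * E p q x) = (\<Sum>p<k. \<Sum>j<k. E k j x * (B j p x * E p q x))"
      by (simp add: A_def sum_distrib_right mult.assoc)
    also have "\<dots> = (\<Sum>j<k. E k j x * (\<Sum>p<k. B j p x * E p q x))"
      by (subst sum.swap) (simp add: sum_distrib_left)
    also have "\<dots> = (\<Sum>j<k. if j = q then E k j x else 0)"
      by (intro sum.cong) (auto simp: D.inv2 q)
    also have "\<dots> = E k q x"
      using q by simp
    finally show ?thesis by simp
  qed
  have Xk: "D.X l (u x) (v x) k = (\<Sum>p<k. A p x * D.X l (u x) (v x) p)"
  proof -
    have "D.X l (u x) (v x) k = (\<Sum>q<k. \<Sum>p<k. A p x * (?c q * (lam q - l) * E p q x))"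
      by (simp add: D.X_def Ek sum_distrib_left mult_ac)
    also have "\<dots> = (\<Sum>p<k. A p x * D.X l (u x) (v x) p)"
      by (subst sum.swap) (simp add: D.X_def sum_distrib_left)
    finally show ?thesis .
  qed
  also have "\<dots> = A (k - 1) x * ?Z + (if 2 \<le> k then A (k - 2) x * ?Y else 0)"
  proof (cases "2 \<le> k")
    case True
    then obtain n where n: "k = Suc (Suc n)"
      by (metis add_2_eq_Suc less_eqE)
    have split: "sum f {..<k} = sum f {..<k - 2} + f (k - 2) + f (k - 1)" for f :: "nat \<Rightarrow> real"
      by (simp add: n)
    have "(\<Sum>p<k - 2. A p x * D.X l (u x) (v x) p) = 0"
      by (intro sum.neutral) (use D.X_below n in auto)
    moreover have "D.X l (u x) (v x) (k - 2) = ?Y" "D.X l (u x) (v x) (k - 1) = ?Z"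
      using D.X_Y[of "k - 2" l "u x" "v x"] True by (simp_all add: D.Z_def)
    ultimately show ?thesis
      unfolding split using True by simp
  next
    case False
    then have "k = 1" using D.k by simp
    then have "sum f {..<k} = f (k - 1)" for f :: "nat \<Rightarrow> real"
      by simp
    then show ?thesis
      using False by (simp only: D.Z_def) simp
  qed
  finally have Xk: "D.X l (u x) (v x) k = A (k - 1) x * ?Z + (if 2 \<le> k then A (k - 2) x * ?Y else 0)" .
  have XV: "(if even k then V x * D.X l (u x) (v x) (k - 2) else 0) = (if even k then V x * ?Y else 0)"
  proof (cases "even k")
    case True
    then have "k - 2 + 2 = k" using D.k by presburger
    then show ?thesis using D.X_Y by simp
  qed simp
  have ev: "odd (k - 1) \<longleftrightarrow> even k" "k - 1 - 1 = k - 2"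
    using D.k by auto
  have "?D = ?Y * (\<Sum>q<k. lam q * (E (k - 1) q x * B q (k - 1) x)) - l * ?Y * (\<Sum>q<k. E (k - 1) q x * B q (k - 1) x)
      + D.X l (u x) (v x) k + (if even k then V x * D.X l (u x) (v x) (k - 2) else 0)"
    unfolding ev D.X_def
    by (simp add: sum.distrib sum_distrib_left sum_subtractf algebra_simps)
  also have "(\<Sum>q<k. E (k - 1) q x * B q (k - 1) x) = 1"
    using D.inv1[of "k - 1" "k - 1"] D.k by simp
  finally have "?D = beta x * ?Z + (g x - l) * ?Y"
    unfolding Xk XV g_def beta_def by (simp add: algebra_simps)
  with D show ?thesis by simp
qed

end

end

section \<open>Deformation in the spectral parameter\<close>

text \<open>Between two different multiples of pi there is an odd multiple of pi / 2, which a
  continuous angle would have to pass, and there its cosine vanishes.\<close>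

lemma angle_unchanged:
  fixes h :: "real \<Rightarrow> real"
  assumes "a \<le> b" and cont: "continuous_on {a..b} h"
    and cos: "\<And>x. x \<in> {a..b} \<Longrightarrow> cos (h x) \<noteq> 0" and sin: "sin (h a) = 0" "sin (h b) = 0"
  shows "h a = h b"
proof -
  obtain i j :: int where ij: "h a = of_int i * pi" "h b = of_int j * pi"
    using sin by (auto simp: sin_zero_iff_int2)
  have cos0: "cos (of_int n * pi + pi / 2) = 0" for n :: int
    by (simp add: cos_add sin_zero_iff_int2)
  have lt: "of_int m * pi + pi / 2 \<le> of_int n * pi" if "m < n" for m n :: int
  proof -
    have "of_int (m + 1) * pi \<le> of_int n * pi"
      using that by (intro mult_right_mono) auto
    moreover have "of_int (m + 1) * pi = of_int m * pi + pi"
      by (simp add: algebra_simps)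
    ultimately show ?thesis using pi_gt_zero by linarith
  qed
  consider "i < j" | "j < i" | "i = j" by linarith
  then show ?thesis
  proof cases
    case 1
    then obtain x where "a \<le> x" "x \<le> b" "h x = of_int i * pi + pi / 2"
      using IVT'[of h a "of_int i * pi + pi / 2" b] lt[OF 1] ij cont \<open>a \<le> b\<close> pi_gt_zero by auto
    then show ?thesis using cos[of x] cos0 by auto
  next
    case 2
    then obtain x where "a \<le> x" "x \<le> b" "h x = of_int j * pi + pi / 2"
      using IVT2'[of h b "of_int j * pi + pi / 2" a] lt[OF 2] ij cont \<open>a \<le> b\<close> pi_gt_zero by auto
    then show ?thesis using cos[of x] cos0 by auto
  qed (use ij in simp)
qed

lemma bc_angle_unchanged:
  fixes h \<rho> :: "real \<Rightarrow> real"
  assumes "a \<le> b" "continuous_on {a..b} h" and \<rho>: "\<And>x. x \<in> {a..b} \<Longrightarrow> \<rho> x > 0"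
    and ends: "bc t (\<rho> a * cos (h a)) (\<rho> a * sin (h a))" "bc t (\<rho> b * cos (h b)) (\<rho> b * sin (h b))"
    and never: "\<And>x. x \<in> {a..b} \<Longrightarrow> \<not> bc (\<not> t) (\<rho> x * cos (h x)) (\<rho> x * sin (h x))"
  shows "h a = h b"
proof -
  have \<rho>ab: "\<rho> a \<noteq> 0" "\<rho> b \<noteq> 0"
    using \<rho>[of a] \<rho>[of b] assms(1) by auto
  show ?thesis
  proof (cases t)
    case True
    show ?thesis
    proof (rule angle_unchanged[OF assms(1,2)])
      show "cos (h x) \<noteq> 0" if "x \<in> {a..b}" for x
        using never[OF that] True by (simp add: bc_def)
      show "sin (h a) = 0" "sin (h b) = 0"
        using ends \<rho>ab True by (simp_all add: bc_def)
    qed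
  next
    case False
    \<comment> \<open>For the type \<open>False\<close> sine and cosine exchange their roles, which
      a shift by pi / 2 undoes.\<close>
    have "h a + pi / 2 = h b + pi / 2"
    proof (rule angle_unchanged[OF assms(1), where h = "\<lambda>x. h x + pi / 2"])
      show "continuous_on {a..b} (\<lambda>x. h x + pi / 2)"
        using assms(2) by (intro continuous_intros)
      show "cos (h x + pi / 2) \<noteq> 0" if "x \<in> {a..b}" for x
        using never[OF that] False by (simp add: bc_def cos_add)
      show "sin (h a + pi / 2) = 0" "sin (h b + pi / 2) = 0"
        using ends \<rho>ab False by (simp_all add: bc_def sin_add)
    qed
    then show ?thesis by simp
  qed
qed

text \<open>The angle is lifted over the whole rectangle, so that angles for different
  \<open>l\<close> belong to one continuous branch. The condition at 0 keeps the initial angle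
  fixed, the conditions at \<open>c\<close> keep the final angles at the two ends equal, and strict
  comparison denies the latter.\<close>

lemma bc_homotopy_contradiction:
  fixes Y Z :: "real \<times> real \<Rightarrow> real"
  assumes "0 < c" "l\<^sub>1 < l\<^sub>2" and coeff: "continuous_on {0..c} \<beta>" "continuous_on {0..c} g"
    and cont: "continuous_on ({0..c} \<times> {l\<^sub>1..l\<^sub>2}) Y" "continuous_on ({0..c} \<times> {l\<^sub>1..l\<^sub>2}) Z"
    and nz: "\<And>x l. x \<in> {0..c} \<Longrightarrow> l \<in> {l\<^sub>1..l\<^sub>2} \<Longrightarrow> Y (x, l) \<noteq> 0 \<or> Z (x, l) \<noteq> 0"
    and dY: "\<And>x l. x \<in> {0..c} \<Longrightarrow> l \<in> {l\<^sub>1..l\<^sub>2} \<Longrightarrow>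
      ((\<lambda>x. Y (x, l)) has_real_derivative Z (x, l) - \<beta> x * Y (x, l)) (at x within {0..c})"
    and dZ: "\<And>x l. x \<in> {0..c} \<Longrightarrow> l \<in> {l\<^sub>1..l\<^sub>2} \<Longrightarrow>
      ((\<lambda>x. Z (x, l)) has_real_derivative \<beta> x * Z (x, l) + (g x - l) * Y (x, l)) (at x within {0..c})"
    and left: "\<And>l. l \<in> {l\<^sub>1..l\<^sub>2} \<Longrightarrow> bc t (Y (0, l)) (Z (0, l))"
    and right: "bc t' (Y (c, l\<^sub>1)) (Z (c, l\<^sub>1))" "bc t' (Y (c, l\<^sub>2)) (Z (c, l\<^sub>2))"
    and never: "\<And>l. l \<in> {l\<^sub>1..l\<^sub>2} \<Longrightarrow> \<not> bc (\<not> t') (Y (c, l)) (Z (c, l))"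
  shows False
proof -
  let ?R = "{0..c} \<times> {l\<^sub>1..l\<^sub>2}"
  have nz': "Y z \<noteq> 0 \<or> Z z \<noteq> 0" if "z \<in> ?R" for z
    using nz[of "fst z" "snd z"] that by auto
  obtain \<rho> \<theta> where \<theta>: "continuous_on ?R \<theta>" and \<rho>: "\<And>z. z \<in> ?R \<Longrightarrow> \<rho> z > 0"
      and Y: "\<And>z. z \<in> ?R \<Longrightarrow> Y z = \<rho> z * cos (\<theta> z)" and Z: "\<And>z. z \<in> ?R \<Longrightarrow> Z z = \<rho> z * sin (\<theta> z)"
    by (rule polar_lift[OF convex_Times[OF convex_real_interval(5) convex_real_interval(5)] cont nz'])
      (assumption, rule that, assumption+)
  have c0: "0 \<in> {0..c}" "c \<in> {0..c}"
    using \<open>0 < c\<close> by auto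
  have polar: "bc s (Y (x, l)) (Z (x, l)) \<longleftrightarrow> bc s (\<rho> (x, l) * cos (\<theta> (x, l))) (\<rho> (x, l) * sin (\<theta> (x, l)))"
    if "x \<in> {0..c}" "l \<in> {l\<^sub>1..l\<^sub>2}" for x l s
    using that by (simp add: Y Z)
  have sec: "continuous_on {l\<^sub>1..l\<^sub>2} (\<lambda>l. \<theta> (x, l))" if "x \<in> {0..c}" for x
  proof (rule continuous_on_compose2[OF \<theta>])
    show "continuous_on {l\<^sub>1..l\<^sub>2} (\<lambda>l. (x, l))" by (intro continuous_intros)
    show "(\<lambda>l. (x, l)) ` {l\<^sub>1..l\<^sub>2} \<subseteq> ?R" using that by auto
  qed
  have not_both: "\<not> bc (\<not> t) (Y (0, l)) (Z (0, l))" if "l \<in> {l\<^sub>1..l\<^sub>2}" for l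
    using left[OF that] nz[OF _ that, of 0] \<open>0 < c\<close> by (auto simp: bc_def)
  have ends: "l\<^sub>1 \<in> {l\<^sub>1..l\<^sub>2}" "l\<^sub>2 \<in> {l\<^sub>1..l\<^sub>2}"
    using \<open>l\<^sub>1 < l\<^sub>2\<close> by auto
  have eq0: "\<theta> (0, l\<^sub>1) = \<theta> (0, l\<^sub>2)"
  proof (rule bc_angle_unchanged[OF less_imp_le[OF \<open>l\<^sub>1 < l\<^sub>2\<close>] sec[OF c0(1)], where \<rho> = "\<lambda>l. \<rho> (0, l)" and t = t])
    show "\<rho> (0, l) > 0" if "l \<in> {l\<^sub>1..l\<^sub>2}" for l
      using \<rho> that c0(1) by blast
    show "bc t (\<rho> (0, l\<^sub>1) * cos (\<theta> (0, l\<^sub>1))) (\<rho> (0, l\<^sub>1) * sin (\<theta> (0, l\<^sub>1)))"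
      "bc t (\<rho> (0, l\<^sub>2) * cos (\<theta> (0, l\<^sub>2))) (\<rho> (0, l\<^sub>2) * sin (\<theta> (0, l\<^sub>2)))"
      using left[of l\<^sub>1] left[of l\<^sub>2] ends by (auto simp only: polar[OF c0(1)])
    show "\<not> bc (\<not> t) (\<rho> (0, l) * cos (\<theta> (0, l))) (\<rho> (0, l) * sin (\<theta> (0, l)))"
      if "l \<in> {l\<^sub>1..l\<^sub>2}" for l
      using not_both[OF that] by (simp only: polar[OF c0(1) that] simp_thms)
  qed
  have eqc: "\<theta> (c, l\<^sub>1) = \<theta> (c, l\<^sub>2)"
  proof (rule bc_angle_unchanged[OF less_imp_le[OF \<open>l\<^sub>1 < l\<^sub>2\<close>] sec[OF c0(2)], where \<rho> = "\<lambda>l. \<rho> (c, l)" and t = t'])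
    show "\<rho> (c, l) > 0" if "l \<in> {l\<^sub>1..l\<^sub>2}" for l
      using \<rho> that c0(2) by blast
    show "bc t' (\<rho> (c, l\<^sub>1) * cos (\<theta> (c, l\<^sub>1))) (\<rho> (c, l\<^sub>1) * sin (\<theta> (c, l\<^sub>1)))"
      "bc t' (\<rho> (c, l\<^sub>2) * cos (\<theta> (c, l\<^sub>2))) (\<rho> (c, l\<^sub>2) * sin (\<theta> (c, l\<^sub>2)))"
      using right ends by (auto simp only: polar[OF c0(2)])
    show "\<not> bc (\<not> t') (\<rho> (c, l) * cos (\<theta> (c, l))) (\<rho> (c, l) * sin (\<theta> (c, l)))"
      if "l \<in> {l\<^sub>1..l\<^sub>2}" for l
      using never[OF that] by (simp only: polar[OF c0(2) that] simp_thms)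
  qed
  have "prufer \<beta> g l c (\<lambda>x. \<theta> (x, l))" if l: "l \<in> {l\<^sub>1..l\<^sub>2}" for l
  proof (rule polar_angle_prufer[where \<rho> = "\<lambda>x. \<rho> (x, l)" and u = "\<lambda>x. Y (x, l)" and v = "\<lambda>x. Z (x, l)"])
    show "continuous_on {0..c} (\<lambda>x. \<theta> (x, l))"
    proof (rule continuous_on_compose2[OF \<theta>])
      show "continuous_on {0..c} (\<lambda>x. (x, l))" by (intro continuous_intros)
      show "(\<lambda>x. (x, l)) ` {0..c} \<subseteq> ?R" using l by auto
    qed
    fix x assume x: "x \<in> {0..c}"
    then have R: "(x, l) \<in> ?R" using l by auto
    show "\<rho> (x, l) > 0" "Y (x, l) = \<rho> (x, l) * cos (\<theta> (x, l))" "Z (x, l) = \<rho> (x, l) * sin (\<theta> (x, l))"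
      by (rule \<rho>[OF R] Y[OF R] Z[OF R])+
    show "((\<lambda>x. Y (x, l)) has_real_derivative Z (x, l) - \<beta> x * Y (x, l)) (at x within {0..c})"
      by (rule dY[OF x l])
    show "((\<lambda>x. Z (x, l)) has_real_derivative \<beta> x * Z (x, l) + (g x - l) * Y (x, l)) (at x within {0..c})"
      by (rule dZ[OF x l])
  qed
  from prufer_comparison[OF coeff \<open>0 < c\<close> this[OF ends(1)] this[OF ends(2)] \<open>l\<^sub>1 < l\<^sub>2\<close>] eq0
  have "\<theta> (c, l\<^sub>2) < \<theta> (c, l\<^sub>1)" by simp
  with eqc show False by simp
qed

lemma wronskian_constant:
  fixes u v u' v' :: "real \<Rightarrow> real"
  assumes "\<And>x. x \<in> {0..c} \<Longrightarrow> (u has_real_derivative v x) (at x within {0..c})"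
    "\<And>x. x \<in> {0..c} \<Longrightarrow> (v has_real_derivative (V x - l) * u x) (at x within {0..c})"
    "\<And>x. x \<in> {0..c} \<Longrightarrow> (u' has_real_derivative v' x) (at x within {0..c})"
    "\<And>x. x \<in> {0..c} \<Longrightarrow> (v' has_real_derivative (V x - l) * u' x) (at x within {0..c})"
    and x: "x \<in> {0..c}"
  shows "u x * v' x - v x * u' x = u 0 * v' 0 - v 0 * u' 0"
proof -
  have "((\<lambda>x. u x * v' x - v x * u' x) has_real_derivative 0) (at y within {0..c})" if "y \<in> {0..c}" for y
    using DERIV_diff[OF DERIV_mult[OF assms(1)[OF that] assms(4)[OF that]]
        DERIV_mult[OF assms(2)[OF that] assms(3)[OF that]]]
    by (simp add: algebra_simps)
  then obtain k where "\<And>y. y \<in> {0..c} \<Longrightarrow> u y * v' y - v y * u' y = k"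
    using has_field_derivative_zero_constant[of "{0..c}" "\<lambda>x. u x * v' x - v x * u' x"] by auto
  then show ?thesis
    using x by (metis atLeastAtMost_iff order_refl order_trans)
qed

text \<open>Column \<open>j\<close> is the member of the pair inside the chosen set,
  \<open>(u, v)\<close> the one outside, and \<open>t\<close> is the type of the latter. The pair of
  eigenvalues is unordered because either member may be the lower one.\<close>

lemma darboux_ode_contradiction:
  assumes D: "darboux_ode k lam U W B V {0..c}" and "0 < c"
    and bcs: "\<And>q. q < k \<Longrightarrow> bc (\<tau> q) (U q 0) (W q 0) \<and> bc (\<tau> q) (U q c) (W q c)"
    and j: "j < k" "\<tau> j \<noteq> t" "U j 0 \<noteq> 0 \<or> W j 0 \<noteq> 0"
    and ends: "l\<^sub>1 < l\<^sub>2" "{lam j, l} = {l\<^sub>1, l\<^sub>2}"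
    and lam: "\<And>q. q < k \<Longrightarrow> lam q \<in> {l\<^sub>1..l\<^sub>2} \<Longrightarrow> q = j"
    and du: "\<And>x. x \<in> {0..c} \<Longrightarrow> (u has_real_derivative v x) (at x within {0..c})"
    and dv: "\<And>x. x \<in> {0..c} \<Longrightarrow> (v has_real_derivative (V x - l) * u x) (at x within {0..c})"
    and uv: "bc t (u 0) (v 0)" "bc t (u c) (v c)" "u 0 \<noteq> 0 \<or> v 0 \<noteq> 0"
    and gap: "\<And>l y z. l\<^sub>1 < l \<Longrightarrow> l < l\<^sub>2 \<Longrightarrow>
      (\<And>x. x \<in> {0..c} \<Longrightarrow> (y has_real_derivative z x) (at x within {0..c})) \<Longrightarrow>
      (\<And>x. x \<in> {0..c} \<Longrightarrow> (z has_real_derivative (V x - l) * y x) (at x within {0..c})) \<Longrightarrow>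
      y 0 \<noteq> 0 \<or> z 0 \<noteq> 0 \<Longrightarrow> bc t (y 0) (z 0) \<Longrightarrow> \<not> bc (\<not> t) (y c) (z c)"
  shows False
proof -
  interpret D: darboux_ode k lam U W B V "{0..c}" by (rule D)
  let ?R = "{0..c} \<times> {l\<^sub>1..l\<^sub>2}"
  have c0: "0 \<in> {0..c}" "c \<in> {0..c}" using \<open>0 < c\<close> by auto
  have endj: "lam j \<in> {l\<^sub>1..l\<^sub>2}" and endl: "l \<in> {l\<^sub>1..l\<^sub>2}" and lj: "l \<noteq> lam j"
    and between: "\<And>m. m \<in> {l\<^sub>1..l\<^sub>2} \<Longrightarrow> m = lam j \<or> m = l \<or> (l\<^sub>1 < m \<and> m < l\<^sub>2)"
    using ends by (auto simp: doubleton_eq_iff)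
  obtain y z :: "real \<times> real \<Rightarrow> real" where
      cy: "continuous_on ?R y" and cz: "continuous_on ?R z"
      and y0: "\<And>m. m \<in> {l\<^sub>1..l\<^sub>2} \<Longrightarrow> y (0, m) = (if t then 1 else 0)"
      and z0: "\<And>m. m \<in> {l\<^sub>1..l\<^sub>2} \<Longrightarrow> z (0, m) = (if t then 0 else 1)"
      and dy: "\<And>x m. x \<in> {0..c} \<Longrightarrow> m \<in> {l\<^sub>1..l\<^sub>2} \<Longrightarrow>
        ((\<lambda>x. y (x, m)) has_real_derivative z (x, m)) (at x within {0..c})"
      and dz: "\<And>x m. x \<in> {0..c} \<Longrightarrow> m \<in> {l\<^sub>1..l\<^sub>2} \<Longrightarrow>
        ((\<lambda>x. z (x, m)) has_real_derivative (V x - m) * y (x, m)) (at x within {0..c})"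
    by (rule linear_ode_solution[OF D.contV less_imp_le[OF \<open>0 < c\<close>],
          of l\<^sub>1 l\<^sub>2 "if t then 1 else 0" "if t then 0 else 1"]) (rule that, assumption+)
  have yz_nz: "y (x, m) \<noteq> 0 \<or> z (x, m) \<noteq> 0" if "x \<in> {0..c}" "m \<in> {l\<^sub>1..l\<^sub>2}" for x m
    using linear_ode_zero[OF D.contV dy[OF _ that(2)] dz[OF _ that(2)] that(1) _ _ c0(1)] y0[OF that(2)] z0[OF that(2)]
    by (auto split: if_splits)
  define Y where "Y = (\<lambda>(x, m). D.Y m (y (x, m)) (z (x, m)) x)"
  define Z where "Z = (\<lambda>(x, m). D.Z m (y (x, m)) (z (x, m)) x)"
  \<comment> \<open>\<open>y\<close> and column \<open>j\<close> have opposite types at 0, so their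
    Wronskian is nonzero there, and it is constant. This is what keeps the transform of
    \<open>y\<close> nonzero at the resonant value \<open>lam j\<close>.\<close>
  have wj: "y (x, lam j) * W j x - z (x, lam j) * U j x \<noteq> 0" if "x \<in> {0..c}" for x
  proof -
    have "y (x, lam j) * W j x - z (x, lam j) * U j x = y (0, lam j) * W j 0 - z (0, lam j) * U j 0"
      using wronskian_constant[OF dy[OF _ endj] dz[OF _ endj] D.dU[OF j(1)] D.dW[OF j(1)] that] .
    then show ?thesis
      using bcs[OF j(1)] j(2,3) y0[OF endj] z0[OF endj] by (auto simp: bc_def split: if_splits)
  qed
  have nz: "Y (x, m) \<noteq> 0 \<or> Z (x, m) \<noteq> 0" if x: "x \<in> {0..c}" and m: "m \<in> {l\<^sub>1..l\<^sub>2}" for x m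
  proof -
    interpret P: darboux k lam "\<lambda>q. U q x" "\<lambda>q. W q x" "\<lambda>q p. B q p x"
      by (rule D.pointwise[OF x])
    show ?thesis
    proof (cases "m = lam j")
      case True
      have "D.Y m (y (x, m)) (z (x, m)) x \<noteq> 0 \<or> D.Z m (y (x, m)) (z (x, m)) x \<noteq> 0"
      proof (rule P.nonvanishing_resonant[OF _ j(1)])
        show "y (x, m) * W j x - z (x, m) * U j x \<noteq> 0"
          using wj[OF x] True by simp
        show "lam q \<noteq> m" if "q < k" "q \<noteq> j" for q
          using lam[OF that(1)] that(2) m by blast
      qed
      then show ?thesis by (simp add: Y_def Z_def)
    next
      case False
      have "D.Y m (y (x, m)) (z (x, m)) x \<noteq> 0 \<or> D.Z m (y (x, m)) (z (x, m)) x \<noteq> 0"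
      proof (rule P.nonvanishing[OF yz_nz[OF x m]])
        show "lam q \<noteq> m" if "q < k" for q
          using lam[OF that] False m by blast
      qed
      then show ?thesis by (simp add: Y_def Z_def)
    qed
  qed
  have fst_cont: "continuous_on ?R (\<lambda>z. f (fst z))" if "continuous_on {0..c} f" for f :: "real \<Rightarrow> real"
    by (rule continuous_on_compose2[OF that]) (auto intro!: continuous_intros)
  have cjet: "continuous_on ?R (\<lambda>w. jet p (snd w) (y w) (z w))" for p
    unfolding jet_def by (cases "even p") (auto intro!: continuous_intros cy cz)
  have ccoord: "continuous_on ?R (\<lambda>w. \<Sum>p<k. B q p (fst w) * jet p (snd w) (y w) (z w))" if "q < k" for q
    using that by (intro continuous_on_sum continuous_on_mult cjet fst_cont D.contB) auto
  have contY: "continuous_on ?R Y"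
  proof -
    have "continuous_on ?R (\<lambda>w. jet k (snd w) (y w) (z w)
        - (\<Sum>q<k. (\<Sum>p<k. B q p (fst w) * jet p (snd w) (y w) (z w)) * D.E k q (fst w)))"
      by (intro continuous_on_diff continuous_on_sum continuous_on_mult cjet ccoord fst_cont D.contE) auto
    then show ?thesis
      by (subst continuous_on_cong[OF refl])
        (auto simp: Y_def darboux.Y_def[OF D.pointwise] darboux.coord_def[OF D.pointwise])
  qed
  have contZ: "continuous_on ?R Z"
  proof -
    have "continuous_on ?R (\<lambda>w. \<Sum>q<k. (\<Sum>p<k. B q p (fst w) * jet p (snd w) (y w) (z w))
        * (lam q - snd w) * D.E (k - 1) q (fst w))"
      by (intro continuous_on_diff continuous_on_sum continuous_on_mult ccoord fst_cont D.contE
          continuous_on_const continuous_on_snd continuous_on_id) auto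
    then show ?thesis
      by (subst continuous_on_cong[OF refl])
        (auto simp: Z_def darboux.Z_def[OF D.pointwise] darboux.X_def[OF D.pointwise] darboux.coord_def[OF D.pointwise])
  qed
  interpret P0: darboux k lam "\<lambda>q. U q 0" "\<lambda>q. W q 0" "\<lambda>q p. B q p 0"
    by (rule D.pointwise[OF c0(1)])
  interpret Pc: darboux k lam "\<lambda>q. U q c" "\<lambda>q. W q c" "\<lambda>q p. B q p c"
    by (rule D.pointwise[OF c0(2)])
  let ?t = "t = even k"
  have img: "bc (s = even k) (Pc.Y m a b) (Pc.Z m a b)" if "bc s a b" for m a b s
    using that bcs by (intro Pc.bc_image[where \<tau> = \<tau>]) auto
  have split: "Pc.Y m a b = Pc.Y m a 0 + Pc.Y m 0 b" "Pc.Z m a b = Pc.Z m a 0 + Pc.Z m 0 b" for m a b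
    using Pc.Y_linear[of m 1 a 1 0 0 b] Pc.Z_linear[of m 1 a 1 0 0 b] by simp_all
  have scale: "Pc.Y m (r * a) (r * b) = r * Pc.Y m a b" "Pc.Z m (r * a) (r * b) = r * Pc.Z m a b" for m r a b
    using Pc.Y_linear[of m r a 0 0 b 0] Pc.Z_linear[of m r a 0 0 b 0] by simp_all
  \<comment> \<open>Two solutions of the same equation with the same type at 0 are proportional, so
    \<open>y\<close> inherits the type of \<open>(u, v)\<close> at \<open>c\<close>.\<close>
  have right_l: "bc ?t (Y (c, l)) (Z (c, l))"
  proof -
    have "y (c, l) * v c - z (c, l) * u c = y (0, l) * v 0 - z (0, l) * u 0"
      by (rule wronskian_constant[OF dy[OF _ endl] dz[OF _ endl] du dv c0(2)])
    also have "\<dots> = 0"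
      using uv(1) y0[OF endl] z0[OF endl] by (auto simp: bc_def)
    moreover have "u c \<noteq> 0 \<or> v c \<noteq> 0"
      using linear_ode_zero[OF D.contV du dv c0(2) _ _ c0(1)] uv(3) by blast
    ultimately have "bc t (y (c, l)) (z (c, l))"
      using uv(2) by (auto simp: bc_def split: if_splits)
    then show ?thesis
      unfolding Y_def Z_def using img by simp
  qed
  \<comment> \<open>At \<open>c\<close> the pair splits into its two types. The component with the
    type of column \<open>j\<close> is a multiple of that column and is killed; the other has type
    \<open>t\<close>, and its image has type \<open>?t\<close>.\<close>
  have right_j: "bc ?t (Y (c, lam j)) (Z (c, lam j))"
  proof -
    let ?a = "y (c, lam j)" and ?b = "z (c, lam j)"
    have nzj: "U j c \<noteq> 0 \<or> W j c \<noteq> 0"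
      using wj[OF c0(2)] by auto
    have kill: "Pc.Y (lam j) (r * U j c) (r * W j c) = 0" "Pc.Z (lam j) (r * U j c) (r * W j c) = 0" for r
      using Pc.kills[OF j(1)] by (simp_all add: scale)
    show ?thesis
    proof (cases t)
      case True
      then have "U j c = 0" "W j c \<noteq> 0"
        using bcs[OF j(1)] j(2) nzj by (auto simp: bc_def split: if_splits)
      then have "Pc.Y (lam j) 0 ?b = 0" "Pc.Z (lam j) 0 ?b = 0"
        using kill[of "?b / W j c"] by simp_all
      then show ?thesis
        using img[of t ?a 0 "lam j"] True split[of "lam j" ?a ?b] by (simp add: Y_def Z_def bc_def)
    next
      case False
      then have "W j c = 0" "U j c \<noteq> 0"
        using bcs[OF j(1)] j(2) nzj by (auto simp: bc_def split: if_splits)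
      then have "Pc.Y (lam j) ?a 0 = 0" "Pc.Z (lam j) ?a 0 = 0"
        using kill[of "?a / U j c"] by simp_all
      then show ?thesis
        using img[of t 0 ?b "lam j"] False split[of "lam j" ?a ?b] by (simp add: Y_def Z_def bc_def)
    qed
  qed
  have never: "\<not> bc (\<not> ?t) (Y (c, m)) (Z (c, m))" if m: "m \<in> {l\<^sub>1..l\<^sub>2}" for m
  proof
    assume *: "bc (\<not> ?t) (Y (c, m)) (Z (c, m))"
    show False
    proof (cases "l\<^sub>1 < m \<and> m < l\<^sub>2")
      case False
      with between[OF m] have "bc ?t (Y (c, m)) (Z (c, m))"
        using right_l right_j by auto
      with * nz[OF c0(2) m] show False
        by (auto simp: bc_def split: if_splits)
    next
      case True
      let ?a = "y (c, m)" and ?b = "z (c, m)"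
      have lam_m: "lam q \<noteq> m" if "q < k" for q
      proof
        assume m': "lam q = m"
        with lam[OF that] m have "q = j" by simp
        moreover have "lam j = l\<^sub>1 \<or> lam j = l\<^sub>2"
          using ends(2) by blast
        ultimately show False
          using m' True by auto
      qed
      have Y: "Y (c, m) = Pc.Y m ?a 0 + Pc.Y m 0 ?b" and Z: "Z (c, m) = Pc.Z m ?a 0 + Pc.Z m 0 ?b"
        unfolding Y_def Z_def using split[of m ?a ?b] by simp_all
      \<comment> \<open>The components of types \<open>t\<close> and \<open>\<not> t\<close> have
        images of opposite types. If the whole image has the type belonging to
        \<open>\<not> t\<close>, the image of the first component is zero, and so is this component,
        since \<open>m\<close> is not an eigenvalue of any column.\<close>
      have "bc (\<not> t) ?a ?b"
      proof (cases t)
        case True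
        then have "Pc.Y m ?a 0 = 0 \<and> Pc.Z m ?a 0 = 0"
          using img[of True ?a 0 m] img[of False 0 ?b m] * Y Z by (auto simp: bc_def split: if_splits)
        then have "?a = 0"
          using Pc.nonvanishing[of ?a 0 m] lam_m by blast
        then show ?thesis using True by (simp add: bc_def)
      next
        case False
        then have "Pc.Y m 0 ?b = 0 \<and> Pc.Z m 0 ?b = 0"
          using img[of True ?a 0 m] img[of False 0 ?b m] * Y Z by (auto simp: bc_def split: if_splits)
        then have "?b = 0"
          using Pc.nonvanishing[of 0 ?b m] lam_m by blast
        then show ?thesis using False by (simp add: bc_def)
      qed
      moreover have "\<not> bc (\<not> t) ?a ?b"
        using gap[of m "\<lambda>x. y (x, m)" "\<lambda>x. z (x, m)"] True dy[OF _ m] dz[OF _ m] yz_nz[OF c0(1) m] y0[OF m] z0[OF m]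
        by (auto simp: bc_def)
      ultimately show False by blast
    qed
  qed
  show False
  proof (rule bc_homotopy_contradiction[OF \<open>0 < c\<close> ends(1) D.cont_beta D.cont_g contY contZ nz])
    fix x m assume x: "x \<in> {0..c}" and m: "m \<in> {l\<^sub>1..l\<^sub>2}"
    show "((\<lambda>x. Y (x, m)) has_real_derivative Z (x, m) - D.beta x * Y (x, m)) (at x within {0..c})"
      unfolding Y_def Z_def prod.case using D.Y_deriv[OF dy[OF _ m] dz[OF _ m] x] .
    show "((\<lambda>x. Z (x, m)) has_real_derivative D.beta x * Z (x, m) + (D.g x - m) * Y (x, m)) (at x within {0..c})"
      unfolding Y_def Z_def prod.case using D.Z_deriv[OF dy[OF _ m] dz[OF _ m] x] .
  next
    fix m assume m: "m \<in> {l\<^sub>1..l\<^sub>2}"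
    have "bc t (y (0, m)) (z (0, m))"
      using y0[OF m] z0[OF m] by (simp add: bc_def)
    then show "bc ?t (Y (0, m)) (Z (0, m))"
      unfolding Y_def Z_def prod.case by (rule P0.bc_image[rotated]) (use bcs in auto)
  next
    show "bc ?t (Y (c, l\<^sub>1)) (Z (c, l\<^sub>1))" "bc ?t (Y (c, l\<^sub>2)) (Z (c, l\<^sub>2))"
      using right_l right_j ends(2) by (auto simp: doubleton_eq_iff)
  qed (use never in auto)
qed

section \<open>Wronskians\<close>

text \<open>A class of smooth functions closed under products and \<open>deriv\<close> that contains
  the potential; inside it repeated differentiation needs no further smoothness conditions.\<close>

inductive_set trig_alg :: "(real \<Rightarrow> real) set" where
  const: "(\<lambda>x. c) \<in> trig_alg"
| sin: "(\<lambda>x. sin (a * x)) \<in> trig_alg"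
| cos: "(\<lambda>x. cos (a * x)) \<in> trig_alg"
| add: "f \<in> trig_alg \<Longrightarrow> g \<in> trig_alg \<Longrightarrow> (\<lambda>x. f x + g x) \<in> trig_alg"
| mult: "f \<in> trig_alg \<Longrightarrow> g \<in> trig_alg \<Longrightarrow> (\<lambda>x. f x * g x) \<in> trig_alg"

lemma trig_alg_sum: "(\<And>i. i \<in> A \<Longrightarrow> f i \<in> trig_alg) \<Longrightarrow> (\<lambda>x. \<Sum>i\<in>A. f i x) \<in> trig_alg"
  by (induction A rule: infinite_finite_induct) (auto intro: trig_alg.intros)

lemma trig_alg_has_deriv:
  "f \<in> trig_alg \<Longrightarrow> \<exists>f'\<in>trig_alg. \<forall>x. (f has_real_derivative f' x) (at x)"
proof (induction rule: trig_alg.induct)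
  case (const c)
  show ?case
    by (intro bexI[of _ "\<lambda>x. 0"]) (auto intro: trig_alg.const)
next
  case (sin a)
  show ?case
    by (intro bexI[of _ "\<lambda>x. a * cos (a * x)"])
      (auto intro!: derivative_eq_intros trig_alg.mult[OF trig_alg.const trig_alg.cos])
next
  case (cos a)
  show ?case
  proof (intro bexI allI)
    show "((\<lambda>x. cos (a * x)) has_real_derivative - a * sin (a * x)) (at x)" for x
      by (auto intro!: derivative_eq_intros)
    show "(\<lambda>x. - a * sin (a * x)) \<in> trig_alg"
      by (rule trig_alg.mult[OF trig_alg.const trig_alg.sin])
  qed
next
  case (add f g)
  then obtain f' g' where "f' \<in> trig_alg" "\<forall>x. (f has_real_derivative f' x) (at x)"
    "g' \<in> trig_alg" "\<forall>x. (g has_real_derivative g' x) (at x)" by blast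
  then show ?case
    by (intro bexI[of _ "\<lambda>x. f' x + g' x"]) (auto intro: trig_alg.add DERIV_add)
next
  case (mult f g)
  then obtain f' g' where *: "f' \<in> trig_alg" "\<forall>x. (f has_real_derivative f' x) (at x)"
    "g' \<in> trig_alg" "\<forall>x. (g has_real_derivative g' x) (at x)" by blast
  show ?case
  proof (intro bexI[of _ "\<lambda>x. f' x * g x + g' x * f x"] allI)
    show "((\<lambda>x. f x * g x) has_real_derivative f' x * g x + g' x * f x) (at x)" for x
      using * by (intro DERIV_mult) auto
    show "(\<lambda>x. f' x * g x + g' x * f x) \<in> trig_alg"
      using * mult.hyps by (intro trig_alg.add trig_alg.mult)
  qed
qed

lemma trig_alg_deriv:
  assumes "f \<in> trig_alg"
  shows "deriv f \<in> trig_alg" "(f has_real_derivative deriv f x) (at x)"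
proof -
  obtain f' where f': "f' \<in> trig_alg" "\<And>x. (f has_real_derivative f' x) (at x)"
    using trig_alg_has_deriv[OF assms] by blast
  then have "deriv f = f'"
    by (auto intro: DERIV_imp_deriv)
  with f' show "deriv f \<in> trig_alg" "(f has_real_derivative deriv f x) (at x)"
    by auto
qed

text \<open>For \<open>y'' = (V - l) y\<close> the \<open>p\<close>-th derivative of \<open>y\<close> is
  \<open>\<Sum>r. wcoef V p r * jet r l y y'\<close>; see \<open>jet_deriv\<close> for the recursion.\<close>

primrec wcoef :: "(real \<Rightarrow> real) \<Rightarrow> nat \<Rightarrow> nat \<Rightarrow> real \<Rightarrow> real" where
  "wcoef V 0 = (\<lambda>r x. if r = 0 then 1 else 0)"
| "wcoef V (Suc p) = (\<lambda>r x. deriv (wcoef V p r) x + (if r = 0 then 0 else wcoef V p (r - 1) x)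
     + (if even r then V x * wcoef V p (Suc r) x else 0))"

lemma wcoef_trig_alg:
  assumes "V \<in> trig_alg"
  shows "wcoef V p r \<in> trig_alg"
proof (induction p arbitrary: r)
  case (Suc p)
  have "(\<lambda>x. if r = 0 then 0 else wcoef V p (r - 1) x) \<in> trig_alg"
    using Suc[of "r - 1"] trig_alg.const[of 0] by (cases "r = 0") simp_all
  moreover have "(\<lambda>x. if even r then V x * wcoef V p (Suc r) x else 0) \<in> trig_alg"
    using trig_alg.mult[OF assms Suc[of "Suc r"]] trig_alg.const[of 0] by (cases "even r") simp_all
  ultimately show ?case
    unfolding wcoef.simps by (intro trig_alg.add trig_alg_deriv Suc)
qed (auto intro: trig_alg.const)

lemma wcoef_eq_0: "p < r \<Longrightarrow> wcoef V p r x = 0"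
proof (induction p arbitrary: r x)
  case (Suc p)
  have "wcoef V p r = (\<lambda>_. 0)"
    using Suc by auto
  with Suc show ?case by auto
qed auto

text \<open>The length \<open>N\<close> of the sum is free because coefficients of index above
  \<open>p\<close> vanish. With one common length for all orders the identity becomes a
  factorization of the Wronskian matrix.\<close>

lemma iterated_deriv_jet:
  assumes V: "V \<in> trig_alg"
    and du: "\<And>x. (u has_real_derivative v x) (at x)"
    and dv: "\<And>x. (v has_real_derivative (V x - l) * u x) (at x)"
  shows "p < N \<Longrightarrow> (deriv ^^ p) u x = (\<Sum>r<N. wcoef V p r x * jet r l (u x) (v x))"
proof (induction p arbitrary: N x)
  case 0
  have "(\<Sum>r<N. wcoef V 0 r x * jet r l (u x) (v x)) = (\<Sum>r<N. if r = 0 then u x else 0)"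
    by (intro sum.cong) auto
  with 0 show ?case by simp
next
  case (Suc p)
  let ?J = "\<lambda>r x. jet r l (u x) (v x)"
  obtain M where N: "N = Suc M" and M: "p < M"
    using Suc.prems by (cases N) auto
  have eq: "(deriv ^^ p) u = (\<lambda>x. \<Sum>r<N. wcoef V p r x * ?J r x)"
    using Suc by auto
  have d: "((deriv ^^ p) u has_real_derivative (\<Sum>r<N. deriv (wcoef V p r) x * ?J r x
      + (?J (Suc r) x + (if odd r then V x * ?J (r - 1) x else 0)) * wcoef V p r x)) (at x)"
    unfolding eq
    by (intro DERIV_sum DERIV_mult trig_alg_deriv wcoef_trig_alg V jet_deriv[where S = UNIV, simplified] du dv)
  have 1: "(\<Sum>r<N. ?J (Suc r) x * wcoef V p r x) = (\<Sum>r<N. (if r = 0 then 0 else wcoef V p (r - 1) x) * ?J r x)"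
  proof -
    have "(\<Sum>r<N. ?J (Suc r) x * wcoef V p r x) = (\<Sum>r<M. wcoef V p r x * ?J (Suc r) x)"
      using M by (simp add: N wcoef_eq_0 mult.commute del: jet_simps)
    also have "\<dots> = (\<Sum>r<N. (if r = 0 then 0 else wcoef V p (r - 1) x) * ?J r x)"
      unfolding N sum.lessThan_Suc_shift by (simp del: jet_simps)
    finally show ?thesis .
  qed
  have 2: "(\<Sum>r<N. (if odd r then V x * ?J (r - 1) x else 0) * wcoef V p r x)
      = (\<Sum>r<N. (if even r then V x * wcoef V p (Suc r) x else 0) * ?J r x)"
  proof -
    have "(\<Sum>r<N. (if odd r then V x * ?J (r - 1) x else 0) * wcoef V p r x)
        = (\<Sum>r<M. (if odd (Suc r) then V x * ?J r x else 0) * wcoef V p (Suc r) x)"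
      unfolding N sum.lessThan_Suc_shift by (simp cong: if_cong)
    also have "\<dots> = (\<Sum>r<M. (if even r then V x * wcoef V p (Suc r) x else 0) * ?J r x)"
      by (intro sum.cong) auto
    also have "\<dots> = (\<Sum>r<N. (if even r then V x * wcoef V p (Suc r) x else 0) * ?J r x)"
      using M by (simp add: N wcoef_eq_0)
    finally show ?thesis .
  qed
  have "(deriv ^^ Suc p) u x = (\<Sum>r<N. deriv (wcoef V p r) x * ?J r x
      + (?J (Suc r) x + (if odd r then V x * ?J (r - 1) x else 0)) * wcoef V p r x)"
    using DERIV_imp_deriv[OF d] by simp
  also have "\<dots> = (\<Sum>r<N. deriv (wcoef V p r) x * ?J r x) + (\<Sum>r<N. ?J (Suc r) x * wcoef V p r x)
      + (\<Sum>r<N. (if odd r then V x * ?J (r - 1) x else 0) * wcoef V p r x)"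
    by (simp add: sum.distrib distrib_right add.assoc del: jet_simps)
  also have "\<dots> = (\<Sum>r<N. wcoef V (Suc p) r x * ?J r x)"
    unfolding 1 2 by (simp add: sum.distrib[symmetric] distrib_right del: jet_simps)
  finally show ?case .
qed

lemma differentiable_prod:
  fixes f :: "'i \<Rightarrow> real \<Rightarrow> real"
  assumes "\<And>i. i \<in> A \<Longrightarrow> f i differentiable (at x within S)"
  shows "(\<lambda>y. \<Prod>i\<in>A. f i y) differentiable (at x within S)"
proof -
  obtain f' where "\<And>i. i \<in> A \<Longrightarrow> (f i has_derivative f' i) (at x within S)"
    using assms unfolding differentiable_def by metis
  from has_derivative_prod[of A f f' x S, OF this] show ?thesis
    unfolding differentiable_def by blast
qed

lemma det_mat_differentiable:
  fixes a :: "nat \<Rightarrow> nat \<Rightarrow> real \<Rightarrow> real"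
  assumes "\<And>i j. i < n \<Longrightarrow> j < n \<Longrightarrow> a i j differentiable (at x within S)"
  shows "(\<lambda>y. Determinant.det (Matrix.mat n n (\<lambda>(i, j). a i j y))) differentiable (at x within S)"
proof -
  have lt: "p i < n" if "p permutes {0..<n}" "i < n" for p i
    using permutes_in_image[OF that(1), of i] that(2) by simp
  have "Determinant.det (Matrix.mat n n (\<lambda>(i, j). a i j y))
      = (\<Sum>p\<in>{p. p permutes {0..<n}}. signof p * (\<Prod>i=0..<n. a i (p i) y))" for y
    by (subst det_def'[of _ n]) (auto intro!: sum.cong prod.cong simp: lt)
  moreover have "(\<lambda>y. \<Sum>p\<in>{p. p permutes {0..<n}}. signof p * (\<Prod>i=0..<n. a i (p i) y)) differentiable (at x within S)"
    by (intro differentiable_sum ballI differentiable_mult differentiable_const differentiable_prod assms)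
      (auto simp: lt finite_permutations)
  ultimately show ?thesis by simp
qed

text \<open>The inverse is the adjugate divided by the determinant, and both have entries that are
  polynomials in the entries of the matrix.\<close>

lemma differentiable_matrix_inverse:
  fixes a :: "nat \<Rightarrow> nat \<Rightarrow> real \<Rightarrow> real"
  assumes diff: "\<And>i j x. i < n \<Longrightarrow> j < n \<Longrightarrow> x \<in> S \<Longrightarrow> a i j differentiable (at x within S)"
    and det: "\<And>x. x \<in> S \<Longrightarrow> Determinant.det (Matrix.mat n n (\<lambda>(i, j). a i j x)) \<noteq> 0"
  obtains b where
    "\<And>i j x. i < n \<Longrightarrow> j < n \<Longrightarrow> x \<in> S \<Longrightarrow> b i j differentiable (at x within S)"
    "\<And>i j x. i < n \<Longrightarrow> j < n \<Longrightarrow> x \<in> S \<Longrightarrow> (\<Sum>q<n. a i q x * b q j x) = (if i = j then 1 else 0)"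
    "\<And>i j x. i < n \<Longrightarrow> j < n \<Longrightarrow> x \<in> S \<Longrightarrow> (\<Sum>q<n. b i q x * a q j x) = (if i = j then 1 else 0)"
proof -
  define M where "M x = Matrix.mat n n (\<lambda>(i, j). a i j x)" for x
  have M: "M x \<in> carrier_mat n n" for x by (simp add: M_def)
  define b where "b i j x = adj_mat (M x) $$ (i, j) / Determinant.det (M x)" for i j x
  note adj = adj_mat[OF M]
  show ?thesis
  proof (rule that[of b])
    fix i j x assume ij: "i < n" "j < n" and x: "x \<in> S"
    have entry: "(A * B) $$ (i, j) = (\<Sum>q<n. A $$ (i, q) * B $$ (q, j))"
      if "A \<in> carrier_mat n n" "B \<in> carrier_mat n n" for A B :: "real mat"
      using that ij by (auto simp: scalar_prod_def lessThan_atLeast0 intro!: sum.cong)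
    have one: "(Determinant.det (M x) \<cdot>\<^sub>m 1\<^sub>m n) $$ (i, j) = (if i = j then Determinant.det (M x) else 0)"
      using ij by simp
    have d: "Determinant.det (M x) \<noteq> 0"
      using det[OF x] by (simp add: M_def)
    have "(\<Sum>q<n. a i q x * b q j x) = (\<Sum>q<n. M x $$ (i, q) * adj_mat (M x) $$ (q, j)) / Determinant.det (M x)"
      unfolding sum_divide_distrib by (intro sum.cong) (use ij in \<open>auto simp: b_def M_def\<close>)
    also have "\<dots> = (if i = j then 1 else 0)"
      unfolding entry[OF M adj(1), symmetric] adj(2) one using d by simp
    finally show "(\<Sum>q<n. a i q x * b q j x) = (if i = j then 1 else 0)" .
    have "(\<Sum>q<n. b i q x * a q j x) = (\<Sum>q<n. adj_mat (M x) $$ (i, q) * M x $$ (q, j)) / Determinant.det (M x)"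
      unfolding sum_divide_distrib by (intro sum.cong) (use ij in \<open>auto simp: b_def M_def\<close>)
    also have "\<dots> = (if i = j then 1 else 0)"
      unfolding entry[OF adj(1) M, symmetric] adj(3) one using d by simp
    finally show "(\<Sum>q<n. b i q x * a q j x) = (if i = j then 1 else 0)" .
    \<comment> \<open>Entry (i, j) of the adjugate is a cofactor for row j and column i;
      \<open>a'\<close> renumbers the entries that remain after deleting these.\<close>
    define a' where "a' p q = a (if p < j then p else Suc p) (if q < i then q else Suc q)" for p q
    have cof: "adj_mat (M y) $$ (i, j)
        = (- 1) ^ (j + i) * Determinant.det (Matrix.mat (n - 1) (n - 1) (\<lambda>(p, q). a' p q y))" for y
    proof -
      have "mat_delete (M y) j i = Matrix.mat (n - 1) (n - 1) (\<lambda>(p, q). a' p q y)"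
        unfolding mat_delete_def M_def a'_def by (rule eq_matI) (use ij in auto)
      then show ?thesis
        using ij M[of y] by (simp add: adj_mat_def cofactor_def)
    qed
    have "b i j = (\<lambda>y. (- 1) ^ (j + i) * Determinant.det (Matrix.mat (n - 1) (n - 1) (\<lambda>(p, q). a' p q y))
        / Determinant.det (M y))"
      by (auto simp: b_def cof)
    moreover have "(\<lambda>y. (- 1) ^ (j + i) * Determinant.det (Matrix.mat (n - 1) (n - 1) (\<lambda>(p, q). a' p q y))
        / Determinant.det (M y)) differentiable (at x within S)"
    proof (intro differentiable_divide differentiable_mult differentiable_const)
      show "(\<lambda>y. Determinant.det (Matrix.mat (n - 1) (n - 1) (\<lambda>(p, q). a' p q y))) differentiable (at x within S)"
      proof (rule det_mat_differentiable)
        fix p q assume "p < n - 1" "q < n - 1"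
        then show "a' p q differentiable (at x within S)"
          unfolding a'_def by (intro diff x) auto
      qed
      show "(\<lambda>y. Determinant.det (M y)) differentiable (at x within S)"
        unfolding M_def by (intro det_mat_differentiable diff x)
    qed (rule d)
    ultimately show "b i j differentiable (at x within S)"
      by simp
  qed
qed

text \<open>The Wronskian matrix is the matrix of coefficients \<open>wcoef\<close> times the jet
  matrix. A nonzero product of determinants already makes the second factor nonzero, whatever the
  value of the first.\<close>

lemma wronskian_nonzero_darboux_ode:
  assumes V: "V \<in> trig_alg" and "1 \<le> k" "0 < c"
    and dU: "\<And>q x. q < k \<Longrightarrow> (U q has_real_derivative W q x) (at x)"
    and dW: "\<And>q x. q < k \<Longrightarrow> (W q has_real_derivative (V x - lam q) * U q x) (at x)"
    and nz: "\<And>x. wronskian (map U [0..<k]) x \<noteq> 0"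
  obtains B where "darboux_ode k lam U W B V {0..c}"
proof -
  let ?E = "\<lambda>p q x. jet p (lam q) (U q x) (W q x)"
  have dE: "\<exists>D. (?E p q has_real_derivative D) (at x within S)" if "q < k" for p q x S
    using jet_deriv[where V = V, OF has_field_derivative_at_within[OF dU[OF that]]
        has_field_derivative_at_within[OF dW[OF that]]]
    by blast
  have det: "Determinant.det (Matrix.mat k k (\<lambda>(p, q). ?E p q x)) \<noteq> 0" for x
  proof -
    have "Matrix.mat k k (\<lambda>(p, q). (deriv ^^ p) (map U [0..<k] ! q) x)
        = Matrix.mat k k (\<lambda>(p, r). wcoef V p r x) * Matrix.mat k k (\<lambda>(r, q). ?E r q x)"
    proof (rule eq_matI)
      fix p q assume "p < dim_row (Matrix.mat k k (\<lambda>(p, r). wcoef V p r x) * Matrix.mat k k (\<lambda>(r, q). ?E r q x))"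
        "q < dim_col (Matrix.mat k k (\<lambda>(p, r). wcoef V p r x) * Matrix.mat k k (\<lambda>(r, q). ?E r q x))"
      then have pq: "p < k" "q < k" by auto
      then show "Matrix.mat k k (\<lambda>(p, q). (deriv ^^ p) (map U [0..<k] ! q) x) $$ (p, q)
          = (Matrix.mat k k (\<lambda>(p, r). wcoef V p r x) * Matrix.mat k k (\<lambda>(r, q). ?E r q x)) $$ (p, q)"
        using iterated_deriv_jet[OF V dU[OF pq(2)] dW[OF pq(2)] pq(1), of x]
        by (simp add: scalar_prod_def lessThan_atLeast0)
    qed auto
    then have "wronskian (map U [0..<k]) x = Determinant.det (Matrix.mat k k (\<lambda>(p, r). wcoef V p r x))
        * Determinant.det (Matrix.mat k k (\<lambda>(r, q). ?E r q x))"
      unfolding wronskian_def by (simp add: det_mult[of _ k])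
    with nz[of x] show ?thesis by auto
  qed
  obtain B where B: "\<And>q p x. q < k \<Longrightarrow> p < k \<Longrightarrow> x \<in> {0..c} \<Longrightarrow> B q p differentiable (at x within {0..c})"
    "\<And>p r x. p < k \<Longrightarrow> r < k \<Longrightarrow> x \<in> {0..c} \<Longrightarrow> (\<Sum>q<k. ?E p q x * B q r x) = (if p = r then 1 else 0)"
    "\<And>q j x. q < k \<Longrightarrow> j < k \<Longrightarrow> x \<in> {0..c} \<Longrightarrow> (\<Sum>p<k. B q p x * ?E p j x) = (if q = j then 1 else 0)"
    by (rule differentiable_matrix_inverse[of k "{0..c}" ?E])
      (use dE det in \<open>auto simp: real_differentiable_def\<close>)
  have "continuous_on {0..c} V"
    using trig_alg_deriv(2)[OF V] by (meson DERIV_continuous_on has_field_derivative_at_within)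
  moreover have "at x within {0..c} \<noteq> bot" if "x \<in> {0..c}" for x
    using that \<open>0 < c\<close> by (auto simp: trivial_limit_within islimpt_Icc)
  ultimately have "darboux_ode k lam U W B V {0..c}"
    unfolding darboux_ode_def darboux_def
    using B \<open>1 \<le> k\<close> dU dW by (auto intro: has_field_derivative_at_within simp: real_differentiable_def)
  then show ?thesis by (rule that)
qed

section \<open>Trigonometric polynomials and rotation numbers\<close>

text \<open>Trigonometric polynomials with frequencies n, n - 2, ..., - n, written as a polynomial
  in exp(2 i x) after multiplication by exp(i n x). In this form zeros on [0, pi) become roots on
  the unit circle.\<close>

definition cis_poly :: "nat \<Rightarrow> (real \<Rightarrow> real) \<Rightarrow> bool" where
  "cis_poly n f \<longleftrightarrow> (\<exists>P :: complex poly. degree P \<le> n \<and>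
     (\<forall>x. complex_of_real (f x) * cis (real n * x) = poly P (cis (2 * x))))"

lemma cis_poly_add: "cis_poly n f \<Longrightarrow> cis_poly n g \<Longrightarrow> cis_poly n (\<lambda>x. f x + g x)"
  unfolding cis_poly_def
proof (elim exE conjE)
  fix P Q :: "complex poly"
  assume "degree P \<le> n" "degree Q \<le> n"
    "\<forall>x. complex_of_real (f x) * cis (real n * x) = poly P (cis (2 * x))"
    "\<forall>x. complex_of_real (g x) * cis (real n * x) = poly Q (cis (2 * x))"
  then show "\<exists>P. degree P \<le> n \<and> (\<forall>x. complex_of_real (f x + g x) * cis (real n * x) = poly P (cis (2 * x)))"
    by (intro exI[of _ "P + Q"]) (auto simp: degree_add_le distrib_right)
qed

lemma cis_poly_scale: "cis_poly n f \<Longrightarrow> cis_poly n (\<lambda>x. c * f x)"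
  unfolding cis_poly_def
proof (elim exE conjE)
  fix P :: "complex poly"
  assume "degree P \<le> n" "\<forall>x. complex_of_real (f x) * cis (real n * x) = poly P (cis (2 * x))"
  then show "\<exists>P. degree P \<le> n \<and> (\<forall>x. complex_of_real (c * f x) * cis (real n * x) = poly P (cis (2 * x)))"
    by (intro exI[of _ "Polynomial.smult (of_real c) P"]) (auto simp: mult.assoc intro: order.trans[OF degree_smult_le])
qed

lemma cis_poly_sum: "(\<And>i. i \<in> A \<Longrightarrow> cis_poly n (f i)) \<Longrightarrow> cis_poly n (\<lambda>x. \<Sum>i\<in>A. f i x)"
proof (induction A rule: infinite_finite_induct)
  case (insert i A)
  then show ?case by (simp add: cis_poly_add)
qed (auto simp: cis_poly_def intro!: exI[of _ 0])

lemma cis_poly_cos_sin: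
  assumes "n = d + 2 * h"
  shows "cis_poly n (\<lambda>x. cos (real d * x))" "cis_poly n (\<lambda>x. sin (real d * x))"
proof -
  have z: "cis (2 * x) ^ (d + h) = cis (real d * x) * cis (real n * x)"
      "cis (2 * x) ^ h = cis (- (real d * x)) * cis (real n * x)" for x
  proof -
    have "real (d + h) * (2 * x) = real d * x + real n * x" "real h * (2 * x) = - (real d * x) + real n * x"
      by (simp_all add: assms algebra_simps)
    then show "cis (2 * x) ^ (d + h) = cis (real d * x) * cis (real n * x)"
      "cis (2 * x) ^ h = cis (- (real d * x)) * cis (real n * x)"
      by (simp_all only: Complex.DeMoivre cis_mult)
  qed
  have c: "complex_of_real (cos y) = (cis y + cis (- y)) / 2"
      "complex_of_real (sin y) = (cis y - cis (- y)) / (2 * \<i>)" for y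
    by (simp_all add: complex_eq_iff divide_simps)
  show "cis_poly n (\<lambda>x. cos (real d * x))"
    unfolding cis_poly_def
  proof (intro exI[of _ "Polynomial.smult (1 / 2) (Polynomial.monom 1 (d + h) + Polynomial.monom 1 h)"] conjI allI)
    show "degree (Polynomial.smult (1 / 2) (Polynomial.monom 1 (d + h) + Polynomial.monom 1 h) :: complex poly) \<le> n"
      using assms by (intro order.trans[OF degree_smult_le] degree_add_le order.trans[OF degree_monom_le]) auto
    show "complex_of_real (cos (real d * x)) * cis (real n * x)
        = poly (Polynomial.smult (1 / 2) (Polynomial.monom 1 (d + h) + Polynomial.monom 1 h)) (cis (2 * x))" for x
      unfolding c poly_smult poly_add poly_monom z by (simp add: field_simps)
  qed
  show "cis_poly n (\<lambda>x. sin (real d * x))"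
    unfolding cis_poly_def
  proof (intro exI[of _ "Polynomial.smult (1 / (2 * \<i>)) (Polynomial.monom 1 (d + h) - Polynomial.monom 1 h)"] conjI allI)
    show "degree (Polynomial.smult (1 / (2 * \<i>)) (Polynomial.monom 1 (d + h) - Polynomial.monom 1 h) :: complex poly) \<le> n"
      using assms by (intro order.trans[OF degree_smult_le] degree_diff_le order.trans[OF degree_monom_le]) auto
    show "complex_of_real (sin (real d * x)) * cis (real n * x)
        = poly (Polynomial.smult (1 / (2 * \<i>)) (Polynomial.monom 1 (d + h) - Polynomial.monom 1 h)) (cis (2 * x))" for x
      unfolding c poly_smult poly_diff poly_monom z by (simp add: field_simps)
  qed
qed

text \<open>On the half-open interval \<open>cis (2 * x)\<close> is injective, so distinct zeros
  give distinct roots of a nonzero polynomial of degree at most \<open>n\<close>.\<close>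

lemma cis_poly_zeros:
  assumes "cis_poly n f" "f \<noteq> (\<lambda>x. 0)"
  shows "finite {x \<in> {0..<pi}. f x = 0} \<and> card {x \<in> {0..<pi}. f x = 0} \<le> n"
proof -
  obtain P :: "complex poly" where P: "degree P \<le> n"
      "\<And>x. complex_of_real (f x) * cis (real n * x) = poly P (cis (2 * x))"
    using assms unfolding cis_poly_def by blast
  obtain x where "f x \<noteq> 0" using assms by auto
  with P(2)[of x] have "P \<noteq> 0" by auto
  let ?Z = "{x \<in> {0..<pi}. f x = 0}" and ?R = "{z. poly P z = 0}"
  have inj: "inj_on (\<lambda>x. cis (2 * x)) {0..<pi}"
  proof (rule inj_onI)
    fix x y assume xy: "x \<in> {0..<pi}" "y \<in> {0..<pi}" "cis (2 * x) = cis (2 * y)"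
    then have "sin (2 * x) = sin (2 * y)" "cos (2 * x) = cos (2 * y)"
      by (simp_all add: complex_eq_iff)
    then obtain k :: int where k: "2 * x = 2 * y + 2 * pi * of_int k"
      using sin_cos_eq_iff[of "2 * x" "2 * y"] by auto
    then have "x - y = pi * of_int k" by simp
    moreover have "\<bar>x - y\<bar> < pi" using xy by auto
    ultimately have "pi * \<bar>of_int k :: real\<bar> < pi * 1" by (simp add: abs_mult)
    then have "\<bar>of_int k :: real\<bar> < 1"
      using pi_gt_zero by (simp only: mult_less_cancel_left_pos)
    then have "k = 0" by linarith
    with k show "x = y" by simp
  qed
  have sub: "(\<lambda>x. cis (2 * x)) ` ?Z \<subseteq> ?R"
    using P(2) by (auto simp flip: P(2))
  have fin: "finite ?R" and cR: "card ?R \<le> degree P"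
    using \<open>P \<noteq> 0\<close> by (auto simp: poly_roots_finite card_poly_roots_bound)
  have injZ: "inj_on (\<lambda>x. cis (2 * x)) ?Z"
    by (rule inj_on_subset[OF inj]) auto
  have "finite ?Z"
    using finite_subset[OF sub fin] injZ by (rule finite_imageD)
  moreover have "card ?Z \<le> card ?R"
    using card_inj_on_le[OF injZ sub fin] .
  ultimately show ?thesis
    using cR P(1) by linarith
qed

lemma trig_space_cis_poly:
  assumes "1 \<le> s" "\<phi> \<in> trig_space s"
  shows "cis_poly (s - 1) \<phi>"
proof (cases "odd s")
  case True
  then have s: "s - 1 = 2 * (s div 2)" by (auto elim: oddE)
  obtain c a b where \<phi>: "\<phi> = (\<lambda>x. c + (\<Sum>j = 1..s div 2. a j * cos (2 * real j * x) + b j * sin (2 * real j * x)))"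
    using assms True unfolding trig_space_def by auto
  have 0: "cis_poly (s - 1) (\<lambda>x. c * cos (real 0 * x))"
    by (rule cis_poly_scale[OF cis_poly_cos_sin(1)[where h = "s div 2"]]) (use s in simp)
  have "cis_poly (s - 1) (\<lambda>x. a j * cos (2 * real j * x) + b j * sin (2 * real j * x))"
    if "j \<in> {1..s div 2}" for j
  proof -
    have "s - 1 = 2 * j + 2 * (s div 2 - j)" using s that by auto
    from cis_poly_cos_sin[OF this] show ?thesis
      by (intro cis_poly_add cis_poly_scale) simp_all
  qed
  from cis_poly_add[OF 0 cis_poly_sum[of "{1..s div 2}" "s - 1", OF this]] show ?thesis
    unfolding \<phi> by simp
next
  case False
  then have s: "s = 2 * (s div 2)" by auto
  obtain a b where \<phi>: "\<phi> = (\<lambda>x. \<Sum>j = 1..s div 2. a j * cos ((2 * real j - 1) * x) + b j * sin ((2 * real j - 1) * x))"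
    using assms False unfolding trig_space_def by auto
  have "cis_poly (s - 1) (\<lambda>x. a j * cos ((2 * real j - 1) * x) + b j * sin ((2 * real j - 1) * x))"
    if j: "j \<in> {1..s div 2}" for j
  proof -
    have "s - 1 = (2 * j - 1) + 2 * (s div 2 - j)" using s j by auto
    moreover have "real (2 * j - 1) = 2 * real j - 1" using j by (simp add: of_nat_diff)
    ultimately show ?thesis
      using cis_poly_cos_sin[of "s - 1" "2 * j - 1" "s div 2 - j"] by (intro cis_poly_add cis_poly_scale) simp_all
  qed
  from cis_poly_sum[of "{1..s div 2}" "s - 1", OF this] show ?thesis
    unfolding \<phi> .
qed

text \<open>With \<open>e\<close> equal to 1 or -1 this is the even or the odd part.\<close>

lemma trig_space_part:
  assumes "\<phi> \<in> trig_space s"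
  shows "(\<lambda>x. (\<phi> x + e * \<phi> (- x)) / 2) \<in> trig_space s"
proof (cases "odd s")
  case True
  obtain c a b where \<phi>: "\<phi> = (\<lambda>x. c + (\<Sum>j = 1..s div 2. a j * cos (2 * real j * x) + b j * sin (2 * real j * x)))"
    using assms True unfolding trig_space_def by auto
  have "(\<lambda>x. (\<phi> x + e * \<phi> (- x)) / 2) = (\<lambda>x. (c + e * c) / 2 + (\<Sum>j = 1..s div 2.
      ((1 + e) / 2 * a j) * cos (2 * real j * x) + ((1 - e) / 2 * b j) * sin (2 * real j * x)))"
  proof
    fix x
    have "(\<phi> x + e * \<phi> (- x)) / 2 = (c + e * c) / 2 +
        (\<Sum>j = 1..s div 2. (a j * cos (2 * real j * x) + b j * sin (2 * real j * x)
          + e * (a j * cos (2 * real j * x) - b j * sin (2 * real j * x))) / 2)"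
      unfolding \<phi> sum_divide_distrib[symmetric] sum_distrib_left[symmetric] sum.distrib minus_mult_right[symmetric]
        cos_minus sin_minus sum_subtractf sum_negf
      by (simp add: field_simps)
    also have "(\<Sum>j = 1..s div 2. (a j * cos (2 * real j * x) + b j * sin (2 * real j * x)
          + e * (a j * cos (2 * real j * x) - b j * sin (2 * real j * x))) / 2)
        = (\<Sum>j = 1..s div 2. ((1 + e) / 2 * a j) * cos (2 * real j * x) + ((1 - e) / 2 * b j) * sin (2 * real j * x))"
      by (intro sum.cong) (auto simp: field_simps)
    finally show "(\<phi> x + e * \<phi> (- x)) / 2 = (c + e * c) / 2 + (\<Sum>j = 1..s div 2.
      ((1 + e) / 2 * a j) * cos (2 * real j * x) + ((1 - e) / 2 * b j) * sin (2 * real j * x))" .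
  qed
  then show ?thesis
    using True unfolding trig_space_def
    by (simp only: if_True not_False_eq_True mem_Collect_eq) (intro exI, rule refl)
next
  case False
  obtain a b where \<phi>: "\<phi> = (\<lambda>x. \<Sum>j = 1..s div 2. a j * cos ((2 * real j - 1) * x) + b j * sin ((2 * real j - 1) * x))"
    using assms False unfolding trig_space_def by auto
  have "(\<lambda>x. (\<phi> x + e * \<phi> (- x)) / 2) = (\<lambda>x. \<Sum>j = 1..s div 2.
      ((1 + e) / 2 * a j) * cos ((2 * real j - 1) * x) + ((1 - e) / 2 * b j) * sin ((2 * real j - 1) * x))"
  proof
    fix x
    have "(\<phi> x + e * \<phi> (- x)) / 2 =
        (\<Sum>j = 1..s div 2. (a j * cos ((2 * real j - 1) * x) + b j * sin ((2 * real j - 1) * x)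
          + e * (a j * cos ((2 * real j - 1) * x) - b j * sin ((2 * real j - 1) * x))) / 2)"
      unfolding \<phi> sum_divide_distrib[symmetric] sum_distrib_left sum.distrib[symmetric] minus_mult_right[symmetric]
        cos_minus sin_minus
      by simp
    also have "\<dots> = (\<Sum>j = 1..s div 2. ((1 + e) / 2 * a j) * cos ((2 * real j - 1) * x) + ((1 - e) / 2 * b j) * sin ((2 * real j - 1) * x))"
      by (intro sum.cong) (auto simp: field_simps)
    finally show "(\<phi> x + e * \<phi> (- x)) / 2 = (\<Sum>j = 1..s div 2.
      ((1 + e) / 2 * a j) * cos ((2 * real j - 1) * x) + ((1 - e) / 2 * b j) * sin ((2 * real j - 1) * x))" .
  qed
  then show ?thesis
    using False unfolding trig_space_def
    by (simp only: if_False mem_Collect_eq) (intro exI, rule refl)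
qed

lemma trig_space_shift:
  assumes "1 \<le> s" "\<phi> \<in> trig_space s"
  shows "\<phi> (x + pi) = (- 1) ^ (s - 1) * \<phi> x"
proof (cases "odd s")
  case True
  obtain c a b where \<phi>: "\<phi> = (\<lambda>x. c + (\<Sum>j = 1..s div 2. a j * cos (2 * real j * x) + b j * sin (2 * real j * x)))"
    using assms True unfolding trig_space_def by auto
  have "cos (2 * real j * (x + pi)) = cos (2 * real j * x)" "sin (2 * real j * (x + pi)) = sin (2 * real j * x)" for j
  proof -
    have *: "2 * real j * (x + pi) = 2 * real j * x + 2 * pi * of_int (int j)"
      by (simp add: algebra_simps)
    show "cos (2 * real j * (x + pi)) = cos (2 * real j * x)" "sin (2 * real j * (x + pi)) = sin (2 * real j * x)"
      unfolding * sin_add cos_add sin_int_2pin cos_int_2pin by simp_all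
  qed
  then show ?thesis
    using True by (simp add: \<phi>)
next
  case False
  obtain a b where \<phi>: "\<phi> = (\<lambda>x. \<Sum>j = 1..s div 2. a j * cos ((2 * real j - 1) * x) + b j * sin ((2 * real j - 1) * x))"
    using assms False unfolding trig_space_def by auto
  have "cos ((2 * real j - 1) * (x + pi)) = - cos ((2 * real j - 1) * x)"
    "sin ((2 * real j - 1) * (x + pi)) = - sin ((2 * real j - 1) * x)" for j
  proof -
    have *: "(2 * real j - 1) * (x + pi) = ((2 * real j - 1) * x - pi) + 2 * pi * of_int (int j)"
      by (simp add: algebra_simps)
    show "cos ((2 * real j - 1) * (x + pi)) = - cos ((2 * real j - 1) * x)"
      "sin ((2 * real j - 1) * (x + pi)) = - sin ((2 * real j - 1) * x)"
      unfolding * sin_add cos_add sin_int_2pin cos_int_2pin by (simp_all add: sin_diff cos_diff)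
  qed
  moreover have "odd (s - 1)" using False assms(1) by simp
  ultimately show ?thesis
    by (simp add: \<phi> sum_negf[symmetric])
qed

text \<open>\<open>prufer_rotation V l t r\<close>: the angle of the solution of \<open>y'' = (V - l) y\<close> with boundary
  condition \<open>t\<close> at 0 turns by \<open>- \<pi> r\<close> over \<open>[0, \<pi>]\<close>.\<close>

definition start_angle :: "bool \<Rightarrow> real" where
  "start_angle t = (if t then 0 else - (pi / 2))"

definition prufer_rotation :: "(real \<Rightarrow> real) \<Rightarrow> real \<Rightarrow> bool \<Rightarrow> real \<Rightarrow> bool" where
  "prufer_rotation V l t r \<longleftrightarrow>
     (\<exists>\<theta>. prufer (\<lambda>_. 0) V l pi \<theta> \<and> \<theta> 0 = start_angle t \<and> \<theta> pi = start_angle t - pi * r)"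

section \<open>Comparison of rotation numbers\<close>

lemma prufer_rotation_less:
  assumes "continuous_on {0..pi} V" "prufer_rotation V l\<^sub>1 t r\<^sub>1" "prufer_rotation V l\<^sub>2 t r\<^sub>2" "l\<^sub>1 < l\<^sub>2"
  shows "r\<^sub>1 < r\<^sub>2"
proof -
  obtain \<theta>\<^sub>1 \<theta>\<^sub>2 where
    1: "prufer (\<lambda>_. 0) V l\<^sub>1 pi \<theta>\<^sub>1" "\<theta>\<^sub>1 0 = start_angle t" "\<theta>\<^sub>1 pi = start_angle t - pi * r\<^sub>1" and
    2: "prufer (\<lambda>_. 0) V l\<^sub>2 pi \<theta>\<^sub>2" "\<theta>\<^sub>2 0 = start_angle t" "\<theta>\<^sub>2 pi = start_angle t - pi * r\<^sub>2"
    using assms unfolding prufer_rotation_def by blast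
  have "\<theta>\<^sub>2 pi < \<theta>\<^sub>1 pi"
    using prufer_comparison[OF continuous_on_const assms(1) pi_gt_zero 1(1) 2(1) assms(4)] 1(2) 2(2) by simp
  with 1(3) 2(3) have "pi * r\<^sub>1 < pi * r\<^sub>2" by linarith
  then show ?thesis
    using pi_gt_zero by (simp only: mult_less_cancel_left_pos)
qed

text \<open>Solutions of different types start at angles that differ by pi / 2 modulo pi. Moving
  them into the order needed for comparison costs at most half a unit of rotation.\<close>

lemma prufer_rotation_less_half:
  assumes V: "continuous_on {0..pi} V" "prufer_rotation V l\<^sub>1 t\<^sub>1 r\<^sub>1" "prufer_rotation V l\<^sub>2 t\<^sub>2 r\<^sub>2" "l\<^sub>1 < l\<^sub>2"
  shows "r\<^sub>1 - 1 / 2 < r\<^sub>2"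
proof -
  obtain \<theta>\<^sub>1 \<theta>\<^sub>2 where
    1: "prufer (\<lambda>_. 0) V l\<^sub>1 pi \<theta>\<^sub>1" "\<theta>\<^sub>1 0 = start_angle t\<^sub>1" "\<theta>\<^sub>1 pi = start_angle t\<^sub>1 - pi * r\<^sub>1" and
    2: "prufer (\<lambda>_. 0) V l\<^sub>2 pi \<theta>\<^sub>2" "\<theta>\<^sub>2 0 = start_angle t\<^sub>2" "\<theta>\<^sub>2 pi = start_angle t\<^sub>2 - pi * r\<^sub>2"
    using assms unfolding prufer_rotation_def by blast
  \<comment> \<open>A shift by - pi is needed only if the first solution starts at - pi / 2 and the
    second at 0.\<close>
  define n :: int where "n = (if \<not> t\<^sub>1 \<and> t\<^sub>2 then - 1 else 0)"
  have "\<theta>\<^sub>2 0 + pi * of_int n \<le> \<theta>\<^sub>1 0"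
    using 1(2) 2(2) pi_gt_zero by (simp add: n_def start_angle_def split: if_splits)
  from prufer_comparison[OF continuous_on_const V(1) pi_gt_zero 1(1) prufer_shift[OF 2(1)] V(4) this]
  have "\<theta>\<^sub>2 pi + pi * of_int n < \<theta>\<^sub>1 pi" .
  moreover have "start_angle t\<^sub>1 - pi / 2 \<le> start_angle t\<^sub>2 + pi * of_int n"
    by (simp add: n_def start_angle_def)
  moreover have "pi * (r\<^sub>1 - 1 / 2) = pi * r\<^sub>1 - pi / 2"
    by (simp add: algebra_simps)
  ultimately have "pi * (r\<^sub>1 - 1 / 2) < pi * r\<^sub>2"
    using 1(3) 2(3) by linarith
  then show ?thesis
    using pi_gt_zero by (simp only: mult_less_cancel_left_pos)
qed

lemma prufer_rotation_lower:
  assumes "continuous_on {0..pi} V" "prufer_rotation V l t r"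
  shows "(if t then - 1 / 2 else 0) < r"
proof -
  obtain \<theta> where 1: "prufer (\<lambda>_. 0) V l pi \<theta>" "\<theta> 0 = start_angle t" "\<theta> pi = start_angle t - pi * r"
    using assms unfolding prufer_rotation_def by blast
  \<comment> \<open>The lowest angle with vanishing cosine that is not below the start angle; for
    the type \<open>False\<close> it is the start angle itself.\<close>
  define k where "k = (if t then pi / 2 else - (pi / 2))"
  have "\<theta> 0 \<le> k" "cos k = 0"
    using 1(2) pi_gt_zero by (auto simp: k_def start_angle_def)
  from prufer_barrier[OF continuous_on_const assms(1) pi_gt_zero 1(1) this]
  have "pi * (if t then - 1 / 2 else 0) < pi * r"
    using 1(3) unfolding k_def start_angle_def by (cases t; simp only: if_True if_False; linarith)
  then show ?thesis
    using pi_gt_zero by (simp only: mult_less_cancel_left_pos)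
qed

text \<open>The lifted angle is shifted by a multiple of pi to the prescribed start. An odd multiple
  reverses the sign of the radius, so \<open>\<rho>\<close> may be negative; the constant
  \<open>e\<close> records that its sign does not change.\<close>

lemma prufer_angle_exists:
  fixes u v :: "real \<Rightarrow> real"
  assumes V: "continuous_on {0..c} V" and "0 \<le> c"
    and du: "\<And>x. x \<in> {0..c} \<Longrightarrow> (u has_real_derivative v x) (at x within {0..c})"
    and dv: "\<And>x. x \<in> {0..c} \<Longrightarrow> (v has_real_derivative (V x - l) * u x) (at x within {0..c})"
    and nz: "u 0 \<noteq> 0 \<or> v 0 \<noteq> 0" and bc: "bc t (u 0) (v 0)"
  obtains \<theta> \<rho> e where "prufer (\<lambda>_. 0) V l c \<theta>" "\<theta> 0 = start_angle t"
    "\<And>x. x \<in> {0..c} \<Longrightarrow> u x = \<rho> x * cos (\<theta> x)" "\<And>x. x \<in> {0..c} \<Longrightarrow> v x = \<rho> x * sin (\<theta> x)"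
    "\<And>x. x \<in> {0..c} \<Longrightarrow> e * \<rho> x > 0"
proof -
  have c0: "0 \<in> {0..c}" using \<open>0 \<le> c\<close> by simp
  have nzx: "u x \<noteq> 0 \<or> v x \<noteq> 0" if "x \<in> {0..c}" for x
    using linear_ode_zero[OF V du dv that _ _ c0] nz by blast
  obtain \<rho> \<theta> where \<theta>: "continuous_on {0..c} \<theta>" "\<And>x. x \<in> {0..c} \<Longrightarrow> \<rho> x > 0"
      "\<And>x. x \<in> {0..c} \<Longrightarrow> u x = \<rho> x * cos (\<theta> x)" "\<And>x. x \<in> {0..c} \<Longrightarrow> v x = \<rho> x * sin (\<theta> x)"
    by (rule polar_lift[OF convex_real_interval(5) DERIV_continuous_on[OF du] DERIV_continuous_on[OF dv] nzx])
      (assumption, assumption, assumption, rule that, assumption+)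
  have p: "prufer (\<lambda>_. 0) V l c \<theta>"
    by (rule polar_angle_prufer[where u = u and v = v and \<rho> = \<rho>]) (use \<theta> du dv in auto)
  have "\<exists>n::int. \<theta> 0 + pi * of_int n = start_angle t"
  proof (cases t)
    case True
    then have "sin (\<theta> 0) = 0"
      using bc \<theta>(2,4)[OF c0] by (simp add: bc_def)
    then obtain i :: int where "\<theta> 0 = of_int i * pi"
      by (auto simp: sin_zero_iff_int2)
    with True show ?thesis
      by (intro exI[of _ "- i"]) (simp add: start_angle_def)
  next
    case False
    then have "cos (\<theta> 0) = 0"
      using bc \<theta>(2,3)[OF c0] by (simp add: bc_def)
    then obtain i :: int where "\<theta> 0 = of_int i * pi + pi / 2"
      by (auto simp: cos_zero_iff_int2)
    with False show ?thesis
      by (intro exI[of _ "- i - 1"]) (simp add: start_angle_def algebra_simps)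
  qed
  then obtain n :: int where n: "\<theta> 0 + pi * of_int n = start_angle t" by blast
  define e where "e = cos (pi * of_int n)"
  have s0: "sin (pi * of_int n) = 0"
    by (metis mult.commute sin_zero_iff_int2)
  then have ee: "e * e = 1"
    using sin_cos_squared_add[of "pi * of_int n"] by (simp add: e_def power2_eq_square)
  show ?thesis
  proof (rule that[of "\<lambda>x. \<theta> x + pi * of_int n" "\<lambda>x. e * \<rho> x" e])
    show "prufer (\<lambda>_. 0) V l c (\<lambda>x. \<theta> x + pi * of_int n)"
      by (rule prufer_shift[OF p])
    show "\<theta> 0 + pi * of_int n = start_angle t" by (rule n)
    fix x assume x: "x \<in> {0..c}"
    have "e * \<rho> x * cos (\<theta> x + pi * of_int n) = (e * e) * (\<rho> x * cos (\<theta> x))"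
      "e * \<rho> x * sin (\<theta> x + pi * of_int n) = (e * e) * (\<rho> x * sin (\<theta> x))"
      unfolding cos_add sin_add s0 e_def[symmetric] by (simp_all only: mult_zero_left mult_zero_right diff_zero add_0_right mult_ac)
    then show "u x = e * \<rho> x * cos (\<theta> x + pi * of_int n)" "v x = e * \<rho> x * sin (\<theta> x + pi * of_int n)"
      using \<theta>(3,4)[OF x] ee by (simp_all only: mult_1)
    have "e * (e * \<rho> x) = \<rho> x" using ee by (metis mult.assoc mult_1)
    then show "e * (e * \<rho> x) > 0" using \<theta>(2)[OF x] by (simp only:)
  qed
qed

section \<open>The Whittaker--Hill operator\<close>

text \<open>The V in L = - D^2 + V, with the signs put into the coefficients so that the expression
  matches the closure rules of \<open>trig_alg\<close>.\<close>

definition hill_potential :: "real \<Rightarrow> nat \<Rightarrow> real \<Rightarrow> real" where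
  "hill_potential \<alpha> s = (\<lambda>x. - (4 * \<alpha> * real s) * cos (2 * x) + - (2 * \<alpha>\<^sup>2) * cos (4 * x))"

lemma hill_potential_trig_alg: "hill_potential \<alpha> s \<in> trig_alg"
  unfolding hill_potential_def
  by (intro trig_alg.add trig_alg.mult trig_alg.const trig_alg.cos)

lemma hill_potential_even: "hill_potential \<alpha> s (- x) = hill_potential \<alpha> s x"
  by (simp add: hill_potential_def)

lemma hill_potential_continuous: "continuous_on A (hill_potential \<alpha> s)"
  unfolding hill_potential_def by (intro continuous_intros)

lemma trig_space_trig_alg: "\<phi> \<in> trig_space s \<Longrightarrow> \<phi> \<in> trig_alg"
proof (cases "odd s")
  case True
  moreover assume "\<phi> \<in> trig_space s"
  ultimately obtain c a b where \<phi>: "\<phi> = (\<lambda>x. c + (\<Sum>j = 1..s div 2. a j * cos (2 * real j * x) + b j * sin (2 * real j * x)))"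
    unfolding trig_space_def by auto
  show ?thesis
    unfolding \<phi> by (intro trig_alg.add trig_alg.mult trig_alg.const trig_alg.cos trig_alg.sin trig_alg_sum)
next
  case False
  moreover assume "\<phi> \<in> trig_space s"
  ultimately obtain a b where \<phi>: "\<phi> = (\<lambda>x. \<Sum>j = 1..s div 2. a j * cos ((2 * real j - 1) * x) + b j * sin ((2 * real j - 1) * x))"
    unfolding trig_space_def by auto
  show ?thesis
    unfolding \<phi> by (intro trig_alg.add trig_alg.mult trig_alg.const trig_alg.cos trig_alg.sin trig_alg_sum)
qed

definition gauge :: "real \<Rightarrow> (real \<Rightarrow> real) \<Rightarrow> real \<Rightarrow> real" where
  "gauge \<alpha> \<phi> x = \<phi> x * exp (\<alpha> * cos (2 * x))"

definition gauge_deriv :: "real \<Rightarrow> (real \<Rightarrow> real) \<Rightarrow> real \<Rightarrow> real" where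
  "gauge_deriv \<alpha> \<phi> x = (deriv \<phi> x - 2 * \<alpha> * sin (2 * x) * \<phi> x) * exp (\<alpha> * cos (2 * x))"

lemma eigenfunction_solves:
  assumes "is_eigenfunction \<alpha> s \<mu> \<phi>"
  shows "(gauge \<alpha> \<phi> has_real_derivative gauge_deriv \<alpha> \<phi> x) (at x)"
    and "(gauge_deriv \<alpha> \<phi> has_real_derivative (hill_potential \<alpha> s x - (\<mu> - 2 * \<alpha>\<^sup>2)) * gauge \<alpha> \<phi> x) (at x)"
proof -
  have alg: "\<phi> \<in> trig_alg" and eig: "gauged_op \<alpha> s \<phi> = (\<lambda>x. \<mu> * \<phi> x)"
    using assms trig_space_trig_alg by (auto simp: is_eigenfunction_def)
  note d1 = trig_alg_deriv(2)[OF alg] and d2 = trig_alg_deriv(2)[OF trig_alg_deriv(1)[OF alg]]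
  have \<phi>'': "deriv (deriv \<phi>) x = 4 * \<alpha> * sin (2 * x) * deriv \<phi> x - 4 * (real s - 1) * \<alpha> * cos (2 * x) * \<phi> x - \<mu> * \<phi> x"
    using fun_cong[OF eig, of x] by (simp add: gauged_op_def numeral_2_eq_2)
  \<comment> \<open>Conjugation produces 4 \<alpha>^2 sin^2(2x) = 2 \<alpha>^2 - 2 \<alpha>^2
    cos(4x): the second term belongs to the potential, the first is the shift of the
    eigenvalue.\<close>
  have c4: "cos (4 * x) = 1 - 2 * (sin (2 * x))\<^sup>2"
    using cos_double_sin[of "2 * x"] by simp
  show "(gauge \<alpha> \<phi> has_real_derivative gauge_deriv \<alpha> \<phi> x) (at x)"
    unfolding gauge_def gauge_deriv_def
    by (auto intro!: derivative_eq_intros d1 simp: algebra_simps)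
  have "(gauge_deriv \<alpha> \<phi> has_real_derivative
      (deriv (deriv \<phi>) x - 4 * \<alpha> * cos (2 * x) * \<phi> x - 2 * \<alpha> * sin (2 * x) * deriv \<phi> x
        - 2 * \<alpha> * sin (2 * x) * (deriv \<phi> x - 2 * \<alpha> * sin (2 * x) * \<phi> x)) * exp (\<alpha> * cos (2 * x))) (at x)"
    unfolding gauge_deriv_def
    by (auto intro!: derivative_eq_intros d1 d2 simp: algebra_simps)
  moreover have "(deriv (deriv \<phi>) x - 4 * \<alpha> * cos (2 * x) * \<phi> x - 2 * \<alpha> * sin (2 * x) * deriv \<phi> x
        - 2 * \<alpha> * sin (2 * x) * (deriv \<phi> x - 2 * \<alpha> * sin (2 * x) * \<phi> x)) * exp (\<alpha> * cos (2 * x))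
      = (hill_potential \<alpha> s x - (\<mu> - 2 * \<alpha>\<^sup>2)) * gauge \<alpha> \<phi> x"
    unfolding \<phi>'' hill_potential_def c4 gauge_def by (simp add: algebra_simps power2_eq_square)
  ultimately show "(gauge_deriv \<alpha> \<phi> has_real_derivative (hill_potential \<alpha> s x - (\<mu> - 2 * \<alpha>\<^sup>2)) * gauge \<alpha> \<phi> x) (at x)"
    by simp
qed

section \<open>Parity parts of eigenfunctions and their rotation numbers\<close>

definition parity_sign :: "bool \<Rightarrow> real" where
  "parity_sign t = (if t then 1 else - 1)"

definition parity_part :: "bool \<Rightarrow> (real \<Rightarrow> real) \<Rightarrow> real \<Rightarrow> real" where
  "parity_part t f x = (f x + parity_sign t * f (- x)) / 2"

lemma gauge_parity_part: "gauge \<alpha> (parity_part t \<phi>) = parity_part t (gauge \<alpha> \<phi>)"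
  by (auto simp: gauge_def parity_part_def algebra_simps add_divide_distrib)

lemma parity_parts: "f x = parity_part t f x + parity_part (\<not> t) f x"
  by (cases t) (simp_all add: parity_part_def parity_sign_def field_simps)

text \<open>Reflection maps solutions to solutions because the potential is even, and
  differentiation reverses parity.\<close>

lemma parity_part_solves:
  assumes du: "\<And>x. (u has_real_derivative v x) (at x)"
    and dv: "\<And>x. (v has_real_derivative (V x - l) * u x) (at x)" and V: "\<And>x. V (- x) = V x"
  shows "(parity_part t u has_real_derivative parity_part (\<not> t) v x) (at x)"
    and "(parity_part (\<not> t) v has_real_derivative (V x - l) * parity_part t u x) (at x)"
proof -
  have du': "((\<lambda>x. u (- x)) has_real_derivative - v (- x)) (at x)"
    using DERIV_chain2[OF du DERIV_minus[OF DERIV_ident]] by simp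
  have dv': "((\<lambda>x. v (- x)) has_real_derivative - ((V x - l) * u (- x))) (at x)"
    using DERIV_chain2[OF dv DERIV_minus[OF DERIV_ident]] V by simp
  have 1: "((\<lambda>x. (u x + parity_sign t * u (- x)) / 2) has_real_derivative
      (v x + parity_sign t * - v (- x)) / 2) (at x)"
    by (intro DERIV_cdivide DERIV_add DERIV_cmult du du')
  show "(parity_part t u has_real_derivative parity_part (\<not> t) v x) (at x)"
    using 1 unfolding parity_part_def[abs_def] by (cases t) (simp_all add: parity_sign_def)
  have 2: "((\<lambda>x. (v x + parity_sign (\<not> t) * v (- x)) / 2) has_real_derivative
      ((V x - l) * u x + parity_sign (\<not> t) * - ((V x - l) * u (- x))) / 2) (at x)"
    by (intro DERIV_cdivide DERIV_add DERIV_cmult dv dv')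
  have "((V x - l) * u x + parity_sign (\<not> t) * - ((V x - l) * u (- x))) / 2 = (V x - l) * parity_part t u x"
    by (cases t) (simp_all add: parity_sign_def parity_part_def field_simps)
  with 2 show "(parity_part (\<not> t) v has_real_derivative (V x - l) * parity_part t u x) (at x)"
    unfolding parity_part_def[of "\<not> t", abs_def] by (simp only:)
qed

lemma gauge_shift:
  assumes "1 \<le> s" "\<phi> \<in> trig_space s"
  shows "gauge \<alpha> \<phi> (x + pi) = (- 1) ^ (s - 1) * gauge \<alpha> \<phi> x"
proof -
  have "cos (2 * (x + pi)) = cos (2 * x)"
    using cos_periodic[of "2 * x"] by (simp add: algebra_simps)
  then show ?thesis
    using trig_space_shift[OF assms, of x] by (simp add: gauge_def)
qed

lemma deriv_shift:
  fixes u v :: "real \<Rightarrow> real"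
  assumes du: "\<And>x. (u has_real_derivative v x) (at x)" and u: "\<And>x. u (x + p) = k * u x"
  shows "v (x + p) = k * v x"
proof -
  have "((\<lambda>x. u (x + p)) has_real_derivative v (x + p)) (at x)"
    using DERIV_shift[of u "v (x + p)" x p] du by simp
  moreover have "((\<lambda>x. u (x + p)) has_real_derivative k * v x) (at x)"
    unfolding u by (intro DERIV_cmult du)
  ultimately show ?thesis by (rule DERIV_unique)
qed

text \<open>Stated for a parity part because the eigenfunction itself is not yet known to have a
  parity. The factor (-1)^(s-1) under translation by pi fixes the number of half turns modulo 2, and
  the zeros of the part bound it from above.\<close>

lemma eigenfunction_part_rotation:
  assumes s: "1 \<le> s" and eig: "is_eigenfunction \<alpha> s \<mu> \<phi>" and nz: "parity_part t \<phi> \<noteq> (\<lambda>x. 0)"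
  shows "\<exists>n::int. prufer_rotation (hill_potential \<alpha> s) (\<mu> - 2 * \<alpha>\<^sup>2) t (of_int n)
    \<and> n \<le> int s - 1 \<and> even (n - (int s - 1))"
proof -
  define f where "f = parity_part t \<phi>"
  define u where "u = gauge \<alpha> f"
  define v where "v = parity_part (\<not> t) (gauge_deriv \<alpha> \<phi>)"
  define \<kappa> :: real where "\<kappa> = (- 1) ^ (s - 1)"
  let ?V = "hill_potential \<alpha> s" and ?l = "\<mu> - 2 * \<alpha>\<^sup>2"
  have f: "f \<in> trig_space s"
    using eig trig_space_part[of \<phi> s "parity_sign t"]
    by (simp add: f_def parity_part_def[abs_def] is_eigenfunction_def)
  note zeros = cis_poly_zeros[OF trig_space_cis_poly[OF s f] nz[folded f_def]]
  have du: "(u has_real_derivative v x) (at x)" and dv: "(v has_real_derivative (?V x - ?l) * u x) (at x)" for x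
    unfolding u_def f_def v_def gauge_parity_part
    by (rule parity_part_solves[OF eigenfunction_solves[OF eig] hill_potential_even])+
  note du' = has_field_derivative_at_within[OF du] and dv' = has_field_derivative_at_within[OF dv]
  have u_zero: "u x = 0 \<longleftrightarrow> f x = 0" for x
    by (simp add: u_def gauge_def)
  have bc0: "bc t (u 0) (v 0)"
    by (simp add: bc_def u_def v_def f_def gauge_def parity_part_def parity_sign_def)
  have nz0: "u 0 \<noteq> 0 \<or> v 0 \<noteq> 0"
  proof (rule ccontr)
    assume *: "\<not> ?thesis"
    have "f x = 0" if x: "x \<in> {0..<pi}" for x
    proof -
      have "u x = 0 \<and> v x = 0"
        using linear_ode_zero[of pi ?V u v ?l 0 x] hill_potential_continuous du' dv' * x by simp
      then show ?thesis using u_zero by blast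
    qed
    then have "{x \<in> {0..<pi}. f x = 0} = {0..<pi}" by auto
    with zeros have "finite {0..<pi}" by simp
    with infinite_Ico[OF pi_gt_zero] show False by contradiction
  qed
  have u_shift: "u (x + pi) = \<kappa> * u x" for x
    unfolding u_def \<kappa>_def by (rule gauge_shift[OF s f])
  have shift: "u pi = \<kappa> * u 0" "v pi = \<kappa> * v 0"
    using u_shift[of 0] deriv_shift[OF du u_shift, of 0] by simp_all
  have \<kappa>: "\<kappa>\<^sup>2 = 1"
    by (simp add: \<kappa>_def power_mult[symmetric] mult.commute)
  obtain \<theta> \<rho> e where \<theta>: "prufer (\<lambda>_. 0) ?V ?l pi \<theta>" "\<theta> 0 = start_angle t"
    "\<And>x. x \<in> {0..pi} \<Longrightarrow> u x = \<rho> x * cos (\<theta> x)" "\<And>x. x \<in> {0..pi} \<Longrightarrow> v x = \<rho> x * sin (\<theta> x)"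
    "\<And>x. x \<in> {0..pi} \<Longrightarrow> e * \<rho> x > 0"
    by (rule prufer_angle_exists[OF hill_potential_continuous pi_ge_zero du' dv' nz0 bc0]) (rule that, assumption+)
  have mem: "0 \<in> {0..pi}" "pi \<in> {0..pi}" by auto
  have sq: "(\<rho> x)\<^sup>2 = (u x)\<^sup>2 + (v x)\<^sup>2" if "x \<in> {0..pi}" for x
  proof -
    have "(u x)\<^sup>2 + (v x)\<^sup>2 = (\<rho> x)\<^sup>2 * ((cos (\<theta> x))\<^sup>2 + (sin (\<theta> x))\<^sup>2)"
      by (simp only: \<theta>(3)[OF that] \<theta>(4)[OF that] power_mult_distrib distrib_left)
    then show ?thesis by simp
  qed
  have "(\<rho> pi)\<^sup>2 = (\<rho> 0)\<^sup>2"
    unfolding sq[OF mem(1)] sq[OF mem(2)] shift power_mult_distrib \<kappa> by simp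
  \<comment> \<open>The radius has constant sign, which rules out the second alternative.\<close>
  then have "\<rho> pi = \<rho> 0 \<or> \<rho> pi = - \<rho> 0"
    by (simp add: power2_eq_iff)
  then have \<rho>: "\<rho> pi = \<rho> 0"
    using \<theta>(5)[OF mem(1)] \<theta>(5)[OF mem(2)] by auto
  have "\<rho> 0 \<noteq> 0" using \<theta>(5)[OF mem(1)] by auto
  have cs: "cos (\<theta> pi) = \<kappa> * cos (\<theta> 0)" "sin (\<theta> pi) = \<kappa> * sin (\<theta> 0)"
  proof -
    have "\<rho> 0 * cos (\<theta> pi) = \<rho> 0 * (\<kappa> * cos (\<theta> 0))" "\<rho> 0 * sin (\<theta> pi) = \<rho> 0 * (\<kappa> * sin (\<theta> 0))"
      using shift unfolding \<theta>(3,4)[OF mem(1)] \<theta>(3,4)[OF mem(2)] \<rho> by (simp_all only: mult_ac)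
    then show "cos (\<theta> pi) = \<kappa> * cos (\<theta> 0)" "sin (\<theta> pi) = \<kappa> * sin (\<theta> 0)"
      using \<open>\<rho> 0 \<noteq> 0\<close> by (simp_all only: mult_cancel_left simp_thms)
  qed
  have "cos (\<theta> pi - \<theta> 0) = \<kappa> * ((cos (\<theta> 0))\<^sup>2 + (sin (\<theta> 0))\<^sup>2)"
    unfolding cos_diff cs power2_eq_square distrib_left by (simp only: mult_ac)
  then have cosd: "cos (\<theta> pi - \<theta> 0) = \<kappa>" by simp
  have "\<exists>n::int. \<theta> pi = \<theta> 0 - pi * of_int n \<and> even (n - (int s - 1))"
  proof (cases "odd s")
    case True
    then have "cos (\<theta> pi - \<theta> 0) = 1" using cosd by (simp add: \<kappa>_def)
    then obtain i :: int where "\<theta> pi - \<theta> 0 = of_int i * 2 * pi"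
      by (auto simp: cos_one_2pi_int)
    with True show ?thesis
      by (intro exI[of _ "- 2 * i"]) (auto simp: algebra_simps)
  next
    case False
    then have "odd (s - 1)" using s by simp
    then have "cos (\<theta> pi - \<theta> 0 + pi) = 1" using cosd by (simp add: \<kappa>_def)
    then obtain i :: int where "\<theta> pi - \<theta> 0 + pi = of_int i * 2 * pi"
      by (auto simp only: cos_one_2pi_int)
    with False show ?thesis
      by (intro exI[of _ "1 - 2 * i"]) (auto simp: algebra_simps)
  qed
  then obtain n :: int where n: "\<theta> pi = \<theta> 0 - pi * of_int n" "even (n - (int s - 1))" by blast
  have "n \<le> int s - 1"
  proof -
    have cont: "continuous_on {0..pi} \<theta>"
      using \<theta>(1) by (auto simp: prufer_def intro: DERIV_continuous_on)
    \<comment> \<open>Each level is an angle with vanishing cosine, at most the start angle and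
      strictly above the final one. So it is attained before pi, and distinct levels give distinct
      zeros in the half-open interval.\<close>
    have "\<exists>x\<in>{0..<pi}. \<theta> x = - (pi / 2) - pi * real j" if "j < nat n" for j
    proof -
      have "pi * real (Suc j) \<le> pi * of_int n"
        using that by (intro mult_left_mono) auto
      then have j: "pi * real j + pi \<le> pi * of_int n" by (simp add: algebra_simps)
      have "0 \<le> pi * real j" by simp
      moreover have "- (pi / 2) \<le> start_angle t" "start_angle t \<le> 0" by (simp_all add: start_angle_def)
      ultimately have le: "\<theta> pi < - (pi / 2) - pi * real j" "- (pi / 2) - pi * real j \<le> \<theta> 0"
        using n(1) \<theta>(2) j pi_gt_zero by linarith+
      have "\<exists>x. 0 \<le> x \<and> x \<le> pi \<and> \<theta> x = - (pi / 2) - pi * real j"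
        by (rule IVT2'[OF less_imp_le[OF le(1)] le(2) pi_ge_zero cont])
      then obtain x where x: "0 \<le> x" "x \<le> pi" "\<theta> x = - (pi / 2) - pi * real j" by (elim exE conjE)
      then have "x \<noteq> pi" using le(1) by (metis less_irrefl)
      with x show ?thesis by (intro bexI[of _ x]) simp_all
    qed
    then obtain X where X: "\<And>j. j < nat n \<Longrightarrow> X j \<in> {0..<pi} \<and> \<theta> (X j) = - (pi / 2) - pi * real j"
      by metis
    have inj: "inj_on X {..<nat n}"
    proof (rule inj_onI)
      fix i j assume ij: "i \<in> {..<nat n}" "j \<in> {..<nat n}" "X i = X j"
      have "- (pi / 2) - pi * real i = - (pi / 2) - pi * real j"
        using X[of i] X[of j] ij by (metis lessThan_iff)
      then show "i = j" by simp
    qed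
    have sub: "X ` {..<nat n} \<subseteq> {x \<in> {0..<pi}. f x = 0}"
    proof
      fix x assume "x \<in> X ` {..<nat n}"
      then obtain j where j: "j < nat n" "x = X j" by blast
      then have x: "x \<in> {0..<pi}" "\<theta> x = - (pi / 2) - pi * real j" using X[OF j(1)] by simp_all
      have "- (pi / 2) - pi * real j = - (of_int (int j) * pi + pi / 2)"
        by (simp add: mult.commute)
      then have "cos (\<theta> x) = cos (of_int (int j) * pi + pi / 2)"
        unfolding x(2) by (simp only: cos_minus)
      also have "\<dots> = 0"
        unfolding cos_zero_iff_int2 by blast
      finally show "x \<in> {x \<in> {0..<pi}. f x = 0}"
        using \<theta>(3)[of x] x(1) u_zero[of x] by simp
    qed
    have "card {..<nat n} \<le> card {x \<in> {0..<pi}. f x = 0}"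
      by (rule card_inj_on_le[OF inj sub conjunct1[OF zeros]])
    also have "\<dots> \<le> s - 1" by (rule conjunct2[OF zeros])
    finally have "nat n \<le> s - 1" by simp
    then show ?thesis using s by linarith
  qed
  with n \<theta>(1,2) show ?thesis
    unfolding prufer_rotation_def by (intro exI[of _ n] conjI exI[of _ \<theta>]) simp_all
qed

text \<open>Mixed types at the ends mean a rotation number k + 1/2. Comparison with the eigenvalue
  of the same type, and with the other one at a loss of 1/2, puts an integer strictly between two
  consecutive ones or makes k < n < k + 1/2.\<close>

lemma no_intermediate_solution:
  assumes V: "continuous_on {0..pi} V"
    and rot: "prufer_rotation V l\<^sub>1 t\<^sub>1 (of_int n)" "prufer_rotation V l\<^sub>2 t\<^sub>2 (of_int n)" "t\<^sub>1 \<noteq> t\<^sub>2"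
    and l: "l\<^sub>1 < l" "l < l\<^sub>2"
    and dy: "\<And>x. x \<in> {0..pi} \<Longrightarrow> (y has_real_derivative z x) (at x within {0..pi})"
    and dz: "\<And>x. x \<in> {0..pi} \<Longrightarrow> (z has_real_derivative (V x - l) * y x) (at x within {0..pi})"
    and nz: "y 0 \<noteq> 0 \<or> z 0 \<noteq> 0" and bc0: "bc t (y 0) (z 0)"
  shows "\<not> bc (\<not> t) (y pi) (z pi)"
proof
  assume bcpi: "bc (\<not> t) (y pi) (z pi)"
  obtain \<theta> \<rho> e where \<theta>: "prufer (\<lambda>_. 0) V l pi \<theta>" "\<theta> 0 = start_angle t"
    "\<And>x. x \<in> {0..pi} \<Longrightarrow> y x = \<rho> x * cos (\<theta> x)" "\<And>x. x \<in> {0..pi} \<Longrightarrow> z x = \<rho> x * sin (\<theta> x)"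
    "\<And>x. x \<in> {0..pi} \<Longrightarrow> e * \<rho> x > 0"
    by (rule prufer_angle_exists[OF V pi_ge_zero dy dz nz bc0]) (assumption, assumption, rule that, assumption+)
  have mem: "pi \<in> {0..pi}" by simp
  have \<rho>: "\<rho> pi \<noteq> 0" using \<theta>(5)[OF mem] by auto
  have "\<exists>k::int. \<theta> pi = start_angle t - pi * (of_int k + 1 / 2)"
  proof (cases t)
    case True
    then have "cos (\<theta> pi) = 0" using bcpi \<rho> \<theta>(3)[OF mem] by (simp add: bc_def)
    then obtain i :: int where "\<theta> pi = of_int i * pi + pi / 2" by (auto simp: cos_zero_iff_int2)
    with True show ?thesis
      by (intro exI[of _ "- i - 1"]) (simp add: start_angle_def algebra_simps)
  next
    case False
    then have "sin (\<theta> pi) = 0" using bcpi \<rho> \<theta>(4)[OF mem] by (simp add: bc_def)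
    then obtain i :: int where "\<theta> pi = of_int i * pi" by (auto simp: sin_zero_iff_int2)
    with False show ?thesis
      by (intro exI[of _ "- i - 1"]) (simp add: start_angle_def algebra_simps)
  qed
  then obtain k :: int where "prufer_rotation V l t (of_int k + 1 / 2)"
    using \<theta>(1,2) unfolding prufer_rotation_def by metis
  note k = this
  show False
  proof (cases "t = t\<^sub>1")
    case True
    have "of_int n < of_int k + (1 / 2 :: real)"
      using prufer_rotation_less[OF V _ k l(1)] rot(1) True by simp
    moreover have "of_int k + 1 / 2 - 1 / 2 < (of_int n :: real)"
      using prufer_rotation_less_half[OF V k rot(2) l(2)] .
    ultimately have "k < n" "of_int n < (of_int (k + 1) :: real)" by simp_all
    then show False by (simp only: of_int_less_iff)
  next
    case False
    then have "t = t\<^sub>2" using rot(3) by blast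
    then have "of_int k + 1 / 2 < (of_int n :: real)"
      using prufer_rotation_less[OF V k _ l(2)] rot(2) by simp
    moreover have "of_int n - 1 / 2 < of_int k + (1 / 2 :: real)"
      using prufer_rotation_less_half[OF V rot(1) k l(1)] .
    ultimately have "of_int k < (of_int n :: real)" "of_int n < (of_int (k + 1) :: real)" by simp_all
    then show False by (simp only: of_int_less_iff)
  qed
qed

section \<open>Counting rotation numbers and assembling clusters\<close>

text \<open>The possible values are 0, 2, ..., 2m or 1, 3, ..., 2m - 1, each for at most one index
  of each type, and 0 only for the type \<open>True\<close>. There are as many places as indices, so
  all are filled. The proof obtains this from a lower and an upper bound that meet.\<close>

lemma rotation_numbers:
  fixes n :: "nat \<Rightarrow> int" and t :: "nat \<Rightarrow> bool"
  assumes s: "1 \<le> s"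
    and par: "\<And>i. i \<in> index_set s \<Longrightarrow> even (n i - (int s - 1))"
    and upper: "\<And>i. i \<in> index_set s \<Longrightarrow> n i \<le> int s - 1"
    and lower: "\<And>i. i \<in> index_set s \<Longrightarrow> 0 \<le> n i" "\<And>i. i \<in> index_set s \<Longrightarrow> \<not> t i \<Longrightarrow> 0 < n i"
    and mono: "\<And>i j. i \<in> index_set s \<Longrightarrow> j \<in> index_set s \<Longrightarrow> i < j \<Longrightarrow> n i \<le> n j"
    and strict: "\<And>i j. i \<in> index_set s \<Longrightarrow> j \<in> index_set s \<Longrightarrow> i < j \<Longrightarrow> t i = t j \<Longrightarrow> n i < n j"
  shows "\<And>j. 1 \<le> j \<Longrightarrow> j \<le> s div 2 \<Longrightarrow> n (2 * j - 1) = n (2 * j) \<and> t (2 * j - 1) \<noteq> t (2 * j)"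
    and "odd s \<Longrightarrow> t 0"
proof -
  define m where "m = s div 2"
  have idx: "i \<in> index_set s" if "1 \<le> i" "i \<le> 2 * m" for i
    using that by (auto simp: index_set_def m_def)
  have two: "n i + 2 \<le> n j" if "i \<in> index_set s" "j \<in> index_set s" "n i < n j" for i j
  proof -
    have "even (n i - (int s - 1))" "even (n j - (int s - 1))" using par that by auto
    then have "even (n j - n i)" by (simp add: even_diff)
    with that(3) show ?thesis by presburger
  qed
  \<comment> \<open>Among three consecutive indices two have the same type, so there is a strict
    increase over two steps, and by parity it is at least 2.\<close>
  have two_apart: "n i + 2 \<le> n (i + 2)" if "i \<in> index_set s" "i + 2 \<le> 2 * m" for i
  proof -
    have i: "i + 1 \<in> index_set s" "i + 2 \<in> index_set s" using idx that(2) by auto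
    have "n i < n (i + 2)"
    proof (cases "t i = t (i + 2)")
      case True
      then show ?thesis using strict[OF that(1) i(2)] by simp
    next
      case False
      then have "t i = t (i + 1) \<or> t (i + 1) = t (i + 2)" by blast
      then show ?thesis
      proof
        assume "t i = t (i + 1)"
        then have "n i < n (i + 1)" using strict[OF that(1) i(1)] by simp
        also have "n (i + 1) \<le> n (i + 2)" using mono[OF i] by simp
        finally show ?thesis .
      next
        assume "t (i + 1) = t (i + 2)"
        then have "n (i + 1) < n (i + 2)" using strict[OF i] by simp
        moreover have "n i \<le> n (i + 1)" using mono[OF that(1) i(1)] by simp
        ultimately show ?thesis by linarith
      qed
    qed
    then show ?thesis using two[OF that(1) i(2)] by simp
  qed
  \<comment> \<open>With this \<open>e\<close> the largest value s - 1 is 2m - e; ascending from the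
    bottom and descending from the top in steps of 2 both arrive at 2j - e for the j-th
    pair.\<close>
  define e :: int where "e = (if odd s then 0 else 1)"
  have s_eq: "int s - 1 = 2 * int m - e"
    unfolding e_def m_def by (cases "odd s") (auto elim!: oddE evenE)
  have low: "2 * int j - e \<le> n (2 * j - 1)" if "1 \<le> j" "j \<le> m" for j
    using that
  proof (induction j rule: dec_induct)
    case base
    have 1: "1 \<in> index_set s" using idx[of 1] base by simp
    show ?case
    proof (cases "odd s")
      case False
      then have "odd (n 1)" using par[OF 1] s by presburger
      then have "n 1 \<noteq> 0" by auto
      then show ?thesis using lower(1)[OF 1] False by (simp add: e_def)
    next
      case True
      then have 0: "0 \<in> index_set s" by (simp add: index_set_def)
      have "0 < n 1"
      proof (cases "t 1 \<and> t 0")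
        case True
        then show ?thesis using strict[OF 0 1] lower(1)[OF 0] by simp
      next
        case False
        then show ?thesis
          using lower(2)[OF 0] lower(2)[OF 1] mono[OF 0 1] by force
      qed
      moreover have "even (n 1)" using par[OF 1] True by presburger
      ultimately have "2 \<le> n 1" by presburger
      then show ?thesis using True by (simp add: e_def)
    qed
  next
    case (step j)
    have "n (2 * j - 1) + 2 \<le> n (2 * j - 1 + 2)"
      using step.prems step.hyps by (intro two_apart idx) auto
    moreover have "2 * j - 1 + 2 = 2 * Suc j - 1" using step.hyps by simp
    ultimately show ?case using step.IH step.prems by simp
  qed
  have high: "n (2 * j) \<le> 2 * int j - e" if "1 \<le> j" "j \<le> m" for j
    using that(2,1)
  proof (induction j rule: inc_induct)
    case base
    then show ?case using upper[OF idx[of "2 * m"]] s_eq by simp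
  next
    case (step j)
    have "n (2 * j) + 2 \<le> n (2 * j + 2)"
      using step.prems step.hyps by (intro two_apart idx) auto
    then show ?case using step.IH by simp
  qed
  show pair: "n (2 * j - 1) = n (2 * j) \<and> t (2 * j - 1) \<noteq> t (2 * j)" if "1 \<le> j" "j \<le> s div 2" for j
  proof -
    have j: "1 \<le> j" "j \<le> m" using that by (auto simp: m_def)
    have i: "2 * j - 1 \<in> index_set s" "2 * j \<in> index_set s" using idx j by auto
    have "n (2 * j - 1) = n (2 * j)"
      using low[OF j] high[OF j] mono[OF i] j by simp
    with strict[OF i] j show ?thesis by auto
  qed
  show "t 0" if "odd s"
  proof (rule ccontr)
    assume "\<not> t 0"
    have 0: "0 \<in> index_set s" using that by (simp add: index_set_def)
    \<comment> \<open>An odd type at index 0 forces a positive value there, which leaves no room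
      below the bound for index 2.\<close>
    have n0: "0 < n 0" using lower(2)[OF 0] \<open>\<not> t 0\<close> .
    show False
    proof (cases "m = 0")
      case True
      then show False using upper[OF 0] n0 s_eq that by (simp add: e_def)
    next
      case False
      then have "n 0 + 2 \<le> n (0 + 2)" by (intro two_apart[OF 0]) simp
      then have "n 0 + 2 \<le> n 2" by (simp only: add_0)
      moreover have "n 2 \<le> 2" using high[of 1] False that by (simp add: e_def)
      ultimately show False using n0 by simp
    qed
  qed
qed

lemma cluster_subsetI:
  assumes I: "I \<subseteq> index_set s"
    and pair: "\<And>j. 1 \<le> j \<Longrightarrow> j \<le> s div 2 \<Longrightarrow> 2 * j - 1 \<in> I \<longleftrightarrow> 2 * j \<in> I"
  shows "cluster_subset s I"
  unfolding cluster_subset_def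
proof (intro exI[of _ "{C \<in> clusters s. C \<subseteq> I}"] conjI)
  show "I = \<Union> {C \<in> clusters s. C \<subseteq> I}"
  proof (intro equalityI subsetI)
    fix i assume i: "i \<in> I"
    show "i \<in> \<Union> {C \<in> clusters s. C \<subseteq> I}"
    proof (cases "i = 0")
      case True
      then have "{0} \<in> clusters s"
        using i I by (auto simp: index_set_def clusters_def split: if_splits)
      with i True show ?thesis by blast
    next
      case False
      define j where "j = (i + 1) div 2"
      have "i \<le> 2 * (s div 2)" using i I by (auto simp: index_set_def split: if_splits)
      then have j: "1 \<le> j" "j \<le> s div 2" "i = 2 * j - 1 \<or> i = 2 * j"
        using False unfolding j_def by presburger+
      then have "{2 * j - 1, 2 * j} \<subseteq> I" using pair[OF j(1,2)] i by auto
      moreover have "{2 * j - 1, 2 * j} \<in> clusters s" using j by (auto simp: clusters_def)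
      moreover have "i \<in> {2 * j - 1, 2 * j}" using j by auto
      ultimately show ?thesis by blast
    qed
  qed auto
qed auto

theorem corollary1:
  fixes s :: nat and \<alpha> :: real and \<nu> :: "nat \<Rightarrow> real"
    and \<phi> \<psi> :: "nat \<Rightarrow> real \<Rightarrow> real" and I :: "nat set"
  assumes "s \<ge> 1" and "\<alpha> > 0"
    and "strict_mono_on (index_set s) \<nu>" and "\<nu> ` index_set s = eigenvalues \<alpha> s"
    and "\<And>i. i \<in> index_set s \<Longrightarrow> is_eigenfunction \<alpha> s (\<nu> i) (\<phi> i)"
    and "\<And>i. i \<in> index_set s \<Longrightarrow> \<psi> i = (\<lambda>x. \<phi> i x * exp (\<alpha> * cos (2 * x)))"
    and "I \<noteq> {}" and "I \<subseteq> index_set s"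
    and "\<forall>x. wronskian (map \<psi> (sorted_list_of_set I)) x \<noteq> 0"
  shows "cluster_subset s I"
proof -
  let ?V = "hill_potential \<alpha> s"
  define lam where "lam i = \<nu> i - 2 * \<alpha>\<^sup>2" for i
  note s = assms(1) and eig = assms(5)
  have V: "continuous_on {0..pi} ?V" by (rule hill_potential_continuous)
  have lam_less: "lam i < lam j \<longleftrightarrow> i < j" if "i \<in> index_set s" "j \<in> index_set s" for i j
    using strict_mono_on_less[OF assms(3) that] by (simp add: lam_def)
  \<comment> \<open>The count is made for every choice \<open>t\<close> of a nonzero parity part of
    each eigenfunction, because it is used for two choices: once to find the types and once to show
    that they are unique.\<close>
  have rotations: "\<exists>n. (\<forall>i\<in>index_set s. prufer_rotation ?V (lam i) (t i) (of_int (n i)))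
      \<and> (\<forall>j. 1 \<le> j \<longrightarrow> j \<le> s div 2 \<longrightarrow> n (2 * j - 1) = n (2 * j) \<and> t (2 * j - 1) \<noteq> t (2 * j))
      \<and> (odd s \<longrightarrow> t 0)"
    if t: "\<forall>i\<in>index_set s. parity_part (t i) (\<phi> i) \<noteq> (\<lambda>x. 0)" for t
  proof -
    have "\<forall>i\<in>index_set s. \<exists>n::int. prufer_rotation ?V (lam i) (t i) (of_int n)
        \<and> n \<le> int s - 1 \<and> even (n - (int s - 1))"
    proof
      fix i assume i: "i \<in> index_set s"
      show "\<exists>n::int. prufer_rotation ?V (lam i) (t i) (of_int n) \<and> n \<le> int s - 1 \<and> even (n - (int s - 1))"
        unfolding lam_def by (rule eigenfunction_part_rotation[OF s eig[OF i] bspec[OF t i]])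
    qed
    from bchoice[OF this] obtain n :: "nat \<Rightarrow> int"
      where "\<forall>i\<in>index_set s. prufer_rotation ?V (lam i) (t i) (of_int (n i))
        \<and> n i \<le> int s - 1 \<and> even (n i - (int s - 1))" ..
    then have n: "\<And>i. i \<in> index_set s \<Longrightarrow> prufer_rotation ?V (lam i) (t i) (of_int (n i))"
      "\<And>i. i \<in> index_set s \<Longrightarrow> n i \<le> int s - 1" "\<And>i. i \<in> index_set s \<Longrightarrow> even (n i - (int s - 1))"
      by blast+
    have lower: "0 \<le> n i" "\<not> t i \<Longrightarrow> 0 < n i" if i: "i \<in> index_set s" for i
    proof -
      note r = prufer_rotation_lower[OF V n(1)[OF i]]
      have "of_int (- 1) < (of_int (n i) :: real)"
        using r by (cases "t i") simp_all
      then show "0 \<le> n i" by (simp only: of_int_less_iff)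
      show "0 < n i" if "\<not> t i" using r that by simp
    qed
    have mono: "n i \<le> n j" if ij: "i \<in> index_set s" "j \<in> index_set s" "i < j" for i j
    proof -
      have "lam i < lam j" using lam_less[OF ij(1,2)] ij(3) by blast
      from prufer_rotation_less_half[OF V n(1)[OF ij(1)] n(1)[OF ij(2)] this]
      have "of_int (n i) < (of_int (n j + 1) :: real)" by simp
      then show ?thesis by (simp only: of_int_less_iff zless_add1_eq le_less)
    qed
    have strict: "n i < n j" if ij: "i \<in> index_set s" "j \<in> index_set s" "i < j" "t i = t j" for i j
    proof -
      have l: "lam i < lam j" using lam_less[OF ij(1,2)] ij(3) by blast
      have r: "prufer_rotation ?V (lam j) (t i) (of_int (n j))"
        unfolding ij(4) by (rule n(1)[OF ij(2)])
      have "of_int (n i) < (of_int (n j) :: real)"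
        by (rule prufer_rotation_less[OF V n(1)[OF ij(1)] r l])
      then show ?thesis by (simp only: of_int_less_iff)
    qed
    have rn: "n (2 * j - 1) = n (2 * j) \<and> t (2 * j - 1) \<noteq> t (2 * j)" if "1 \<le> j" "j \<le> s div 2" for j
      by (rule rotation_numbers(1)[of s n t]; fact s n(3) n(2) lower mono strict that)
    show ?thesis
    proof (intro exI[of _ n] conjI ballI allI impI)
      show "prufer_rotation ?V (lam i) (t i) (of_int (n i))" if "i \<in> index_set s" for i
        by (rule n(1)[OF that])
      show "n (2 * j - 1) = n (2 * j)" "t (2 * j - 1) \<noteq> t (2 * j)" if "1 \<le> j" "j \<le> s div 2" for j
        using rn[OF that] by simp_all
      show "t 0" if "odd s"
        by (rule rotation_numbers(2)[of s n t]; fact s n(3) n(2) lower mono strict that)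
    qed
  qed
  \<comment> \<open>The even part is taken whenever it is nonzero, even if the odd part were nonzero
    as well; this possibility is excluded next.\<close>
  define \<tau> where "\<tau> i = (parity_part True (\<phi> i) \<noteq> (\<lambda>x. 0))" for i
  have \<tau>: "\<forall>i\<in>index_set s. parity_part (\<tau> i) (\<phi> i) \<noteq> (\<lambda>x. 0)"
  proof (intro ballI notI)
    fix i assume i: "i \<in> index_set s" and *: "parity_part (\<tau> i) (\<phi> i) = (\<lambda>x. 0)"
    show False
    proof (cases "\<tau> i")
      case True
      then show False using * by (simp add: \<tau>_def)
    next
      case False
      then have "parity_part True (\<phi> i) = (\<lambda>x. 0)" by (simp add: \<tau>_def)
      moreover have "parity_part (\<not> True) (\<phi> i) = (\<lambda>x. 0)" using * False by simp
      ultimately have "\<phi> i x = 0" for x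
        unfolding parity_parts[of "\<phi> i" x True] by simp
      then show False using eig[OF i] by (auto simp: is_eigenfunction_def)
    qed
  qed
  from rotations[OF \<tau>] obtain n :: "nat \<Rightarrow> int"
    where "(\<forall>i\<in>index_set s. prufer_rotation ?V (lam i) (\<tau> i) (of_int (n i)))
      \<and> (\<forall>j. 1 \<le> j \<longrightarrow> j \<le> s div 2 \<longrightarrow> n (2 * j - 1) = n (2 * j) \<and> \<tau> (2 * j - 1) \<noteq> \<tau> (2 * j))
      \<and> (odd s \<longrightarrow> \<tau> 0)" ..
  then have n: "\<And>i. i \<in> index_set s \<Longrightarrow> prufer_rotation ?V (lam i) (\<tau> i) (of_int (n i))"
      "\<And>j. 1 \<le> j \<Longrightarrow> j \<le> s div 2 \<Longrightarrow> n (2 * j - 1) = n (2 * j) \<and> \<tau> (2 * j - 1) \<noteq> \<tau> (2 * j)"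
      "odd s \<Longrightarrow> \<tau> 0"
    by blast+
  \<comment> \<open>If both parts were nonzero, the type of this single index could be reversed and
    the count repeated. But it forces opposite types in each pair, and type \<open>True\<close> at
    index 0, for either choice.\<close>
  have pure: "parity_part (\<not> \<tau> i) (\<phi> i) = (\<lambda>x. 0)" if i: "i \<in> index_set s" for i
  proof (rule ccontr)
    assume nz: "parity_part (\<not> \<tau> i) (\<phi> i) \<noteq> (\<lambda>x. 0)"
    define t where "t = \<tau>(i := \<not> \<tau> i)"
    have "\<forall>j\<in>index_set s. parity_part (t j) (\<phi> j) \<noteq> (\<lambda>x. 0)"
      using \<tau> nz by (simp add: t_def)
    from rotations[OF this] have t: "1 \<le> j \<Longrightarrow> j \<le> s div 2 \<Longrightarrow> t (2 * j - 1) \<noteq> t (2 * j)" "odd s \<Longrightarrow> t 0" for j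
      by (elim exE conjE; simp)+
    show False
    proof (cases "i = 0")
      case True
      then have "odd s" using i by (auto simp: index_set_def split: if_splits)
      then show False using t(2) n(3) True by (simp add: t_def)
    next
      case False
      define j where "j = (i + 1) div 2"
      have "i \<le> 2 * (s div 2)" using i by (auto simp: index_set_def split: if_splits)
      then have j: "1 \<le> j" "j \<le> s div 2" "i = 2 * j - 1 \<or> i = 2 * j"
        using False unfolding j_def by presburger+
      have "2 * j - 1 \<noteq> 2 * j" using j(1) by simp
      then show False
        using t(1)[OF j(1,2)] n(2)[OF j(1,2)] j(3) by (auto simp: t_def)
    qed
  qed
  define W where "W i = gauge_deriv \<alpha> (\<phi> i)" for i
  have \<psi>: "\<psi> i = gauge \<alpha> (\<phi> i)" if "i \<in> index_set s" for i
    using assms(6)[OF that] by (auto simp: gauge_def)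
  have d\<psi>: "(\<psi> i has_real_derivative W i x) (at x)" "(W i has_real_derivative (?V x - lam i) * \<psi> i x) (at x)"
    if "i \<in> index_set s" for i x
    using eigenfunction_solves[OF eig[OF that]] unfolding W_def \<psi>[OF that] lam_def by blast+
  have sym: "\<psi> i x = parity_part (\<tau> i) (\<psi> i) x" if i: "i \<in> index_set s" for i x
  proof -
    have "\<phi> i = parity_part (\<tau> i) (\<phi> i)"
      by (rule ext) (subst parity_parts[of _ _ "\<tau> i"], simp add: pure[OF i])
    then show ?thesis
      unfolding \<psi>[OF i] gauge_parity_part[symmetric] by (rule arg_cong)
  qed
  have symW: "W i x = parity_part (\<not> \<tau> i) (W i) x" if i: "i \<in> index_set s" for i x
  proof -
    have sym_fun: "parity_part (\<tau> i) (\<psi> i) = \<psi> i"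
      by (rule ext) (rule sym[OF i, symmetric])
    have "(\<psi> i has_real_derivative parity_part (\<not> \<tau> i) (W i) x) (at x)"
      using parity_part_solves(1)[OF d\<psi>[OF i] hill_potential_even, of "\<tau> i" x]
      unfolding sym_fun .
    then show ?thesis
      by (rule DERIV_unique[OF d\<psi>(1)[OF i]])
  qed
  have bc0: "bc (\<tau> i) (\<psi> i 0) (W i 0)" if i: "i \<in> index_set s" for i
    using sym[OF i, of 0] symW[OF i, of 0]
    by (cases "\<tau> i") (simp_all add: bc_def parity_part_def parity_sign_def)
  have bcpi: "bc (\<tau> i) (\<psi> i pi) (W i pi)" if i: "i \<in> index_set s" for i
  proof -
    have "\<phi> i \<in> trig_space s" using eig[OF i] by (simp add: is_eigenfunction_def)
    then have sh: "\<psi> i (x + pi) = (- 1) ^ (s - 1) * \<psi> i x" for x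
      unfolding \<psi>[OF i] by (rule gauge_shift[OF s])
    have "\<psi> i pi = (- 1) ^ (s - 1) * \<psi> i 0" "W i pi = (- 1) ^ (s - 1) * W i 0"
      using sh[of 0] deriv_shift[OF d\<psi>(1)[OF i] sh, of 0] by simp_all
    with bc0[OF i] show ?thesis by (simp add: bc_def)
  qed
  have nz0: "\<psi> i 0 \<noteq> 0 \<or> W i 0 \<noteq> 0" if i: "i \<in> index_set s" for i
  proof (rule ccontr)
    assume *: "\<not> ?thesis"
    have f: "\<phi> i \<in> trig_space s" "\<phi> i \<noteq> (\<lambda>x. 0)" using eig[OF i] by (auto simp: is_eigenfunction_def)
    have "\<phi> i x = 0" if x: "x \<in> {0..<pi}" for x
    proof -
      have "\<psi> i x = 0 \<and> W i x = 0"
        using linear_ode_zero[of pi ?V "\<psi> i" "W i" "lam i" 0 x] V * x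
          has_field_derivative_at_within[OF d\<psi>(1)[OF i]] has_field_derivative_at_within[OF d\<psi>(2)[OF i]]
        by simp
      then show ?thesis unfolding \<psi>[OF i] by (simp add: gauge_def)
    qed
    then have "{x \<in> {0..<pi}. \<phi> i x = 0} = {0..<pi}" by auto
    with cis_poly_zeros[OF trig_space_cis_poly[OF s f(1)] f(2)] have "finite {0..<pi}" by simp
    with infinite_Ico[OF pi_gt_zero] show False by contradiction
  qed
  have fin: "finite I"
    using assms(8) by (rule finite_subset) (simp add: index_set_def)
  define ix where "ix = sorted_list_of_set I"
  define k where "k = length ix"
  have ix: "set ix = I" "distinct ix" using fin by (simp_all add: ix_def)
  have isq: "ix ! q \<in> I" "ix ! q \<in> index_set s" if "q < k" for q
    using nth_mem[of q "ix"] that ix(1) assms(8) by (auto simp: k_def)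
  have "1 \<le> k"
    using assms(7) ix(1) by (cases "ix") (auto simp: k_def)
  define U where "U q = \<psi> (ix ! q)" for q
  have "map U [0..<k] = map \<psi> ix"
    by (rule nth_equalityI) (auto simp: U_def k_def)
  then have wnz: "wronskian (map U [0..<k]) x \<noteq> 0" for x
    using assms(9) by (simp add: ix_def)
  obtain B where D: "darboux_ode k (\<lambda>q. lam (ix ! q)) U (\<lambda>q. W (ix ! q)) B ?V {0..pi}"
  proof (rule wronskian_nonzero_darboux_ode[OF hill_potential_trig_alg \<open>1 \<le> k\<close> pi_gt_zero])
    show "(U q has_real_derivative W (ix ! q) x) (at x)"
      "(W (ix ! q) has_real_derivative (?V x - lam (ix ! q)) * U q x) (at x)" if "q < k" for q x
      unfolding U_def by (rule d\<psi>[OF isq(2)[OF that]])+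
  qed (use wnz that in blast)+
  \<comment> \<open>\<open>a\<close> is the index inside \<open>I\<close> and \<open>b\<close> the
    one outside; stating this for an unordered pair covers both ways in which \<open>I\<close> can
    split a cluster.\<close>
  have contra: False
    if j: "1 \<le> j" "j \<le> s div 2" and ab: "{a, b} = {2 * j - 1, 2 * j}" "a \<in> I" "b \<notin> I" for j a b
  proof -
    have ixs: "2 * j - 1 \<in> index_set s" "2 * j \<in> index_set s"
    proof -
      obtain m where m: "m = s div 2" by blast
      have "j \<le> m" using j(2) by (simp only: m)
      then have "2 * j - 1 \<in> {1..2 * m}" "2 * j \<in> {1..2 * m}" "{1..2 * m} \<subseteq> {0..2 * m}"
        using j(1) by auto
      then show "2 * j - 1 \<in> index_set s" "2 * j \<in> index_set s"
        unfolding index_set_def m[symmetric] by (auto simp only: split: if_splits)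
    qed
    have abx: "a \<in> index_set s" "b \<in> index_set s"
      using ab ixs by (metis doubleton_eq_iff)+
    obtain q where q: "q < k" "ix ! q = a"
      using ab(2) ix(1) by (metis in_set_conv_nth k_def)
    have \<tau>ab: "\<tau> a \<noteq> \<tau> b"
      using n(2)[OF j] ab(1) by (auto simp: doubleton_eq_iff)
    show False
    proof (rule darboux_ode_contradiction[OF D pi_gt_zero, where \<tau> = "\<lambda>q. \<tau> (ix ! q)" and j = q and t = "\<tau> b"
        and l = "lam b" and l\<^sub>1 = "lam (2 * j - 1)" and l\<^sub>2 = "lam (2 * j)" and u = "\<psi> b" and v = "W b"])
      show "bc (\<tau> (ix ! p)) (U p 0) (W (ix ! p) 0) \<and> bc (\<tau> (ix ! p)) (U p pi) (W (ix ! p) pi)" if "p < k" for p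
        using bc0 bcpi isq(2)[OF that] by (simp add: U_def)
      show "U q 0 \<noteq> 0 \<or> W (ix ! q) 0 \<noteq> 0"
        using nz0[OF abx(1)] by (simp add: U_def q)
      show "lam (2 * j - 1) < lam (2 * j)"
        using lam_less[OF ixs] j by simp
      show "{lam (ix ! q), lam b} = {lam (2 * j - 1), lam (2 * j)}"
        using arg_cong[OF ab(1), of "\<lambda>S. lam ` S"] by (simp add: q)
      show "p = q" if p: "p < k" "lam (ix ! p) \<in> {lam (2 * j - 1)..lam (2 * j)}" for p
      proof -
        \<comment> \<open>The eigenvalues are ordered as their indices, so a column with eigenvalue
          in the closed interval has index 2j - 1 or 2j, and \<open>b\<close> is not in
          \<open>I\<close>.\<close>
        have "\<not> ix ! p < 2 * j - 1" "\<not> 2 * j < ix ! p"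
          using p lam_less[OF isq(2)[OF p(1)] ixs(1)] lam_less[OF ixs(2) isq(2)[OF p(1)]] by auto
        then have "ix ! p \<in> {a, b}"
          unfolding ab(1) using j by auto
        then have "ix ! p = a" using isq(1)[OF p(1)] ab(3) by auto
        then show ?thesis
          using ix(2) p(1) q by (metis k_def nth_eq_iff_index_eq)
      qed
      show "bc (\<tau> b) (\<psi> b 0) (W b 0)" "bc (\<tau> b) (\<psi> b pi) (W b pi)" "\<psi> b 0 \<noteq> 0 \<or> W b 0 \<noteq> 0"
        using bc0 bcpi nz0 abx by auto
      show "(\<psi> b has_real_derivative W b x) (at x within {0..pi})"
        "(W b has_real_derivative (?V x - lam b) * \<psi> b x) (at x within {0..pi})" for x
        using d\<psi>[OF abx(2)] by (auto intro: has_field_derivative_at_within)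
    next
      fix l y z
      assume l: "lam (2 * j - 1) < l" "l < lam (2 * j)"
        and d: "\<And>x. x \<in> {0..pi} \<Longrightarrow> (y has_real_derivative z x) (at x within {0..pi})"
          "\<And>x. x \<in> {0..pi} \<Longrightarrow> (z has_real_derivative (?V x - l) * y x) (at x within {0..pi})"
        and b: "y 0 \<noteq> 0 \<or> z 0 \<noteq> 0" "bc (\<tau> b) (y 0) (z 0)"
      have r: "prufer_rotation ?V (lam (2 * j)) (\<tau> (2 * j)) (of_int (n (2 * j - 1)))"
        using n(1)[OF ixs(2)] n(2)[OF j] by simp
      show "\<not> bc (\<not> \<tau> b) (y pi) (z pi)"
      proof (rule no_intermediate_solution[where y = y and z = z, OF V n(1)[OF ixs(1)] r _ l _ _ b])
        show "\<tau> (2 * j - 1) \<noteq> \<tau> (2 * j)" using n(2)[OF j] by blast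
      qed (fact d)+
    qed (use q \<tau>ab in auto)
  qed
  show ?thesis
  proof (rule cluster_subsetI[OF assms(8)])
    fix j assume j: "1 \<le> j" "j \<le> s div 2"
    show "2 * j - 1 \<in> I \<longleftrightarrow> 2 * j \<in> I"
      using contra[OF j, of "2 * j - 1" "2 * j"] contra[OF j, of "2 * j" "2 * j - 1"] by blast
  qed
qed

end
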